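(* Consider the delayed relay system with reflection symmetry and its colliding symmetric periodic orbit $L=(y_*,u_* )$ at the parameter $\lambda=\lambda_0$, as described in the context, with $\Delta>0$ sufficiently small. Let $\lambda$ be sufficiently close to $\lambda_0$. Then the return map $m$ for elements of the image $\operatorname{rg}P$ of the Poincaré map $P$ (the map sending the switching point $y$ of an element of $\operatorname{rg}P$ to the switching point of its image under $P$) is given by $m=F\circ F$, where $F:U(y_*(0))\to U(y_*(0))$ is defined by $$F(y)=-Y_+^{\tau+t(y)}y$$ and $t(y)\in(-\Delta,\Delta)$ is the unique time such that $$\epsilon=h\left(Y_-^{\,t(y)}y,\lambda\right)\ \text{ if } h(y,\lambda)\ge\epsilon,\qquad \epsilon=h\left(Y_+^{\,t(y)}y,\lambda\right)\ \text{ if } h(y,\lambda)<\epsilon .$$ Here each $U(y_*(0))\subset\mathbb{R}^n$ denotes a (sufficiently small) neighborhood of $y_*(0)$.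
   Context: System. Let $f(\cdot,\pm1,\cdot):\mathbb{R}^n\times\mathbb{R}\to\mathbb{R}^n$ and $h:\mathbb{R}^n\times\mathbb{R}\to\mathbb{R}$ be continuously differentiable in $(y,\lambda)$, with $f(\cdot,\pm1,\lambda)$ and $h(\cdot,\lambda)$ uniformly Lipschitz in $y$ and $h'=\partial_yh\ne0$ everywhere. Let $\epsilon>0$, $\tau>0$, and let $\Theta\ge\tau$ be an upper bound for the delay $\tau$. The system is $$\dot y(t)=f(y(t),u(t),\lambda),$$ $u(t)=-1$ if $h(y(t-\tau),\lambda)\ge\epsilon$; $u(t)=+1$ if $h(y(t-\tau),\lambda)\le-\epsilon$; $u(t)=\lim_{s\nearrow t}u(s)$ if $h(y(t-\tau),\lambda)\in(-\epsilon,\epsilon)$. $Y_\pm^t$ denotes the flow of $\dot y=f(y,\pm1,\lambda)$ (defined for positive and negative $t$). Evolution. For $(\xi_0,u_0)\in C([-\Theta,0];\mathbb{R}^n)\times\{-1,1\}$ there are unique functions $y:[-\Theta,\infty)\to\mathbb{R}^n$ (continuous) and $u:[0,\infty)\to\{-1,1\}$ with $y|_{[-\Theta,0]}=\xi_0$, $u(0)=u_0$, $y(t)=\xi_0(0)+\int_0^tf(y(s),u(s),\lambda)\,ds$ for $t\ge0$, and for $t>0$: $u(t)=-1$ if $h(y(t-\tau),\lambda)\ge\epsilon$; $u(t)=1$ if $h(y(t-\tau),\lambda)\le-\epsilon$; and if $|h(y(t-\tau),\lambda)|<\epsilon$, then $u(t)=u_0$ if $|h(y(s),\lambda)|<\epsilon$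 for all $s\in[-\tau,t-\tau]$, and otherwise, with $\sigma$ the largest $s\in[-\tau,t-\tau]$ with $|h(y(s),\lambda)|\ge\epsilon$, $u(t)=-1$ if $h(y(\sigma),\lambda)\geq\epsilon$ and $u(t)=1$ if $h(y(\sigma),\lambda)\leq-\epsilon$. Set $E_c^t(\xi_0,u_0)(\theta)=y(t+\theta)$ for $\theta\in[-\Theta,0]$, $E_d^t(\xi_0,u_0)=u(t)$, $E^t=(E_c^t,E_d^t)$. A periodic solution of period $p$ is a pair of $p$-periodic functions $(y_*,u_* )$ on $\mathbb{R}$ with $E^t(y_*(s+\cdot),u_*(s))=(y_*(s+t+\cdot),u_*(s+t))$ for all $s\in\mathbb{R}$, $t\ge0$. A time $t$ is a crossing time of $(y_*,u_* )$ if $|h(y_*(t),\lambda)|=\epsilon$ and $\lim_{s\nearrow t}u_*(s+\tau)\ne u_*(t+\tau)$. Symmetry and colliding orbit. Assume $f(y,u,\lambda)=-f(-y,-u,\lambda)$ and $h(y,\lambda)=-h(-y,\lambda)$. Assume that at $\lambda=\lambda_0$ there is a symmetric periodic orbit $L=(y_*,u_* )$ of half-period $T=\tau$ (period $2T$): $y_*(t-T)=-y_*(t)$, $u_*(t-T)=-u_*(t)$ for all $t$, with $u_*=+1$ on $[0,T)$, $u_*=-1$ on $[T,2T)$ (so $y_*$ follows $Y_+$ on $[0,T]$ and $Y_-$ on $[T,2T]$), $h(y_*(0),\lambda_0)=\epsilon$, $h(y_*(T),\lambda_0)=-\epsilon$, and $0$ and $T$ are the only crossing times of $L$ in $[0,2T)$.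 Let $h_0'=h'(y_*(0),\lambda_0)$, $f_1=f(y_*(0),-1,\lambda_0)$, $f_2=f(y_*(0),1,\lambda_0)$, and assume strict transversality: $(h_0'f_1)\cdot(h_0'f_2)>0$. Poincaré map. For small $\Delta>0$ let $\Sigma=\{y\in\mathbb{R}^n:f_2^T[y-y_*(\Delta)]=0\}$ and ${\cal S}_1=\{\xi\in{\cal U}:\xi(0)\in\Sigma\}$, where ${\cal U}$ is a sufficiently small neighborhood of $y_*(\Delta+\cdot)$ in $C([-\Theta,0];\mathbb{R}^n)$. For $\xi\in{\cal S}_1$, $P(\xi)=E_c^{T(\xi)}(\xi,1)$, where $T(\xi)$ is the unique time near $2T$ with $E_c^{T(\xi)}(\xi,1)(0)\in\Sigma$ (at this time the discrete component is $+1$). $L$, $\Sigma$, ${\cal U}$ are those for $\lambda_0$; the evolution $E$ is taken at the parameter $\lambda$. Reduction to switching points. Elements $\xi$ of $\operatorname{rg}P$ are represented in the form $\xi(s)=Y_+^{s+\theta(y)}y$ for $s\in[-\theta(y),0]$ and $\xi(s)=Y_-^{s+\theta(y)}y$ for $s\in[-\Theta,-\theta(y)]$, with $y\in U(y_*(0))$ and $\theta(y)$ implicitly defined by $Y_+^{\theta(y)}y\in\Sigma$ (with $\theta(y)\in[0,2\Delta]$). The point $y=\xi(-\theta(y))$, at which $\xi$ switches from following $Y_-$ to following $Y_+$, is called the switching point of $\xi$; it determines what is needed to evaluate $P$ at $\xi$, so that $P$ on $\operatorname{rg}P$ can be described by the map $m$ from the switching point of $\xi$ to the switching point of $P(\xi)$.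 *)

theory Defs
  imports "HOL-Analysis.Analysis"
begin

text \<open>
  The control value \<open>u\<close> is a real number, but only \<open>f y 1 lam\<close> and \<open>f y (-1) lam\<close> ever
  matter; nothing is assumed about other values of \<open>u\<close>.
\<close>

definition C1 :: "('a::real_normed_vector \<Rightarrow> 'b::real_normed_vector) \<Rightarrow> bool" where
  "C1 g \<longleftrightarrow>
     (\<exists>g' :: 'a \<Rightarrow> 'a \<Rightarrow>\<^sub>L 'b.
        (\<forall>x. (g has_derivative blinfun_apply (g' x)) (at x)) \<and> continuous_on UNIV g')"

text \<open>
  Lipschitz constants in \<open>y\<close> are global in \<open>y\<close> but may depend on the parameter; \<open>\<partial>\<^sub>y h\<close> is the
  Frechet derivative of \<open>h\<close> in its first argument.
\<close>

definition relay_system ::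
  "('a::euclidean_space \<Rightarrow> real \<Rightarrow> real \<Rightarrow> 'a) \<Rightarrow> ('a \<Rightarrow> real \<Rightarrow> real) \<Rightarrow> real \<Rightarrow> real \<Rightarrow> real \<Rightarrow> bool"
where
  "relay_system f h \<epsilon> \<tau> \<Theta> \<longleftrightarrow>
     (\<forall>u\<in>{-1, 1}. C1 (\<lambda>(y, lam). f y u lam)) \<and> C1 (\<lambda>(y, lam). h y lam) \<and>
     (\<forall>lam. \<forall>u\<in>{-1, 1}. \<exists>L. L-lipschitz_on UNIV (\<lambda>y. f y u lam)) \<and>
     (\<forall>lam. \<exists>L. L-lipschitz_on UNIV (\<lambda>y. h y lam)) \<and>
     (\<forall>y lam. frechet_derivative (\<lambda>z. h z lam) (at y) \<noteq> (\<lambda>v. 0)) \<and>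
     \<epsilon> > 0 \<and> \<tau> > 0 \<and> \<tau> \<le> \<Theta>"

definition reflection_symmetric ::
  "('a::euclidean_space \<Rightarrow> real \<Rightarrow> real \<Rightarrow> 'a) \<Rightarrow> ('a \<Rightarrow> real \<Rightarrow> real) \<Rightarrow> bool"
where
  "reflection_symmetric f h \<longleftrightarrow>
     (\<forall>y lam. \<forall>u\<in>{-1, 1}. f y u lam = - f (- y) (- u) lam) \<and>
     (\<forall>y lam. h y lam = - h (- y) lam)"

text \<open>The flow of \<open>y' = f y u lam\<close> for frozen control \<open>u\<close>, at (possibly negative) time \<open>t\<close>.\<close>

definition flow ::
  "('a::euclidean_space \<Rightarrow> real \<Rightarrow> real \<Rightarrow> 'a) \<Rightarrow> real \<Rightarrow> real \<Rightarrow> real \<Rightarrow> 'a \<Rightarrow> 'a"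
where
  "flow f u lam t y =
     (THE x. x 0 = y \<and> (\<forall>s. (x has_vector_derivative f (x s) u lam) (at s))) t"

text \<open>
  \<open>C([-\<Theta>, 0])\<close> is represented by extensional functions, so that equality of histories is
  equality of functions on \<open>[-\<Theta>, 0]\<close>; \<open>hist \<Theta> y t\<close> is the history \<open>y(t + \<cdot>)\<close>.
\<close>

definition histories :: "real \<Rightarrow> (real \<Rightarrow> 'a::euclidean_space) set" where
  "histories \<Theta> = {\<xi> \<in> extensional {-\<Theta>..0}. continuous_on {-\<Theta>..0} \<xi>}"

definition hist :: "real \<Rightarrow> (real \<Rightarrow> 'a::euclidean_space) \<Rightarrow> real \<Rightarrow> real \<Rightarrow> 'a" where
  "hist \<Theta> y t = (\<lambda>\<theta>\<in>{-\<Theta>..0}. y (t + \<theta>))"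

text \<open>
  The value \<open>v\<close> the relay takes at time \<open>t > 0\<close>, where \<open>g s\<close> is the switching function
  \<open>h (y s) lam\<close> along the trajectory and \<open>u0\<close> is the initial relay state.
\<close>

definition relay_value ::
  "real \<Rightarrow> real \<Rightarrow> (real \<Rightarrow> real) \<Rightarrow> real \<Rightarrow> real \<Rightarrow> real \<Rightarrow> bool"
where
  "relay_value \<epsilon> \<tau> g u0 t v \<longleftrightarrow>
     (g (t - \<tau>) \<ge> \<epsilon> \<longrightarrow> v = -1) \<and>
     (g (t - \<tau>) \<le> -\<epsilon> \<longrightarrow> v = 1) \<and>
     (\<bar>g (t - \<tau>)\<bar> < \<epsilon> \<longrightarrow>
        (if \<forall>s\<in>{-\<tau>..t - \<tau>}. \<bar>g s\<bar> < \<epsilon> then v = u0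
         else \<exists>\<sigma>\<in>{-\<tau>..t - \<tau>}. \<bar>g \<sigma>\<bar> \<ge> \<epsilon> \<and> (\<forall>s\<in>{\<sigma><..t - \<tau>}. \<bar>g s\<bar> < \<epsilon>) \<and>
                (g \<sigma> \<ge> \<epsilon> \<longrightarrow> v = -1) \<and> (g \<sigma> \<le> -\<epsilon> \<longrightarrow> v = 1)))"

definition relay_solution ::
  "('a::euclidean_space \<Rightarrow> real \<Rightarrow> real \<Rightarrow> 'a) \<Rightarrow> ('a \<Rightarrow> real \<Rightarrow> real) \<Rightarrow> real \<Rightarrow> real \<Rightarrow> real \<Rightarrow> real \<Rightarrow>
   (real \<Rightarrow> 'a) \<Rightarrow> real \<Rightarrow> (real \<Rightarrow> 'a) \<Rightarrow> (real \<Rightarrow> real) \<Rightarrow> bool"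
where
  "relay_solution f h \<epsilon> \<tau> \<Theta> lam \<xi>0 u0 y u \<longleftrightarrow>
     continuous_on {-\<Theta>..} y \<and> (\<forall>t\<ge>0. u t \<in> {-1, 1}) \<and>
     (\<forall>\<theta>\<in>{-\<Theta>..0}. y \<theta> = \<xi>0 \<theta>) \<and> u 0 = u0 \<and>
     (\<forall>t\<ge>0. ((\<lambda>s. f (y s) (u s) lam) has_integral (y t - \<xi>0 0)) {0..t}) \<and>
     (\<forall>t>0. relay_value \<epsilon> \<tau> (\<lambda>s. h (y s) lam) u0 t (u t))"

text \<open>The evolution \<open>E\<^sup>t\<close>; its components are \<open>fst\<close> (continuous) and \<open>snd\<close> (discrete).\<close>

definition evolution ::
  "('a::euclidean_space \<Rightarrow> real \<Rightarrow> real \<Rightarrow> 'a) \<Rightarrow> ('a \<Rightarrow> real \<Rightarrow> real) \<Rightarrow> real \<Rightarrow> real \<Rightarrow> real \<Rightarrow> real \<Rightarrow>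
   real \<Rightarrow> (real \<Rightarrow> 'a) \<times> real \<Rightarrow> (real \<Rightarrow> 'a) \<times> real"
where
  "evolution f h \<epsilon> \<tau> \<Theta> lam t q =
     (THE r. \<exists>y u. relay_solution f h \<epsilon> \<tau> \<Theta> lam (fst q) (snd q) y u \<and> r = (hist \<Theta> y t, u t))"

definition periodic_solution ::
  "('a::euclidean_space \<Rightarrow> real \<Rightarrow> real \<Rightarrow> 'a) \<Rightarrow> ('a \<Rightarrow> real \<Rightarrow> real) \<Rightarrow> real \<Rightarrow> real \<Rightarrow> real \<Rightarrow> real \<Rightarrow>
   real \<Rightarrow> (real \<Rightarrow> 'a) \<Rightarrow> (real \<Rightarrow> real) \<Rightarrow> bool"
where
  "periodic_solution f h \<epsilon> \<tau> \<Theta> lam p y u \<longleftrightarrow>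
     p > 0 \<and> continuous_on UNIV y \<and> (\<forall>t. u t \<in> {-1, 1}) \<and>
     (\<forall>t. y (t + p) = y t \<and> u (t + p) = u t) \<and>
     (\<forall>s. \<forall>t\<ge>0. evolution f h \<epsilon> \<tau> \<Theta> lam t (hist \<Theta> y s, u s) = (hist \<Theta> y (s + t), u (s + t)))"

definition crossing_time ::
  "('a::euclidean_space \<Rightarrow> real \<Rightarrow> real) \<Rightarrow> real \<Rightarrow> real \<Rightarrow> real \<Rightarrow>
   (real \<Rightarrow> 'a) \<Rightarrow> (real \<Rightarrow> real) \<Rightarrow> real \<Rightarrow> bool"
where
  "crossing_time h \<epsilon> \<tau> lam y u t \<longleftrightarrow>
     \<bar>h (y t) lam\<bar> = \<epsilon> \<and>
     (\<exists>l. ((\<lambda>s. u (s + \<tau>)) \<longlongrightarrow> l) (at_left t) \<and> l \<noteq> u (t + \<tau>))"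

text \<open>
  A symmetric periodic orbit with half-period \<open>T\<close> and crossing times \<open>0\<close> and \<open>T\<close>, where the relay
  is \<open>+1\<close> on the first half-period; the orbit is colliding if in addition \<open>T = \<tau>\<close>.
\<close>

definition symmetric_periodic_orbit ::
  "('a::euclidean_space \<Rightarrow> real \<Rightarrow> real \<Rightarrow> 'a) \<Rightarrow> ('a \<Rightarrow> real \<Rightarrow> real) \<Rightarrow> real \<Rightarrow> real \<Rightarrow> real \<Rightarrow> real \<Rightarrow>
   real \<Rightarrow> (real \<Rightarrow> 'a) \<Rightarrow> (real \<Rightarrow> real) \<Rightarrow> bool"
where
  "symmetric_periodic_orbit f h \<epsilon> \<tau> \<Theta> lam T y u \<longleftrightarrow>
     periodic_solution f h \<epsilon> \<tau> \<Theta> lam (2 * T) y u \<and>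
     (\<forall>t. y (t - T) = - y t \<and> u (t - T) = - u t) \<and>
     (\<forall>t\<in>{0..<T}. u t = 1) \<and> (\<forall>t\<in>{T..<2 * T}. u t = -1) \<and>
     h (y 0) lam = \<epsilon> \<and> h (y T) lam = -\<epsilon> \<and>
     {t \<in> {0..<2 * T}. crossing_time h \<epsilon> \<tau> lam y u t} = {0, T}"

text \<open>
  The plane through \<open>ys \<Delta>\<close> with normal \<open>f\<^sub>2 = f (ys 0) 1 lam0\<close>, and the elements of the
  sup-norm neighbourhood of radius \<open>\<delta>\<close> of \<open>ys(\<Delta> + \<cdot>)\<close> whose head lies in a given plane \<open>\<Gamma>\<close>.
\<close>

definition section_plane ::
  "('a::euclidean_space \<Rightarrow> real \<Rightarrow> real \<Rightarrow> 'a) \<Rightarrow> real \<Rightarrow> (real \<Rightarrow> 'a) \<Rightarrow> real \<Rightarrow> 'a set"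
where
  "section_plane f lam0 ys \<Delta> = {y. f (ys 0) 1 lam0 \<bullet> (y - ys \<Delta>) = 0}"

definition local_section ::
  "real \<Rightarrow> (real \<Rightarrow> 'a::euclidean_space) \<Rightarrow> 'a set \<Rightarrow> real \<Rightarrow> real \<Rightarrow> (real \<Rightarrow> 'a) set"
where
  "local_section \<Theta> ys \<Gamma> \<Delta> \<delta> =
     {\<xi> \<in> histories \<Theta>. (\<forall>\<theta>\<in>{-\<Theta>..0}. dist (\<xi> \<theta>) (ys (\<Delta> + \<theta>)) < \<delta>) \<and> \<xi> 0 \<in> \<Gamma>}"

text \<open>
  In the following definitions \<open>E\<close> is the evolution, \<open>Yp\<close> and \<open>Ym\<close> are the flows for control
  \<open>+1\<close> and \<open>-1\<close>, and \<open>g\<close> is the switching function, all at one and the same parameter value.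
  ``Near \<open>2 T\<close>'' means at distance less than \<open>\<rho>\<close>.
\<close>

definition is_return_time ::
  "(real \<Rightarrow> (real \<Rightarrow> 'a::euclidean_space) \<times> real \<Rightarrow> (real \<Rightarrow> 'a) \<times> real) \<Rightarrow>
   'a set \<Rightarrow> real \<Rightarrow> real \<Rightarrow> (real \<Rightarrow> 'a) \<Rightarrow> real \<Rightarrow> bool"
where
  "is_return_time E \<Gamma> T \<rho> \<xi> t \<longleftrightarrow> \<bar>t - 2 * T\<bar> < \<rho> \<and> fst (E t (\<xi>, 1)) 0 \<in> \<Gamma>"

definition return_time ::
  "(real \<Rightarrow> (real \<Rightarrow> 'a::euclidean_space) \<times> real \<Rightarrow> (real \<Rightarrow> 'a) \<times> real) \<Rightarrow>
   'a set \<Rightarrow> real \<Rightarrow> real \<Rightarrow> (real \<Rightarrow> 'a) \<Rightarrow> real"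
where
  "return_time E \<Gamma> T \<rho> \<xi> = (THE t. is_return_time E \<Gamma> T \<rho> \<xi> t)"

definition poincare_map ::
  "(real \<Rightarrow> (real \<Rightarrow> 'a::euclidean_space) \<times> real \<Rightarrow> (real \<Rightarrow> 'a) \<times> real) \<Rightarrow>
   'a set \<Rightarrow> real \<Rightarrow> real \<Rightarrow> (real \<Rightarrow> 'a) \<Rightarrow> real \<Rightarrow> 'a"
where
  "poincare_map E \<Gamma> T \<rho> \<xi> = fst (E (return_time E \<Gamma> T \<rho> \<xi>) (\<xi>, 1))"

text \<open>
  \<open>y \<in> U\<close> is the switching point of the element \<open>poincare_map E \<Gamma> T \<rho> \<eta>\<close> of the range of the
  Poincare map.  Two points to note:

  \<^item> The switching instant is also recorded through the discrete component.  The segment alone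
    does not determine it when \<open>f y 1 lam = f y (-1) lam\<close> near \<open>U\<close>, which is not excluded.  This
    is why the notion refers to \<open>\<eta>\<close> and not only to its image.

  \<^item> The backward piece is required on the delay window \<open>[-\<tau>, -\<theta>]\<close>, the part of the history that
    enters the evolution.  For \<open>\<Theta> = \<tau>\<close> this is the whole remaining history \<open>[-\<Theta>, -\<theta>]\<close>; for
    larger \<open>\<Theta>\<close> the history may contain earlier switches.
\<close>

definition is_switching_point ::
  "(real \<Rightarrow> (real \<Rightarrow> 'a::euclidean_space) \<times> real \<Rightarrow> (real \<Rightarrow> 'a) \<times> real) \<Rightarrow>
   (real \<Rightarrow> 'a \<Rightarrow> 'a) \<Rightarrow> (real \<Rightarrow> 'a \<Rightarrow> 'a) \<Rightarrow> 'a set \<Rightarrow> real \<Rightarrow> real \<Rightarrow> real \<Rightarrow> real \<Rightarrow> 'a set \<Rightarrow>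
   (real \<Rightarrow> 'a) \<Rightarrow> 'a \<Rightarrow> bool"
where
  "is_switching_point E Yp Ym \<Gamma> T \<rho> \<tau> \<Delta> U \<eta> y \<longleftrightarrow>
     y \<in> U \<and>
     (\<exists>\<theta>\<in>{0..2 * \<Delta>}. Yp \<theta> y \<in> \<Gamma> \<and>
        (\<forall>s\<in>{-\<theta>..0}. poincare_map E \<Gamma> T \<rho> \<eta> s = Yp (s + \<theta>) y) \<and>
        (\<forall>s\<in>{-\<tau>..-\<theta>}. poincare_map E \<Gamma> T \<rho> \<eta> s = Ym (s + \<theta>) y) \<and>
        (\<forall>s\<in>{-\<theta>..0}. snd (E (return_time E \<Gamma> T \<rho> \<eta> + s) (\<eta>, 1)) = 1) \<and>
        (\<forall>s\<in>{-\<tau>..<-\<theta>}. snd (E (return_time E \<Gamma> T \<rho> \<eta> + s) (\<eta>, 1)) = -1))"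

definition switching_point ::
  "(real \<Rightarrow> (real \<Rightarrow> 'a::euclidean_space) \<times> real \<Rightarrow> (real \<Rightarrow> 'a) \<times> real) \<Rightarrow>
   (real \<Rightarrow> 'a \<Rightarrow> 'a) \<Rightarrow> (real \<Rightarrow> 'a \<Rightarrow> 'a) \<Rightarrow> 'a set \<Rightarrow> real \<Rightarrow> real \<Rightarrow> real \<Rightarrow> real \<Rightarrow> 'a set \<Rightarrow>
   (real \<Rightarrow> 'a) \<Rightarrow> 'a"
where
  "switching_point E Yp Ym \<Gamma> T \<rho> \<tau> \<Delta> U \<eta> = (THE y. is_switching_point E Yp Ym \<Gamma> T \<rho> \<tau> \<Delta> U \<eta> y)"

text \<open>
  The return map on switching points, for a Poincare map \<open>P\<close> with domain \<open>S\<close>, where \<open>sp \<eta>\<close> is the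
  switching point of \<open>P \<eta>\<close>: it sends the switching point of \<open>\<xi> = P \<eta>\<close> to that of \<open>P \<xi>\<close>, for all
  \<open>\<xi>\<close> in the range of \<open>P\<close> to which \<open>P\<close> can be applied again.
\<close>

definition return_map ::
  "((real \<Rightarrow> 'a) \<Rightarrow> real \<Rightarrow> 'a) \<Rightarrow> (real \<Rightarrow> 'a) set \<Rightarrow> ((real \<Rightarrow> 'a) \<Rightarrow> 'a::euclidean_space) \<Rightarrow> 'a \<Rightarrow> 'a"
where
  "return_map P S sp y = (THE y'. \<exists>\<eta>\<in>S. P \<eta> \<in> S \<and> sp \<eta> = y \<and> sp (P \<eta>) = y')"

definition is_hitting_time ::
  "(real \<Rightarrow> 'a::euclidean_space \<Rightarrow> 'a) \<Rightarrow> (real \<Rightarrow> 'a \<Rightarrow> 'a) \<Rightarrow> ('a \<Rightarrow> real) \<Rightarrow> real \<Rightarrow> real \<Rightarrow> 'a \<Rightarrow> real \<Rightarrow> bool"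
where
  "is_hitting_time Yp Ym g \<epsilon> \<Delta> y t \<longleftrightarrow>
     t \<in> {-\<Delta><..<\<Delta>} \<and>
     (if g y \<ge> \<epsilon> then \<epsilon> = g (Ym t y) else \<epsilon> = g (Yp t y))"

definition half_return_map ::
  "(real \<Rightarrow> 'a::euclidean_space \<Rightarrow> 'a) \<Rightarrow> (real \<Rightarrow> 'a \<Rightarrow> 'a) \<Rightarrow> ('a \<Rightarrow> real) \<Rightarrow> real \<Rightarrow> real \<Rightarrow> real \<Rightarrow> 'a \<Rightarrow> 'a"
where
  "half_return_map Yp Ym g \<epsilon> \<tau> \<Delta> y =
     - Yp (\<tau> + (THE t. is_hitting_time Yp Ym g \<epsilon> \<Delta> y t)) y"

end

theory Submission
  imports Defs
begin

text \<open>
  Since \<open>h (ys s) < \<epsilon>\<close> on \<open>(-\<tau>, 0)\<close>, transversality forces \<open>h\<close> to increase along both flows near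
  \<open>ys 0\<close>.  Let \<open>\<xi>\<close> be close to the orbit and let \<open>s1\<close> be the first time at which
  \<open>h (\<xi> s) \<ge> \<epsilon>\<close>.  The relay is \<open>+1\<close> up to time \<open>\<tau> + s1\<close>, where the trajectory is at a point \<open>-w\<close>.
  By reflection symmetry, near that time the trajectory is the negative of the curve that follows
  \<open>Y\<^sub>-\<close> before and \<open>Y\<^sub>+\<close> after \<open>w\<close>, so \<open>h\<close> reaches \<open>-\<epsilon>\<close> exactly at \<open>\<tau> + s1 + t(w)\<close>, whichever side of
  the corner this is.  The next switch is \<open>\<tau>\<close> later, at the point \<open>Y\<^sub>- (\<tau> + t(w)) (-w) = F(w)\<close>, which is
  therefore the switching point of \<open>P \<xi>\<close>.  If \<open>\<xi>\<close> itself has a switching point \<open>y\<close>, then near \<open>s1\<close> it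
  is the curve that follows \<open>Y\<^sub>-\<close> before and \<open>Y\<^sub>+\<close> after \<open>y\<close>, and the same computation gives \<open>w = F(y)\<close>.
\<close>

section \<open>Integral equations with Lipschitz right-hand side\<close>

text \<open>The evolution and both flows are definite descriptions, so nothing can be said about a
  trajectory before well-posedness is proved. Joint continuity of the flows then carries facts at
  \<open>lam0\<close> over to nearby parameters and points. The collision is the obstacle. Since the
  delay equals the half-period, the instant at which a trajectory reaches \<open>-\<epsilon>\<close>
  and the instant at which its control turns to \<open>-1\<close> nearly coincide, in either order.
  A crossing after the turn lies on a piece of trajectory that is known only once the control there
  is known. This is not circular, because that control is decided by the signal about one delay
  earlier. Along the bent curve \<open>h\<close> need not be differentiable at the corner, so
  hitting times come from the intermediate value theorem and strict monotonicity rather than from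
  implicit functions. The estimates live on separated scales: the timing error \<eta> is small
  against the window \<rho> of return times, \<rho> against \<Delta>, \<Delta> against the radius
  \<open>d\<close> of the box where monotonicity holds, and \<open>d\<close> against \<tau>.\<close>

lemma gronwall:
  fixes \<phi> :: "real \<Rightarrow> real"
  assumes cont: "continuous_on {a..b} \<phi>" and L: "0 \<le> L"
    and le: "\<And>t. t \<in> {a..b} \<Longrightarrow> \<phi> t \<le> C + L * integral {a..t} \<phi>"
    and t: "t \<in> {a..b}"
  shows "\<phi> t \<le> C * exp (L * (t - a))"
proof -
  define I where "I = (\<lambda>s. integral {a..s} \<phi>)"
  \<comment> \<open>With the integrating factor \<psi> is nonincreasing; comparing its values at
    \<open>t\<close> and \<open>a\<close> bounds \<open>C + L * I t\<close>.\<close>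
  define \<psi> where "\<psi> = (\<lambda>s. exp (- (L * (s - a))) * (C + L * I s))"
  have I: "(I has_real_derivative \<phi> s) (at s within {a..b})" if "s \<in> {a..b}" for s
    using integral_has_vector_derivative[OF cont that]
    by (simp add: I_def has_real_derivative_iff_has_vector_derivative)
  have d: "(\<psi> has_real_derivative
      exp (- (L * (s - a))) * L * (\<phi> s - (C + L * I s))) (at s within {a..b})"
    if "s \<in> {a..b}" for s
    unfolding \<psi>_def by (rule derivative_eq_intros I[OF that] refl)+ (simp add: algebra_simps)
  have "\<psi> t \<le> \<psi> a"
  proof (rule DERIV_nonpos_imp_decreasing_open[where f = \<psi> and a = a and b = t])
    show "a \<le> t" using t by simp
    show "continuous_on {a..t} \<psi>"
      by (rule continuous_on_subset[of "{a..b}"], rule DERIV_continuous_on, rule d) (use t in auto)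
    fix s assume s: "a < s" "s < t"
    then have "(\<psi> has_real_derivative exp (- (L * (s - a))) * L * (\<phi> s - (C + L * I s))) (at s)"
      using d[of s] t at_within_Icc_at[of a s b] by auto
    moreover have "exp (- (L * (s - a))) * L * (\<phi> s - (C + L * I s)) \<le> 0"
      using le[of s] s t L by (intro mult_nonneg_nonpos) (auto simp: I_def)
    ultimately show "\<exists>y. (\<psi> has_real_derivative y) (at s) \<and> y \<le> 0" by blast
  qed
  then have "exp (- (L * (t - a))) * (C + L * I t) \<le> C"
    by (simp add: \<psi>_def I_def)
  then have "exp (L * (t - a)) * (exp (- (L * (t - a))) * (C + L * I t)) \<le> exp (L * (t - a)) * C"
    by (rule mult_left_mono) simp
  then have "C + L * I t \<le> C * exp (L * (t - a))"
    by (simp add: mult.assoc[symmetric] mult.commute[of C] flip: exp_add)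
  with le[OF t] show ?thesis by (simp add: I_def)
qed

text \<open>The right-hand side may jump in time, as it does once the relay enters, so the
  comparison is made in the integral equations; it is \<open>gronwall\<close> with
  \<open>C = 0\<close>.\<close>

lemma integral_equation_unique:
  fixes x y :: "real \<Rightarrow> 'a::euclidean_space"
  assumes x: "continuous_on {a..b} x" and y: "continuous_on {a..b} y"
    and L: "\<And>s p q. s \<in> {a..b} \<Longrightarrow> norm (\<phi> s p - \<phi> s q) \<le> L * norm (p - q)" "0 \<le> L"
    and ix: "\<And>t. t \<in> {a..b} \<Longrightarrow> ((\<lambda>s. \<phi> s (x s)) has_integral x t - z) {a..t}"
    and iy: "\<And>t. t \<in> {a..b} \<Longrightarrow> ((\<lambda>s. \<phi> s (y s)) has_integral y t - z) {a..t}"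
    and t: "t \<in> {a..b}"
  shows "x t = y t"
proof -
  have c: "continuous_on {a..b} (\<lambda>s. norm (x s - y s))"
    by (intro continuous_intros x y)
  have "norm (x t - y t) \<le> 0 * exp (L * (t - a))"
  proof (rule gronwall[OF c L(2) _ t])
    fix t assume t: "t \<in> {a..b}"
    have i: "((\<lambda>s. \<phi> s (x s) - \<phi> s (y s)) has_integral (x t - z) - (y t - z)) {a..t}"
      by (rule has_integral_diff[OF ix[OF t] iy[OF t]])
    have g: "(\<lambda>s. L * norm (x s - y s)) integrable_on {a..t}"
      by (intro integrable_continuous_real continuous_intros continuous_on_subset[OF x]
          continuous_on_subset[OF y]) (use t in auto)
    have "norm (integral {a..t} (\<lambda>s. \<phi> s (x s) - \<phi> s (y s)))
       \<le> integral {a..t} (\<lambda>s. L * norm (x s - y s))"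
      by (rule Henstock_Kurzweil_Integration.integral_norm_bound_integral
          [OF has_integral_integrable[OF i] g]) (use L t in auto)
    then show "norm (x t - y t) \<le> 0 + L * integral {a..t} (\<lambda>s. norm (x s - y s))"
      using i by (simp add: integral_unique[OF i])
  qed
  then show ?thesis by simp
qed

text \<open>
  Contraction in the norm \<open>sup\<^sub>t exp (-2 L t) |x t|\<close>, which yields the solution on the whole
  half-line at once; \<open>w\<close> below stands for \<open>exp (-2 L t) x t\<close>.
\<close>

lemma caratheodory_solution:
  fixes \<phi> :: "real \<Rightarrow> 'a::euclidean_space \<Rightarrow> 'a"
  assumes lip0: "\<And>s p q. norm (\<phi> s p - \<phi> s q) \<le> L0 * norm (p - q)"
    and bd: "\<And>s. norm (\<phi> s 0) \<le> M"
    and int: "\<And>x t. continuous_on UNIV x \<Longrightarrow> (\<lambda>s. \<phi> s (x s)) integrable_on {0..t}"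
  obtains x where "continuous_on UNIV x" "\<And>t. t \<le> 0 \<Longrightarrow> x t = z"
    "\<And>t. t \<ge> 0 \<Longrightarrow> ((\<lambda>s. \<phi> s (x s)) has_integral x t - z) {0..t}"
proof -
  \<comment> \<open>The added 1 makes the constant positive, because the weight rate
    \<open>K\<close> appears in denominators.\<close>
  define L where "L = \<bar>L0\<bar> + 1"
  have L: "0 < L" by (simp add: L_def)
  have lip: "norm (\<phi> s p - \<phi> s q) \<le> L * norm (p - q)" for s p q
    using lip0[of s p q] by (rule order_trans) (intro mult_right_mono, auto simp: L_def)
  have M: "0 \<le> M" using bd[of 0] norm_ge_zero order_trans by blast
  \<comment> \<open>Twice the Lipschitz constant, so that the weighted integral contracts by
    \<open>L / K = 1/2\<close>.\<close>
  define K where "K = 2 * L"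
  have K: "0 < K" using L by (simp add: K_def)
  define J where "J = (\<lambda>w t. integral {0..t} (\<lambda>s. \<phi> s (exp (K * s) *\<^sub>R w s)))"
  \<comment> \<open>Bounded continuous functions live on the whole line here. Freezing the image by
    \<open>max 0 t\<close> avoids the unbounded weight at negative times.\<close>
  define S where "S = (\<lambda>w t. exp (- (K * max 0 t)) *\<^sub>R (z + J w (max 0 t)))"
  have ce: "continuous_on UNIV (\<lambda>s. exp (K * s) *\<^sub>R w s)" if "continuous_on UNIV w"
    for w :: "real \<Rightarrow> 'a"
    by (intro continuous_intros that)
  have iJ: "(\<lambda>s. \<phi> s (exp (K * s) *\<^sub>R w s)) integrable_on {0..t}" if "continuous_on UNIV w" for w t
    by (rule int[OF ce[OF that]])
  have cont: "continuous_on UNIV (S w)" if w: "continuous_on UNIV w" for w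
  proof -
    have "continuous_on (\<Union>N\<in>(UNIV::nat set). {..<real N}) (\<lambda>t. J w (max 0 t))"
    proof (rule continuous_on_open_UN)
      fix N :: nat
      have "continuous_on {0..real N} (J w)"
        unfolding J_def by (rule indefinite_integral_continuous_1[OF iJ[OF w]])
      then show "continuous_on {..<real N} (\<lambda>t. J w (max 0 t))"
        by (rule continuous_on_compose2) (auto intro!: continuous_intros)
    qed simp
    moreover have "(\<Union>N\<in>(UNIV::nat set). {..<real N}) = UNIV"
      using reals_Archimedean2 by auto
    ultimately have "continuous_on UNIV (\<lambda>t. J w (max 0 t))" by simp
    then show ?thesis unfolding S_def by (intro continuous_intros)
  qed
  have expint: "((\<lambda>s. c * exp (K * s)) has_integral c * ((exp (K * t) - 1) / K)) {0..t}"
    if "0 \<le> t" for c t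
  proof -
    have "((\<lambda>s. exp (K * s)) has_integral exp (K * t) / K - exp (K * 0) / K) {0..t}"
      by (rule fundamental_theorem_of_calculus[OF that])
        (auto intro!: derivative_eq_intros
          simp: has_real_derivative_iff_has_vector_derivative[symmetric] K less_imp_neq[OF K, symmetric])
    from has_integral_mult_right[OF this, of c] show ?thesis by (simp add: diff_divide_distrib)
  qed
  have eb: "exp (- (K * t)) * (c * ((exp (K * t) - 1) / K)) \<le> c / K" if "0 \<le> c" for c t
  proof -
    have "exp (- (K * t)) * (c * ((exp (K * t) - 1) / K)) = c / K * (1 - exp (- (K * t)))"
      using K by (simp add: field_simps exp_minus)
    also have "\<dots> \<le> c / K * 1" by (rule mult_left_mono) (use that K in auto)
    finally show ?thesis by simp
  qed
  have bnd: "norm (S w t) \<le> norm z + (M + L * W) / K"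
    if w: "continuous_on UNIV w" and W: "\<And>s. norm (w s) \<le> W" for w W t
  proof -
    define r where "r = max 0 t"
    have r: "0 \<le> r" by (simp add: r_def)
    have W0: "0 \<le> W" using W[of 0] norm_ge_zero order_trans by blast
    have "norm (J w r) \<le> integral {0..r} (\<lambda>s. (M + L * W) * exp (K * s))"
      unfolding J_def
    proof (rule Henstock_Kurzweil_Integration.integral_norm_bound_integral[OF iJ[OF w]
          has_integral_integrable[OF expint[OF r]]])
      fix s assume s: "s \<in> {0..r}"
      have "norm (\<phi> s (exp (K * s) *\<^sub>R w s))
          \<le> norm (\<phi> s 0) + norm (\<phi> s (exp (K * s) *\<^sub>R w s) - \<phi> s 0)"
        by (rule norm_triangle_sub)
      also have "\<dots> \<le> M * exp (K * s) + L * (exp (K * s) * W)"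
      proof (rule add_mono)
        show "norm (\<phi> s 0) \<le> M * exp (K * s)"
          using bd[of s] mult_left_mono[of 1 "exp (K * s)" M] s K M by auto
        have "norm (\<phi> s (exp (K * s) *\<^sub>R w s) - \<phi> s 0) \<le> L * (exp (K * s) * norm (w s))"
          using lip[of s "exp (K * s) *\<^sub>R w s" 0] by simp
        also have "\<dots> \<le> L * (exp (K * s) * W)"
          using W[of s] L by (intro mult_left_mono) auto
        finally show "norm (\<phi> s (exp (K * s) *\<^sub>R w s) - \<phi> s 0) \<le> L * (exp (K * s) * W)" .
      qed
      finally show "norm (\<phi> s (exp (K * s) *\<^sub>R w s)) \<le> (M + L * W) * exp (K * s)"
        by (simp add: algebra_simps)
    qed
    then have "norm (J w r) \<le> (M + L * W) * ((exp (K * r) - 1) / K)"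
      unfolding integral_unique[OF expint[OF r]] .
    then have "exp (- (K * r)) * norm (J w r) \<le> (M + L * W) / K"
      using eb[of "M + L * W" r] M L W0
      by (smt (verit) exp_ge_zero mult_left_mono mult_nonneg_nonneg)
    moreover have "exp (- (K * r)) * norm z \<le> norm z"
      using r K by (intro mult_left_le_one_le) auto
    moreover have "norm (S w t) \<le> exp (- (K * r)) * norm z + exp (- (K * r)) * norm (J w r)"
      unfolding S_def r_def[symmetric] norm_scaleR
      by (simp add: norm_triangle_ineq flip: distrib_left)
    ultimately show ?thesis by linarith
  qed
  define B where "B = (\<lambda>w. Bcontfun (S (apply_bcontfun w)))"
  have B: "apply_bcontfun (B w) = S (apply_bcontfun w)" for w
    unfolding B_def
  proof (rule Bcontfun_inverse, rule bcontfun_normI)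
    show "continuous_on UNIV (S (apply_bcontfun w))" by (rule cont) simp
    show "norm (S (apply_bcontfun w) t) \<le> norm z + (M + L * norm w) / K" for t
      by (rule bnd) (auto simp: norm_bounded)
  qed
  have "dist (B v) (B w) \<le> 1 / 2 * dist v w" for v w
  proof (rule dist_bound)
    fix t :: real
    define r where "r = max 0 t"
    have r: "0 \<le> r" by (simp add: r_def)
    define D where "D = dist v w"
    have D: "0 \<le> D" by (simp add: D_def)
    let ?v = "apply_bcontfun v" and ?w = "apply_bcontfun w"
    have i: "(\<lambda>s. \<phi> s (exp (K * s) *\<^sub>R ?v s) - \<phi> s (exp (K * s) *\<^sub>R ?w s)) integrable_on {0..r}"
      by (rule Henstock_Kurzweil_Integration.integrable_diff[OF iJ iJ]) simp_all
    have "norm (integral {0..r} (\<lambda>s. \<phi> s (exp (K * s) *\<^sub>R ?v s) - \<phi> s (exp (K * s) *\<^sub>R ?w s)))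
        \<le> integral {0..r} (\<lambda>s. L * D * exp (K * s))"
    proof (rule Henstock_Kurzweil_Integration.integral_norm_bound_integral[OF i
          has_integral_integrable[OF expint[OF r]]])
      fix s
      have "norm (\<phi> s (exp (K * s) *\<^sub>R ?v s) - \<phi> s (exp (K * s) *\<^sub>R ?w s))
          \<le> L * norm (exp (K * s) *\<^sub>R (?v s - ?w s))"
        using lip[of s "exp (K * s) *\<^sub>R ?v s" "exp (K * s) *\<^sub>R ?w s"]
        by (simp add: scaleR_diff_right)
      also have "\<dots> = L * (exp (K * s) * norm (?v s - ?w s))" by simp
      also have "\<dots> \<le> L * (exp (K * s) * D)"
        using dist_bounded[of v s w] L by (intro mult_left_mono) (auto simp: dist_norm D_def)
      finally show "norm (\<phi> s (exp (K * s) *\<^sub>R ?v s) - \<phi> s (exp (K * s) *\<^sub>R ?w s))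
          \<le> L * D * exp (K * s)" by (simp add: mult_ac)
    qed
    then have "norm (J ?v r - J ?w r) \<le> L * D * ((exp (K * r) - 1) / K)"
      unfolding J_def integral_unique[OF expint[OF r]]
      by (simp add: Henstock_Kurzweil_Integration.integral_diff iJ)
    then have "exp (- (K * r)) * norm (J ?v r - J ?w r) \<le> L * D / K"
      using eb[of "L * D" r] L D by (smt (verit) exp_ge_zero mult_left_mono mult_nonneg_nonneg)
    also have "\<dots> = 1 / 2 * D" using L by (simp add: K_def)
    finally show "dist (apply_bcontfun (B v) t) (apply_bcontfun (B w) t) \<le> 1 / 2 * dist v w"
      unfolding B S_def r_def[symmetric] D_def dist_norm
      by (simp flip: scaleR_diff_right)
  qed
  then have "\<exists>!w. B w = w" by (intro banach_fix_type[of "1/2"]) auto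
  then obtain w where w: "B w = w" by auto
  define x where "x = (\<lambda>t. if t \<le> 0 then z else exp (K * t) *\<^sub>R apply_bcontfun w t)"
  have fixed: "apply_bcontfun w t = S (apply_bcontfun w) t" for t
    using B[of w] w by simp
  have x: "x t = z + J (apply_bcontfun w) (max 0 t)" for t
    using fixed[of t] by (auto simp: x_def S_def J_def max_def exp_minus)
  have x': "x t = exp (K * max 0 t) *\<^sub>R S (apply_bcontfun w) t" for t
    by (simp add: x S_def exp_minus)
  show thesis
  proof
    show "continuous_on UNIV x"
      unfolding x' by (intro continuous_intros cont) simp
    show "x t = z" if "t \<le> 0" for t using that by (simp add: x_def)
    fix t :: real assume t: "t \<ge> 0"
    have "((\<lambda>s. \<phi> s (exp (K * s) *\<^sub>R apply_bcontfun w s)) has_integral x t - z) {0..t}"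
      using t iJ[of "apply_bcontfun w" t] by (simp add: x J_def has_integral_integral)
    then show "((\<lambda>s. \<phi> s (x s)) has_integral x t - z) {0..t}"
    proof (rule has_integral_eq[rotated])
      fix s assume "s \<in> {0..t}"
      then have "x s = exp (K * s) *\<^sub>R apply_bcontfun w s"
        using x[of 0] fixed[of 0] by (cases "s = 0") (auto simp: x_def S_def J_def)
      then show "\<phi> s (exp (K * s) *\<^sub>R apply_bcontfun w s) = \<phi> s (x s)" by simp
    qed
  qed
qed

section \<open>Flows of Lipschitz vector fields\<close>

text \<open>The flow of one autonomous field, detached from control and parameter, so that the same
  facts serve both controls, every parameter and the reversed field.\<close>

definition ode_flow :: "('a::euclidean_space \<Rightarrow> 'a) \<Rightarrow> real \<Rightarrow> 'a \<Rightarrow> 'a" where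
  "ode_flow F t y = (THE x. x 0 = y \<and> (\<forall>s. (x has_vector_derivative F (x s)) (at s))) t"

lemma flow_eq_ode_flow: "flow f u lam t y = ode_flow (\<lambda>y. f y u lam) t y"
  by (simp add: flow_def ode_flow_def)

lemma continuous_on_global_vector_derivative:
  "(\<And>s. (x has_vector_derivative x' s) (at s)) \<Longrightarrow> continuous_on S x"
  by (rule continuous_on_vector_derivative) (rule has_vector_derivative_at_within)

locale lipschitz_field =
  fixes F :: "'a::euclidean_space \<Rightarrow> 'a" and L :: real
  assumes lip: "L-lipschitz_on UNIV F"
begin

lemma lipD: "norm (F p - F q) \<le> L * norm (p - q)"
  using lipschitz_onD[OF lip, of p q] by (simp add: dist_norm)

lemma L_nonneg: "0 \<le> L"
  by (rule lipschitz_on_nonneg[OF lip])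

lemma cont_field: "continuous_on UNIV F"
  by (rule lipschitz_on_continuous_on[OF lip])

lemma cont_field_comp: "continuous_on S x \<Longrightarrow> continuous_on S (\<lambda>s. F (x s))"
  by (rule continuous_on_compose2[OF cont_field]) auto

lemma forward_solution:
  obtains x :: "real \<Rightarrow> 'a" where "continuous_on UNIV x" "\<And>t. t \<le> 0 \<Longrightarrow> x t = z"
    "\<And>t. t \<ge> 0 \<Longrightarrow> ((\<lambda>s. F (x s)) has_integral x t - z) {0..t}"
proof (rule caratheodory_solution[of "\<lambda>_. F" L "norm (F 0)" z])
  show "(\<lambda>s. F (x s)) integrable_on {0..t}" if "continuous_on UNIV x" for x :: "real \<Rightarrow> 'a" and t
    by (intro integrable_continuous_real cont_field_comp continuous_on_subset[OF that]) auto
qed (use lipD that in auto)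

lemma reversed: "lipschitz_field (\<lambda>y. - F y) L"
  by unfold_locales (use lip in \<open>auto simp: lipschitz_on_def dist_minus\<close>)

text \<open>The contraction argument runs forward only; the past of the solution is the reflected
  forward solution of the reversed field.\<close>

lemma ode_solution_exists:
  obtains x where "x 0 = z" "\<And>s. (x has_vector_derivative F (x s)) (at s)"
proof -
  obtain x1 :: "real \<Rightarrow> 'a" where x1: "continuous_on UNIV x1" "\<And>t. t \<le> 0 \<Longrightarrow> x1 t = z"
    "\<And>t. t \<ge> 0 \<Longrightarrow> ((\<lambda>s. F (x1 s)) has_integral x1 t - z) {0..t}"
    by (rule forward_solution[of z]) blast
  obtain x2 :: "real \<Rightarrow> 'a" where x2: "continuous_on UNIV x2" "\<And>t. t \<le> 0 \<Longrightarrow> x2 t = z"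
    "\<And>t. t \<ge> 0 \<Longrightarrow> ((\<lambda>s. - F (x2 s)) has_integral x2 t - z) {0..t}"
    by (rule lipschitz_field.forward_solution[OF reversed, of z]) blast
  \<comment> \<open>Both \<open>x1\<close> and \<open>x2\<close> rest at \<open>z\<close> for
    nonpositive arguments, so the sum minus \<open>z\<close> concatenates them without a case
    split.\<close>
  define x where "x = (\<lambda>t. x1 t + x2 (- t) - z)"
  have x_pos: "x t = x1 t" if "t \<ge> 0" for t using that by (simp add: x_def x2(2))
  have x_neg: "x t = x2 (- t)" if "t \<le> 0" for t using that by (simp add: x_def x1(2))
  have x0: "x 0 = z" by (simp add: x_def x1(2) x2(2))
  have cx: "continuous_on S x" for S
    unfolding x_def by (intro continuous_intros continuous_on_subset[OF x1(1)]
        continuous_on_compose2[OF x2(1)]) auto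
  have cF: "continuous_on S (\<lambda>s. F (x s))" for S by (rule cont_field_comp[OF cx])
  have iF: "(\<lambda>s. F (x s)) integrable_on {a..b}" for a b by (rule integrable_continuous_real[OF cF])
  have pos: "integral {0..t} (\<lambda>s. F (x s)) = x t - z" if t: "t \<ge> 0" for t
    by (rule integral_unique, rule has_integral_eq[rotated], subst x_pos[OF t], rule x1(3)[OF t])
      (simp add: x_pos)
  have neg: "integral {t..0} (\<lambda>s. F (x s)) = z - x t" if t: "t \<le> 0" for t
  proof -
    have "((\<lambda>s. - F (x2 s)) has_integral x2 (- t) - z) {- 0..- t}"
      using x2(3)[of "- t"] t by simp
    then have "((\<lambda>s. - F (x2 (- s))) has_integral x2 (- t) - z) {t..0}"
      using has_integral_reflect_real[of "\<lambda>s. - F (x2 s)" "x2 (- t) - z" "- t" 0] by simp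
    from has_integral_neg[OF this] have "((\<lambda>s. F (x2 (- s))) has_integral z - x t) {t..0}"
      by (simp add: x_neg[OF t])
    then show ?thesis
      by (intro integral_unique, elim has_integral_eq[rotated]) (simp add: x_neg)
  qed
  have "(x has_vector_derivative F (x s)) (at s)" for s
  proof -
    \<comment> \<open>Integrating from \<open>- N\<close> puts past and future into one integral
      equation, which gives the derivative at \<open>s\<close> also when
      \<open>s = 0\<close>.\<close>
    define N where "N = \<bar>s\<bar> + 1"
    have N: "0 < N" "- N < s" "s < N" by (auto simp: N_def)
    have eq: "x t = x (- N) + integral {-N..t} (\<lambda>s. F (x s))" if "t \<in> {-N..N}" for t
    proof (cases "t \<ge> 0")
      case True
      then show ?thesis
        using Henstock_Kurzweil_Integration.integral_combine[of "-N" 0 t "\<lambda>s. F (x s)"]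
          pos[of t] neg[of "- N"] N iF by (simp add: algebra_simps)
    next
      case False
      then show ?thesis
        using Henstock_Kurzweil_Integration.integral_combine[of "-N" t 0 "\<lambda>s. F (x s)"]
          neg[of t] neg[of "- N"] N iF that by (simp add: algebra_simps)
    qed
    have "((\<lambda>t. x (- N) + integral {-N..t} (\<lambda>s. F (x s))) has_vector_derivative 0 + F (x s))
        (at s within {-N..N})"
      by (intro has_vector_derivative_add has_vector_derivative_const
          integral_has_vector_derivative[OF cF]) (use N in auto)
    then have "((\<lambda>t. x (- N) + integral {-N..t} (\<lambda>s. F (x s))) has_vector_derivative F (x s))
        (at s within {-N..N})" by simp
    then have "(x has_vector_derivative F (x s)) (at s within {-N..N})"
      by (rule has_vector_derivative_transform[rotated 2, OF _ _ eq]) (use N in auto)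
    then show ?thesis using at_within_Icc_at[OF N(2,3)] by simp
  qed
  then show thesis using that x0 by blast
qed

lemma ode_integral:
  assumes "\<And>s. s \<in> {a..b} \<Longrightarrow> (x has_vector_derivative F (x s)) (at s)" "t \<in> {a..b}"
  shows "((\<lambda>s. F (x s)) has_integral x t - x a) {a..t}"
  by (rule fundamental_theorem_of_calculus)
    (use assms in \<open>auto intro: has_vector_derivative_at_within\<close>)

lemma ode_unique_forward:
  assumes x: "\<And>s. (x has_vector_derivative F (x s)) (at s)"
    and y: "\<And>s. (y has_vector_derivative F (y s)) (at s)"
    and eq: "x 0 = y 0" and t: "0 \<le> t"
  shows "x t = y t"
proof (rule integral_equation_unique[where \<phi> = "\<lambda>_. F" and L = L and a = 0 and b = t and z = "x 0"])
  show "continuous_on {0..t} x" "continuous_on {0..t} y"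
    by (rule continuous_on_global_vector_derivative, rule x)
      (rule continuous_on_global_vector_derivative, rule y)
  show "((\<lambda>s. F (x s)) has_integral x r - x 0) {0..r}" if "r \<in> {0..t}" for r
    by (rule ode_integral[OF x that])
  show "((\<lambda>s. F (y s)) has_integral y r - x 0) {0..r}" if "r \<in> {0..t}" for r
    unfolding eq by (rule ode_integral[OF y that])
qed (use t lipD L_nonneg in auto)

lemma reflect_deriv:
  assumes "\<And>s. (x has_vector_derivative F (x s)) (at s)"
  shows "((\<lambda>s. x (- s)) has_vector_derivative - F (x (- s))) (at s)"
proof -
  have "((x \<circ> uminus) has_vector_derivative -1 *\<^sub>R F (x (- s))) (at s)"
    by (rule vector_diff_chain_at[OF _ assms]) (auto intro!: derivative_eq_intros)
  then show ?thesis by (simp add: o_def)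
qed

lemma ode_unique:
  assumes x: "\<And>s. (x has_vector_derivative F (x s)) (at s)"
    and y: "\<And>s. (y has_vector_derivative F (y s)) (at s)"
    and eq: "x 0 = y 0"
  shows "x t = y t"
proof (cases "0 \<le> t")
  case True
  then show ?thesis by (rule ode_unique_forward[OF x y eq])
next
  case False
  then show ?thesis
    using lipschitz_field.ode_unique_forward[OF reversed reflect_deriv[OF x] reflect_deriv[OF y],
        of "- t"] eq by simp
qed

lemma ode_flow_properties:
  "ode_flow F 0 y = y \<and> (\<forall>s. ((\<lambda>t. ode_flow F t y) has_vector_derivative F (ode_flow F s y)) (at s))"
proof -
  obtain x where x: "x 0 = y" "\<And>s. (x has_vector_derivative F (x s)) (at s)"
    by (rule ode_solution_exists[of y]) blast
  have "(THE x. x 0 = y \<and> (\<forall>s. (x has_vector_derivative F (x s)) (at s))) = x"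
  proof (rule the_equality)
    fix x' assume x': "x' 0 = y \<and> (\<forall>s. (x' has_vector_derivative F (x' s)) (at s))"
    show "x' = x"
    proof
      show "x' t = x t" for t by (rule ode_unique) (use x' x in auto)
    qed
  qed (use x in auto)
  then have "(\<lambda>t. ode_flow F t y) = x" by (auto simp: ode_flow_def)
  with x show ?thesis by (metis (no_types, lifting))
qed

lemma ode_flow_0: "ode_flow F 0 y = y"
  using ode_flow_properties by blast

lemma ode_flow_deriv: "((\<lambda>t. ode_flow F t y) has_vector_derivative F (ode_flow F s y)) (at s)"
  using ode_flow_properties by blast

lemma ode_flow_unique:
  assumes "\<And>s. (x has_vector_derivative F (x s)) (at s)"
  shows "x t = ode_flow F t (x 0)"
  by (rule ode_unique[OF assms ode_flow_deriv]) (simp add: ode_flow_0)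

lemma ode_flow_add: "ode_flow F (s + t) y = ode_flow F s (ode_flow F t y)"
proof -
  have "((\<lambda>s. ode_flow F (s + t) y) has_vector_derivative F (ode_flow F (s + t) y)) (at s)" for s
  proof -
    have "(((\<lambda>t. ode_flow F t y) \<circ> (\<lambda>s. s + t)) has_vector_derivative
        1 *\<^sub>R F (ode_flow F (s + t) y)) (at s)"
      by (rule vector_diff_chain_at[OF _ ode_flow_deriv]) (auto intro!: derivative_eq_intros)
    then show ?thesis by (simp add: o_def)
  qed
  from ode_flow_unique[OF this] show ?thesis by simp
qed

lemma ode_flow_cont: "continuous_on S (\<lambda>t. ode_flow F t y)"
  by (rule continuous_on_global_vector_derivative) (rule ode_flow_deriv)

lemma ode_flow_reversed: "ode_flow (\<lambda>y. - F y) t y = ode_flow F (- t) y"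
  using lipschitz_field.ode_flow_unique[OF reversed reflect_deriv[OF ode_flow_deriv], of t y]
  by (simp add: ode_flow_0)

text \<open>The bridge from relay trajectories, known only through an integral equation, to the
  flow.\<close>

lemma integral_solution_eq_ode_flow:
  assumes x: "continuous_on {a..b} x"
    and ix: "\<And>t. t \<in> {a..b} \<Longrightarrow> ((\<lambda>s. F (x s)) has_integral x t - x a) {a..t}"
    and t: "t \<in> {a..b}"
  shows "x t = ode_flow F (t - a) (x a)"
proof (rule integral_equation_unique[where \<phi> = "\<lambda>_. F" and z = "x a", OF x _ _ L_nonneg ix _ t])
  have d: "((\<lambda>t. ode_flow F (t - a) (x a)) has_vector_derivative
      F (ode_flow F (s - a) (x a))) (at s)" for s
  proof -
    have "(((\<lambda>t. ode_flow F t (x a)) \<circ> (\<lambda>s. s - a)) has_vector_derivative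
        1 *\<^sub>R F (ode_flow F (s - a) (x a))) (at s)"
      by (rule vector_diff_chain_at[OF _ ode_flow_deriv]) (auto intro!: derivative_eq_intros)
    then show ?thesis by (simp add: o_def)
  qed
  show "continuous_on {a..b} (\<lambda>t. ode_flow F (t - a) (x a))"
    by (rule continuous_on_global_vector_derivative) (rule d)
  show "((\<lambda>s. F (ode_flow F (s - a) (x a))) has_integral ode_flow F (r - a) (x a) - x a) {a..r}"
    if "r \<in> {a..b}" for r
    using ode_integral[OF d that] by (simp add: ode_flow_0)
qed (use lipD in auto)

text \<open>The fields are compared only in the tube of radius 1 about the reference orbit. As long
  as the perturbed orbit stays in the tube, \<open>gronwall\<close> yields the bound; since the
  bound is below 1, the orbit cannot leave.\<close>

lemma perturbed_flow:
  assumes G: "lipschitz_field G L'"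
    and \<mu>: "\<And>p s. s \<in> {0..A} \<Longrightarrow> dist p (ode_flow F s y0) \<le> 1 \<Longrightarrow> norm (G p - F p) \<le> \<mu>"
    and small: "(dist y y0 + \<mu> * A) * exp (L * A) < 1"
    and A: "t \<in> {0..A}"
  shows "dist (ode_flow G t y) (ode_flow F t y0) \<le> (dist y y0 + \<mu> * A) * exp (L * A)"
proof -
  interpret G: lipschitz_field G L' by (rule G)
  let ?B = "(dist y y0 + \<mu> * A) * exp (L * A)"
  define \<phi> where "\<phi> = (\<lambda>t. norm (ode_flow G t y - ode_flow F t y0))"
  have c: "continuous_on S \<phi>" for S
    unfolding \<phi>_def by (intro continuous_intros ode_flow_cont G.ode_flow_cont)
  have A0: "0 \<le> A" using A by auto
  have mu0: "0 \<le> \<mu>" using \<mu>[of 0 "ode_flow F 0 y0"] A0 by (auto intro: order_trans[OF norm_ge_zero])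
  have est: "\<phi> r \<le> ?B" if r: "r \<in> {0..A}" and le: "\<And>s. s \<in> {0..r} \<Longrightarrow> \<phi> s \<le> 1" for r
  proof -
    have "\<phi> r \<le> (dist y y0 + \<mu> * A) * exp (L * (r - 0))"
    proof (rule gronwall[OF c L_nonneg, where b = r])
      fix s assume s: "s \<in> {0..r}"
      have i: "((\<lambda>q. G (ode_flow G q y) - F (ode_flow F q y0)) has_integral
          (ode_flow G s y - y) - (ode_flow F s y0 - y0)) {0..s}"
        using has_integral_diff[OF G.ode_integral[OF G.ode_flow_deriv, of s 0 s y]
            ode_integral[OF ode_flow_deriv, of s 0 s y0]] s
        by (simp add: ode_flow_0 G.ode_flow_0)
      have "norm (integral {0..s} (\<lambda>q. G (ode_flow G q y) - F (ode_flow F q y0)))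
          \<le> integral {0..s} (\<lambda>q. \<mu> + L * \<phi> q)"
      proof (rule Henstock_Kurzweil_Integration.integral_norm_bound_integral
          [OF has_integral_integrable[OF i]])
        show "(\<lambda>q. \<mu> + L * \<phi> q) integrable_on {0..s}"
          by (intro integrable_continuous_real continuous_intros c)
        fix q assume q: "q \<in> {0..s}"
        have "norm (G (ode_flow G q y) - F (ode_flow G q y)) \<le> \<mu>"
          using \<mu>[of q "ode_flow G q y"] le[of q] q s r by (auto simp: dist_norm \<phi>_def)
        moreover have "norm (F (ode_flow G q y) - F (ode_flow F q y0)) \<le> L * \<phi> q"
          unfolding \<phi>_def by (rule lipD)
        ultimately show "norm (G (ode_flow G q y) - F (ode_flow F q y0)) \<le> \<mu> + L * \<phi> q"
          using norm_triangle_ineq[of "G (ode_flow G q y) - F (ode_flow G q y)"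
              "F (ode_flow G q y) - F (ode_flow F q y0)"] by simp
      qed
      moreover have "integral {0..s} (\<lambda>q. \<mu> + L * \<phi> q) = \<mu> * s + L * integral {0..s} \<phi>"
      proof -
        have "integral {0..s} (\<lambda>q. \<mu> + L * \<phi> q)
            = integral {0..s} (\<lambda>q. \<mu>) + integral {0..s} (\<lambda>q. L * \<phi> q)"
          by (rule Henstock_Kurzweil_Integration.integral_add)
            (intro integrable_continuous_real continuous_intros c)+
        then show ?thesis using s by simp
      qed
      moreover have "\<phi> s \<le> dist y y0 + norm ((ode_flow G s y - y) - (ode_flow F s y0 - y0))"
        using norm_triangle_ineq[of "y - y0" "(ode_flow G s y - y) - (ode_flow F s y0 - y0)"]
        by (simp add: \<phi>_def dist_norm)
      moreover have "\<mu> * s \<le> \<mu> * A" using s r mu0 by (intro mult_left_mono) auto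
      ultimately show "\<phi> s \<le> (dist y y0 + \<mu> * A) + L * integral {0..s} \<phi>"
        by (simp add: integral_unique[OF i])
    qed (use r in auto)
    also have "\<dots> \<le> ?B"
      using r L_nonneg mu0 A0 by (intro mult_left_mono) (auto intro!: mult_left_mono)
    finally show ?thesis .
  qed
  have "\<phi> s < 1" if s: "s \<in> {0..A}" for s
  proof (rule ccontr)
    assume "\<not> \<phi> s < 1"
    \<comment> \<open>Its minimum would be the first time at distance at least 1. Up to that time
      \<open>est\<close> applies and gives a distance below 1.\<close>
    define Z where "Z = {r \<in> {0..A}. 1 \<le> \<phi> r}"
    have Z: "closed Z" "s \<in> Z"
      using s \<open>\<not> \<phi> s < 1\<close> unfolding Z_def
      by (auto intro!: closed_Collect_conj closed_Collect_le continuous_intros c)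
    have "bounded Z" by (rule bounded_subset[of "{0..A}"]) (auto simp: Z_def)
    with Z have "compact Z" by (simp add: compact_eq_bounded_closed)
    then obtain m where m: "m \<in> Z" "\<And>r. r \<in> Z \<Longrightarrow> m \<le> r"
      using compact_attains_inf[of Z] Z(2) by auto
    have lt: "\<phi> r < 1" if "0 \<le> r" "r < m" for r
      using m(2)[of r] m(1) that by (force simp: Z_def)
    have B0: "0 \<le> ?B" using mu0 A0 by simp
    have "\<phi> m \<le> 1"
    proof (cases "m = 0")
      case True
      have "dist y y0 * 1 \<le> ?B" using mu0 A0 L_nonneg by (intro mult_mono) auto
      then show ?thesis using small True by (simp add: \<phi>_def ode_flow_0 G.ode_flow_0 dist_norm)
    next
      case False
      then have m0: "0 < m" using m(1) by (auto simp: Z_def)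
      show ?thesis
      proof (rule tendsto_upperbound[where F = "at_left m"])
        show "(\<phi> \<longlongrightarrow> \<phi> m) (at_left m)"
          using c[of UNIV] by (auto simp: continuous_on_def intro: tendsto_within_subset)
        show "\<forall>\<^sub>F r in at_left m. \<phi> r \<le> 1"
          by (rule eventually_at_leftI[of 0]) (use lt m0 in \<open>auto intro: less_imp_le\<close>)
      qed simp
    qed
    then have "\<phi> r \<le> 1" if "r \<in> {0..m}" for r
      using lt[of r] that by (cases "r = m") auto
    then have "\<phi> m \<le> ?B" using est[of m] m(1) by (auto simp: Z_def)
    then show False using m(1) small by (auto simp: Z_def)
  qed
  then show ?thesis using est[OF A] A by (auto simp: dist_norm \<phi>_def less_imp_le)
qed

end

text \<open>On a compact tube around the orbit at \<open>lam0\<close> the fields differ uniformly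
  little, by uniform continuity; \<open>perturbed_flow\<close> turns this into closeness of the
  orbits, uniformly on the time interval.\<close>

lemma family_perturbation:
  fixes F :: "real \<Rightarrow> 'a::euclidean_space \<Rightarrow> 'a"
  assumes cont: "continuous_on UNIV (\<lambda>(y, lam). F lam y)"
    and lips: "\<And>lam. \<exists>L. L-lipschitz_on UNIV (F lam)"
    and e: "0 < e"
  shows "\<exists>d>0. \<forall>lam y. dist lam lam0 < d \<longrightarrow> dist y y0 < d \<longrightarrow>
           (\<forall>t\<in>{0..A}. dist (ode_flow (F lam) t y) (ode_flow (F lam0) t y0) < e)"
proof (cases "0 \<le> A")
  case False
  then show ?thesis by (auto intro!: exI[of _ 1])
next
  case A: True
  obtain L where "L-lipschitz_on UNIV (F lam0)" using lips by blast
  then interpret lipschitz_field "F lam0" L by unfold_locales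
  define B where "B = exp (L * A)"
  have B: "0 < B" by (simp add: B_def)
  define K where "K = (\<lambda>(s, v). ode_flow (F lam0) s y0 + v) ` ({0..A} \<times> cball 0 1)"
  have "compact K"
    unfolding K_def
  proof (rule compact_continuous_image)
    show "continuous_on ({0..A} \<times> cball 0 1) (\<lambda>(s, v). ode_flow (F lam0) s y0 + v)"
      unfolding split_beta
      by (intro continuous_intros continuous_on_compose2[OF ode_flow_cont[of UNIV y0]]) auto
  qed (auto intro!: compact_Times)
  then have "compact (K \<times> cball lam0 1)" by (intro compact_Times) auto
  then have uc: "uniformly_continuous_on (K \<times> cball lam0 1) (\<lambda>(y, lam). F lam y)"
    by (intro compact_uniformly_continuous continuous_on_subset[OF cont]) auto
  \<comment> \<open>Chosen so that \<open>(m + m * A) * B = min e 1 / 4\<close>, which is below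
    \<open>e\<close> and also below 1, as \<open>perturbed_flow\<close> demands.\<close>
  define m where "m = min e 1 / (4 * B * (1 + A))"
  have m: "0 < m" using e B A by (auto simp: m_def)
  obtain d where d: "d > 0" "\<And>p q. p \<in> K \<times> cball lam0 1 \<Longrightarrow> q \<in> K \<times> cball lam0 1 \<Longrightarrow>
      dist p q < d \<Longrightarrow> dist ((\<lambda>(y, lam). F lam y) p) ((\<lambda>(y, lam). F lam y) q) < m"
    using uc m unfolding uniformly_continuous_on_def by metis
  define d' where "d' = min (min d 1) m"
  show ?thesis
  proof (intro exI[of _ d'] conjI allI impI ballI)
    show "0 < d'" using d m by (simp add: d'_def)
    fix lam y t assume a: "dist lam lam0 < d'" "dist y y0 < d'" and t: "t \<in> {0..A}"
    obtain L' where "L'-lipschitz_on UNIV (F lam)" using lips by blast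
    then have G: "lipschitz_field (F lam) L'" by unfold_locales
    have \<mu>: "norm (F lam p - F lam0 p) \<le> m" if "s \<in> {0..A}" "dist p (ode_flow (F lam0) s y0) \<le> 1"
      for p s
    proof -
      have "p = (\<lambda>(s, v). ode_flow (F lam0) s y0 + v) (s, p - ode_flow (F lam0) s y0)" by simp
      then have "p \<in> K" using that unfolding K_def
        by (intro image_eqI) (auto simp: dist_norm)
      then show ?thesis
        using d(2)[of "(p, lam)" "(p, lam0)"] a
        by (auto simp: dist_Pair_Pair dist_norm d'_def abs_minus_commute)
    qed
    have "(dist y y0 + m * A) * B \<le> (m + m * A) * B"
      using a B by (intro mult_right_mono) (auto simp: d'_def)
    also have "\<dots> = min e 1 / 4"
    proof -
      have "m * (4 * B * (1 + A)) = min e 1" using B A by (simp add: m_def)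
      then show ?thesis by (simp add: algebra_simps)
    qed
    finally have le: "(dist y y0 + m * A) * B \<le> min e 1 / 4" .
    then have lt: "(dist y y0 + m * A) * exp (L * A) < 1" using e by (simp add: B_def)
    have "dist (ode_flow (F lam) t y) (ode_flow (F lam0) t y0) \<le> (dist y y0 + m * A) * exp (L * A)"
      by (rule perturbed_flow[OF G \<mu> lt t])
    with le e show "dist (ode_flow (F lam) t y) (ode_flow (F lam0) t y0) < e"
      by (simp add: B_def)
  qed
qed

text \<open>Closeness at equal times, obtained for negative times through the reversed field, is
  combined with continuity in time of the single orbit at \<open>lam0\<close>.\<close>

lemma continuous_family_flow:
  fixes F :: "real \<Rightarrow> 'a::euclidean_space \<Rightarrow> 'a"
  assumes cont: "continuous_on UNIV (\<lambda>(y, lam). F lam y)"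
    and lips: "\<And>lam. \<exists>L. L-lipschitz_on UNIV (F lam)"
  shows "continuous_on UNIV (\<lambda>(lam, t, y). ode_flow (F lam) t y)"
  unfolding continuous_on_iff
proof (intro ballI allI impI, clarify)
  fix lam0 t0 :: real and y0 :: 'a and e :: real assume e: "0 < e"
  obtain L where "L-lipschitz_on UNIV (F lam0)" using lips by blast
  then interpret lipschitz_field "F lam0" L by unfold_locales
  have lipneg: "\<exists>L. L-lipschitz_on UNIV (\<lambda>y. - F lam y)" for lam
    using lips[of lam] by (auto simp: lipschitz_on_def dist_minus)
  have contneg: "continuous_on UNIV (\<lambda>(y, lam). - F lam y)"
    using continuous_on_minus[OF cont] by (simp add: split_beta)
  have e2: "0 < e / 2" using e by simp
  define A where "A = \<bar>t0\<bar> + 1"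
  obtain d1 where d1: "d1 > 0" "\<And>lam y t. dist lam lam0 < d1 \<Longrightarrow> dist y y0 < d1 \<Longrightarrow> t \<in> {0..A} \<Longrightarrow>
      dist (ode_flow (F lam) t y) (ode_flow (F lam0) t y0) < e / 2"
    using family_perturbation[OF cont lips e2, of lam0 y0 A] by blast
  obtain d2 where d2: "d2 > 0" "\<And>lam y t. dist lam lam0 < d2 \<Longrightarrow> dist y y0 < d2 \<Longrightarrow> t \<in> {0..A} \<Longrightarrow>
      dist (ode_flow (\<lambda>y. - F lam y) t y) (ode_flow (\<lambda>y. - F lam0 y) t y0) < e / 2"
    using family_perturbation[OF contneg lipneg e2, of lam0 y0 A] by blast
  obtain d3 where d3: "d3 > 0" "\<And>t. dist t t0 < d3 \<Longrightarrow>
      dist (ode_flow (F lam0) t y0) (ode_flow (F lam0) t0 y0) < e / 2"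
    using ode_flow_cont[of UNIV y0] e2 unfolding continuous_on_iff by (metis UNIV_I)
  define d where "d = min (min d1 d2) (min d3 1)"
  have "dist (ode_flow (F lam) t y) (ode_flow (F lam0) t0 y0) < e"
    if "dist (lam, t, y) (lam0, t0, y0) < d" for lam t y
  proof -
    have "dist lam lam0 \<le> dist (lam, t, y) (lam0, t0, y0)"
      "dist (t, y) (t0, y0) \<le> dist (lam, t, y) (lam0, t0, y0)"
      "dist t t0 \<le> dist (t, y) (t0, y0)" "dist y y0 \<le> dist (t, y) (t0, y0)"
      using dist_fst_le[of "(lam, t, y)" "(lam0, t0, y0)"] dist_snd_le[of "(lam, t, y)" "(lam0, t0, y0)"]
        dist_fst_le[of "(t, y)" "(t0, y0)"] dist_snd_le[of "(t, y)" "(t0, y0)"] by auto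
    with that have c: "dist lam lam0 < d" "dist t t0 < d" "dist y y0 < d" by auto
    obtain L' where "L'-lipschitz_on UNIV (F lam)" using lips by blast
    then interpret G: lipschitz_field "F lam" L' by unfold_locales
    have tA: "\<bar>t\<bar> \<le> A" using c(2) by (auto simp: d_def A_def dist_real_def)
    have "dist (ode_flow (F lam) t y) (ode_flow (F lam0) t y0) < e / 2"
    proof (cases "t \<ge> 0")
      case True
      then show ?thesis using d1(2)[of lam y t] c tA by (simp add: d_def)
    next
      case False
      then show ?thesis using d2(2)[of lam y "- t"] c tA
        by (simp add: d_def ode_flow_reversed G.ode_flow_reversed)
    qed
    moreover have "dist (ode_flow (F lam0) t y0) (ode_flow (F lam0) t0 y0) < e / 2"
      using d3(2) c(2) by (simp add: d_def)
    ultimately show ?thesis by (metis dist_commute dist_triangle_half_r)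
  qed
  moreover have "0 < d" using d1 d2 d3 by (simp add: d_def)
  ultimately show "\<exists>d>0. \<forall>x'\<in>UNIV. dist x' (lam0, t0, y0) < d \<longrightarrow>
      dist (case x' of (lam, t, y) \<Rightarrow> ode_flow (F lam) t y) (ode_flow (F lam0) t0 y0) < e"
    by (intro exI[of _ d]) auto
qed

section \<open>Existence and uniqueness for the relay evolution\<close>

text \<open>Meant for the right-hand side along a relay trajectory: one control value holds on a
  Borel set of times, the other on its complement.\<close>

lemma integrable_on_if_borel:
  fixes p q :: "real \<Rightarrow> 'a::euclidean_space"
  assumes S: "S \<in> sets borel" and p: "continuous_on {a..b} p" and q: "continuous_on {a..b} q"
  shows "(\<lambda>s. if s \<in> S then p s else q s) integrable_on {a..b}"
proof -
  have 1: "p integrable_on S \<inter> {a..b}"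
    by (rule set_borel_integral_eq_integral(1),
        rule set_integrable_subset[OF borel_integrable_atLeastAtMost'[OF p]]) (use S in auto)
  have 2: "q integrable_on (- S) \<inter> {a..b}"
    by (rule set_borel_integral_eq_integral(1),
        rule set_integrable_subset[OF borel_integrable_atLeastAtMost'[OF q]]) (use S in auto)
  have "(\<lambda>s. (if s \<in> S then p s else 0) + (if s \<in> - S then q s else 0)) integrable_on {a..b}"
    using 1 2 by (intro Henstock_Kurzweil_Integration.integrable_add) (simp_all only: integrable_restrict_Int)
  then show ?thesis by (rule integrable_eq) auto
qed

section \<open>The relay rule for a scalar signal\<close>

context
  fixes \<epsilon> \<tau> :: real
  assumes pos: "0 < \<epsilon>" "0 < \<tau>"
begin

lemma relay_value_last_exit:
  assumes v: "relay_value \<epsilon> \<tau> g u0 t v" and t: "\<bar>g (t - \<tau>)\<bar> < \<epsilon>"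
    and s: "s \<in> {-\<tau>..t - \<tau>}" "\<not> \<bar>g s\<bar> < \<epsilon>"
  obtains b where "b \<in> {-\<tau>..t - \<tau>}" "\<bar>g b\<bar> \<ge> \<epsilon>" "\<forall>s\<in>{b<..t - \<tau>}. \<bar>g s\<bar> < \<epsilon>"
    "g b \<ge> \<epsilon> \<longrightarrow> v = -1" "g b \<le> -\<epsilon> \<longrightarrow> v = 1"
proof -
  have n: "(\<forall>s\<in>{-\<tau>..t - \<tau>}. \<bar>g s\<bar> < \<epsilon>) = False" using s by blast
  show thesis using v t that unfolding relay_value_def n if_False by blast
qed

lemma relay_value_unique:
  assumes "relay_value \<epsilon> \<tau> g u0 t v" "relay_value \<epsilon> \<tau> g u0 t v'"
  shows "v = v'"
proof (cases "\<bar>g (t - \<tau>)\<bar> < \<epsilon> \<and> \<not> (\<forall>s\<in>{-\<tau>..t - \<tau>}. \<bar>g s\<bar> < \<epsilon>)")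
  case False
  then show ?thesis using assms pos by (auto simp: relay_value_def)
next
  case True
  then obtain s where s: "s \<in> {-\<tau>..t - \<tau>}" "\<not> \<bar>g s\<bar> < \<epsilon>" by blast
  obtain a where a: "a \<in> {-\<tau>..t - \<tau>}" "\<bar>g a\<bar> \<ge> \<epsilon>" "\<forall>s\<in>{a<..t - \<tau>}. \<bar>g s\<bar> < \<epsilon>"
    "g a \<ge> \<epsilon> \<longrightarrow> v = -1" "g a \<le> -\<epsilon> \<longrightarrow> v = 1"
    using relay_value_last_exit[OF assms(1) conjunct1[OF True] s] by metis
  obtain b where b: "b \<in> {-\<tau>..t - \<tau>}" "\<bar>g b\<bar> \<ge> \<epsilon>" "\<forall>s\<in>{b<..t - \<tau>}. \<bar>g s\<bar> < \<epsilon>"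
    "g b \<ge> \<epsilon> \<longrightarrow> v' = -1" "g b \<le> -\<epsilon> \<longrightarrow> v' = 1"
    using relay_value_last_exit[OF assms(2) conjunct1[OF True] s] by metis
  have "a = b" using a b by (cases a b rule: linorder_cases) force+
  moreover have "g a \<ge> \<epsilon> \<or> g a \<le> - \<epsilon>" using a(2) by linarith
  ultimately show ?thesis using a b by auto
qed

text \<open>Continuity makes the set of times outside the dead zone compact, so that there is a last
  one.\<close>

lemma relay_value_exists:
  assumes g: "continuous_on {-\<tau>..t - \<tau>} g" and t: "0 \<le> t" and u0: "u0 \<in> {-1, 1}"
  shows "\<exists>v\<in>{-1, 1}. relay_value \<epsilon> \<tau> g u0 t v"
proof (cases "\<bar>g (t - \<tau>)\<bar> < \<epsilon> \<and> \<not> (\<forall>s\<in>{-\<tau>..t - \<tau>}. \<bar>g s\<bar> < \<epsilon>)")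
  case False
  then consider "g (t - \<tau>) \<ge> \<epsilon>" | "g (t - \<tau>) \<le> - \<epsilon>" |
    "\<bar>g (t - \<tau>)\<bar> < \<epsilon>" "\<forall>s\<in>{-\<tau>..t - \<tau>}. \<bar>g s\<bar> < \<epsilon>" by linarith
  then show ?thesis using u0 pos by cases (auto simp: relay_value_def)
next
  case True
  define Z where "Z = {s \<in> {-\<tau>..t - \<tau>}. \<epsilon> \<le> \<bar>g s\<bar>}"
  have "closed ({-\<tau>..t - \<tau>} \<inter> (\<lambda>s. \<bar>g s\<bar>) -` {\<epsilon>..})"
    by (intro continuous_closed_preimage continuous_intros g)
  also have "{-\<tau>..t - \<tau>} \<inter> (\<lambda>s. \<bar>g s\<bar>) -` {\<epsilon>..} = Z" by (auto simp: Z_def)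
  finally have "closed Z" .
  moreover have "bounded Z" by (rule bounded_subset[of "{-\<tau>..t - \<tau>}"]) (auto simp: Z_def)
  ultimately have "compact Z" by (simp add: compact_eq_bounded_closed)
  moreover have "Z \<noteq> {}" using True by (auto simp: Z_def not_less)
  ultimately obtain a where a: "a \<in> Z" "\<And>s. s \<in> Z \<Longrightarrow> s \<le> a"
    using compact_attains_sup[of Z] by auto
  have "\<forall>s\<in>{a<..t - \<tau>}. \<bar>g s\<bar> < \<epsilon>"
  proof (rule ballI, rule ccontr)
    fix s assume s: "s \<in> {a<..t - \<tau>}" "\<not> \<bar>g s\<bar> < \<epsilon>"
    then have "s \<in> Z" using a(1) by (auto simp: Z_def)
    with a(2) s show False by fastforce
  qed
  then have "relay_value \<epsilon> \<tau> g u0 t (if g a \<ge> \<epsilon> then -1 else 1)"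
    unfolding relay_value_def using True a(1) pos by (auto simp: Z_def intro!: bexI[of _ a])
  then show ?thesis by (rule bexI) simp
qed

text \<open>This delayed dependence makes the method of steps work, for existence as well as for
  uniqueness.\<close>

lemma relay_value_cong:
  assumes "\<And>s. s \<in> {-\<tau>..t - \<tau>} \<Longrightarrow> g s = g' s" "0 \<le> t"
  shows "relay_value \<epsilon> \<tau> g u0 t v \<longleftrightarrow> relay_value \<epsilon> \<tau> g' u0 t v"
proof -
  have e: "g (t - \<tau>) = g' (t - \<tau>)" using assms by simp
  have "(\<forall>s\<in>{-\<tau>..t - \<tau>}. \<bar>g s\<bar> < \<epsilon>) = (\<forall>s\<in>{-\<tau>..t - \<tau>}. \<bar>g' s\<bar> < \<epsilon>)"
    using assms by (intro ball_cong) auto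
  moreover have "(\<exists>\<sigma>\<in>{-\<tau>..t - \<tau>}. \<bar>g \<sigma>\<bar> \<ge> \<epsilon> \<and> (\<forall>s\<in>{\<sigma><..t - \<tau>}. \<bar>g s\<bar> < \<epsilon>) \<and>
                (g \<sigma> \<ge> \<epsilon> \<longrightarrow> v = -1) \<and> (g \<sigma> \<le> -\<epsilon> \<longrightarrow> v = 1)) \<longleftrightarrow>
        (\<exists>\<sigma>\<in>{-\<tau>..t - \<tau>}. \<bar>g' \<sigma>\<bar> \<ge> \<epsilon> \<and> (\<forall>s\<in>{\<sigma><..t - \<tau>}. \<bar>g' s\<bar> < \<epsilon>) \<and>
                (g' \<sigma> \<ge> \<epsilon> \<longrightarrow> v = -1) \<and> (g' \<sigma> \<le> -\<epsilon> \<longrightarrow> v = 1))"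
    using assms by (intro bex_cong conj_cong ball_cong) auto
  ultimately show ?thesis unfolding relay_value_def e by simp
qed

text \<open>The last time outside the dead zone is \<open>a\<close> or later, and there
  \<open>g\<close> is above \<open>-\<epsilon>\<close>, hence at least \<open>\<epsilon>\<close>,
  however often \<open>g\<close> has crossed \<open>\<epsilon>\<close> in between. This is the form
  in which the hysteresis is exploited.\<close>

lemma relay_value_minus_one:
  assumes v: "relay_value \<epsilon> \<tau> g u0 t v" and a: "a \<in> {-\<tau>..t - \<tau>}" "g a \<ge> \<epsilon>"
    and g: "\<And>s. s \<in> {a..t - \<tau>} \<Longrightarrow> - \<epsilon> < g s"
  shows "v = -1"
proof (cases "\<bar>g (t - \<tau>)\<bar> < \<epsilon>")
  case True
  have "\<not> \<bar>g a\<bar> < \<epsilon>" using a by linarith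
  from relay_value_last_exit[OF v True a(1) this]
  obtain b where b: "b \<in> {-\<tau>..t - \<tau>}" "\<bar>g b\<bar> \<ge> \<epsilon>" "\<forall>s\<in>{b<..t - \<tau>}. \<bar>g s\<bar> < \<epsilon>"
    "g b \<ge> \<epsilon> \<longrightarrow> v = -1" by metis
  have "a \<le> b"
  proof (rule ccontr)
    assume "\<not> a \<le> b"
    then have "\<bar>g a\<bar> < \<epsilon>" using b(3) a(1) by auto
    then show False using a(2) by linarith
  qed
  then have "g b \<ge> \<epsilon>" using g[of b] b by auto
  with b show ?thesis by simp
next
  case False
  then have "g (t - \<tau>) \<ge> \<epsilon>" using g[of "t - \<tau>"] a by auto
  then show ?thesis using v by (simp add: relay_value_def)
qed

lemma relay_value_one:
  assumes v: "relay_value \<epsilon> \<tau> g u0 t v" and a: "a \<in> {-\<tau>..t - \<tau>}" "g a \<le> - \<epsilon>"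
    and g: "\<And>s. s \<in> {a..t - \<tau>} \<Longrightarrow> g s < \<epsilon>"
  shows "v = 1"
proof (cases "\<bar>g (t - \<tau>)\<bar> < \<epsilon>")
  case True
  have "\<not> \<bar>g a\<bar> < \<epsilon>" using a by linarith
  from relay_value_last_exit[OF v True a(1) this]
  obtain b where b: "b \<in> {-\<tau>..t - \<tau>}" "\<bar>g b\<bar> \<ge> \<epsilon>" "\<forall>s\<in>{b<..t - \<tau>}. \<bar>g s\<bar> < \<epsilon>"
    "g b \<le> - \<epsilon> \<longrightarrow> v = 1" by metis
  have "a \<le> b"
  proof (rule ccontr)
    assume "\<not> a \<le> b"
    then have "\<bar>g a\<bar> < \<epsilon>" using b(3) a(1) by auto
    then show False using a(2) by linarith
  qed
  then have "g b \<le> - \<epsilon>" using g[of b] b by auto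
  with b show ?thesis by simp
next
  case False
  then have "g (t - \<tau>) \<le> - \<epsilon>" using g[of "t - \<tau>"] a by auto
  then show ?thesis using v by (simp add: relay_value_def)
qed

text \<open>Between \<open>s - \<tau>\<close> and \<open>t - \<tau>\<close> the signal stays in the
  dead zone, so both times refer to the same last exit, or both to \<open>u0\<close>. This gives
  local constancy of the state, needed for measurability.\<close>

lemma relay_value_hold:
  assumes v: "relay_value \<epsilon> \<tau> g u0 s v" and st: "0 \<le> s" "s \<le> t"
    and g: "\<And>r. r \<in> {s - \<tau>..t - \<tau>} \<Longrightarrow> \<bar>g r\<bar> < \<epsilon>"
  shows "relay_value \<epsilon> \<tau> g u0 t v"
proof (cases "\<forall>r\<in>{-\<tau>..t - \<tau>}. \<bar>g r\<bar> < \<epsilon>")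
  case True
  moreover have "\<bar>g (s - \<tau>)\<bar> < \<epsilon>" "\<bar>g (t - \<tau>)\<bar> < \<epsilon>" using g st by auto
  moreover have "\<forall>r\<in>{-\<tau>..s - \<tau>}. \<bar>g r\<bar> < \<epsilon>" using True st by auto
  ultimately show ?thesis using v by (auto simp: relay_value_def)
next
  case False
  have e: "\<bar>g (s - \<tau>)\<bar> < \<epsilon>" "\<bar>g (t - \<tau>)\<bar> < \<epsilon>" using g st by auto
  have "\<not> (\<forall>r\<in>{-\<tau>..s - \<tau>}. \<bar>g r\<bar> < \<epsilon>)"
  proof
    assume all: "\<forall>r\<in>{-\<tau>..s - \<tau>}. \<bar>g r\<bar> < \<epsilon>"
    have "\<bar>g r\<bar> < \<epsilon>" if "r \<in> {-\<tau>..t - \<tau>}" for r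
      using all g[of r] that by (cases "r \<le> s - \<tau>") auto
    with False show False by blast
  qed
  then obtain r where r: "r \<in> {-\<tau>..s - \<tau>}" "\<not> \<bar>g r\<bar> < \<epsilon>" by blast
  obtain b where b: "b \<in> {-\<tau>..s - \<tau>}" "\<bar>g b\<bar> \<ge> \<epsilon>" "\<forall>r\<in>{b<..s - \<tau>}. \<bar>g r\<bar> < \<epsilon>"
    "g b \<ge> \<epsilon> \<longrightarrow> v = -1" "g b \<le> - \<epsilon> \<longrightarrow> v = 1"
    using relay_value_last_exit[OF v e(1) r] by metis
  have "\<bar>g r\<bar> < \<epsilon>" if "r \<in> {b<..t - \<tau>}" for r
    using b(3) g[of r] that by (cases "r \<le> s - \<tau>") auto
  with b st False e show ?thesis by (auto simp: relay_value_def intro!: bexI[of _ b])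
qed

text \<open>A total function of time, constant up to time 0, which lets a signal defined on the
  whole line drive the control in the existence proof.\<close>

definition relay_state :: "(real \<Rightarrow> real) \<Rightarrow> real \<Rightarrow> real \<Rightarrow> real" where
  "relay_state g u0 t = (if t \<le> 0 then u0 else THE v. relay_value \<epsilon> \<tau> g u0 t v)"

lemma relay_state_eq: "relay_value \<epsilon> \<tau> g u0 t v \<Longrightarrow> 0 < t \<Longrightarrow> relay_state g u0 t = v"
  unfolding relay_state_def by (simp, rule the_equality) (auto intro: relay_value_unique)

lemma relay_state:
  assumes "continuous_on UNIV g" "u0 \<in> {-1, 1}"
  shows "relay_state g u0 t \<in> {-1, 1}" "0 < t \<Longrightarrow> relay_value \<epsilon> \<tau> g u0 t (relay_state g u0 t)"
proof -
  have "relay_state g u0 t \<in> {-1, 1} \<and> relay_value \<epsilon> \<tau> g u0 t (relay_state g u0 t)" if "0 < t"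
    using relay_value_exists[OF continuous_on_subset[OF assms(1)], of t u0] that assms
      relay_state_eq[of g u0 t] by (metis less_imp_le subset_UNIV)
  then show "relay_state g u0 t \<in> {-1, 1}" "0 < t \<Longrightarrow> relay_value \<epsilon> \<tau> g u0 t (relay_state g u0 t)"
    using assms by (auto simp: relay_state_def)
qed

lemma relay_state_cong:
  assumes "\<And>s. s \<in> {-\<tau>..t - \<tau>} \<Longrightarrow> g s = g' s"
  shows "relay_state g u0 t = relay_state g' u0 t"
proof (cases "t \<le> 0")
  case False
  then have "relay_value \<epsilon> \<tau> g u0 t = relay_value \<epsilon> \<tau> g' u0 t"
    using relay_value_cong[of t g g'] assms by (intro ext) auto
  then show ?thesis by (simp add: relay_state_def)
qed (simp add: relay_state_def)

text \<open>
  Off the dead zone the state is prescribed by closed conditions on \<open>g\<close>, and inside it is locally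
  constant.
\<close>

lemma relay_state_borel:
  assumes g: "continuous_on UNIV g" and u0: "u0 \<in> {-1, 1}"
  shows "{t. relay_state g u0 t = 1} \<in> sets borel"
proof -
  define A where "A = {t. 0 < t \<and> \<bar>g (t - \<tau>)\<bar> < \<epsilon> \<and> relay_state g u0 t = 1}"
  have gs: "continuous_on UNIV (\<lambda>t. g (t - \<tau>))"
    by (rule continuous_on_compose2[OF g]) (auto intro!: continuous_intros)
  have "open A"
    unfolding open_contains_ball
  proof (rule ballI)
    fix t assume t: "t \<in> A"
    have "open {t. 0 < t \<and> \<bar>g (t - \<tau>)\<bar> < \<epsilon>}"
      by (intro open_Collect_conj open_Collect_less continuous_intros gs)
    then obtain d where d: "d > 0" "ball t d \<subseteq> {t. 0 < t \<and> \<bar>g (t - \<tau>)\<bar> < \<epsilon>}"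
      using t unfolding open_contains_ball A_def by blast
    have "s \<in> A" if s: "s \<in> ball t d" for s
    proof -
      have b: "\<bar>g r\<bar> < \<epsilon>" if "r \<in> {min s t - \<tau>..max s t - \<tau>}" for r
      proof -
        have "r + \<tau> \<in> ball t d" using that s by (auto simp: dist_real_def)
        then show ?thesis using d(2) by auto
      qed
      have "relay_state g u0 s = relay_state g u0 t"
      proof (cases "s \<le> t")
        case True
        then show ?thesis
          using relay_state(2)[OF g u0, of s] relay_value_hold[of g u0 s _ t] b d(2) s
            relay_state_eq[of g u0 t] t by (auto simp: A_def subset_iff)
      next
        case False
        then show ?thesis
          using relay_state(2)[OF g u0, of t] relay_value_hold[of g u0 t _ s] b d(2) s
            relay_state_eq[of g u0 s] t by (auto simp: A_def subset_iff)
      qed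
      then show ?thesis using d(2) s t by (auto simp: A_def)
    qed
    then show "\<exists>d>0. ball t d \<subseteq> A" using d(1) by blast
  qed
  moreover have "closed {t. g (t - \<tau>) \<le> - \<epsilon>}"
    by (intro closed_Collect_le continuous_intros gs)
  moreover have "{t. relay_state g u0 t = 1}
      = (if u0 = 1 then {..0} else {}) \<union> ({0<..} \<inter> {t. g (t - \<tau>) \<le> - \<epsilon>}) \<union> A"
  proof (rule set_eqI)
    fix t
    show "t \<in> {t. relay_state g u0 t = 1} \<longleftrightarrow>
        t \<in> (if u0 = 1 then {..0} else {}) \<union> ({0<..} \<inter> {t. g (t - \<tau>) \<le> - \<epsilon>}) \<union> A"
    proof (cases "t \<le> 0")
      case True
      then show ?thesis by (auto simp: relay_state_def A_def)
    next
      case False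
      then show ?thesis using relay_state(2)[OF g u0, of t] pos
        by (auto simp: relay_value_def A_def abs_less_iff not_le)
    qed
  qed
  ultimately show ?thesis by simp
qed

end

section \<open>The delayed system solved by the method of steps\<close>

locale relay =
  fixes f :: "'a::euclidean_space \<Rightarrow> real \<Rightarrow> real \<Rightarrow> 'a" and h :: "'a \<Rightarrow> real \<Rightarrow> real"
    and \<epsilon> \<tau> \<Theta> :: real
  assumes system: "relay_system f h \<epsilon> \<tau> \<Theta>"
begin

lemma pos: "0 < \<epsilon>" "0 < \<tau>" and \<tau>_le: "\<tau> \<le> \<Theta>"
  using system by (auto simp: relay_system_def)

lemma field_lipschitz: "c \<in> {-1, 1} \<Longrightarrow> \<exists>L. L-lipschitz_on UNIV (\<lambda>y. f y c lam)"
  using system by (auto simp: relay_system_def)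

lemma C1_continuous: "C1 g \<Longrightarrow> continuous_on UNIV g"
  unfolding C1_def by (metis continuous_at_imp_continuous_on has_derivative_continuous)

lemma field_continuous: "c \<in> {-1, 1} \<Longrightarrow> continuous_on UNIV (\<lambda>(y, lam). f y c lam)"
  using system by (intro C1_continuous) (auto simp: relay_system_def)

lemma h_continuous: "continuous_on UNIV (\<lambda>(y, lam). h y lam)"
  using system by (intro C1_continuous) (auto simp: relay_system_def)

lemma h_continuous_comp [continuous_intros]:
  "continuous_on S x \<Longrightarrow> continuous_on S l \<Longrightarrow> continuous_on S (\<lambda>s. h (x s) (l s))"
  using continuous_on_compose2[OF h_continuous, of S "\<lambda>s. (x s, l s)"]
  by (auto intro: continuous_on_Pair)

lemma f_continuous_comp:
  "c \<in> {-1, 1} \<Longrightarrow> continuous_on S x \<Longrightarrow> continuous_on S l \<Longrightarrow> continuous_on S (\<lambda>s. f (x s) c (l s))"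
  using continuous_on_compose2[OF field_continuous, of c S "\<lambda>s. (x s, l s)"]
  by (auto intro: continuous_on_Pair)

abbreviation state :: "real \<Rightarrow> (real \<Rightarrow> 'a) \<Rightarrow> real \<Rightarrow> real \<Rightarrow> real" where
  "state lam y \<equiv> relay_state \<epsilon> \<tau> (\<lambda>s. h (y s) lam)"

text \<open>The relay is driven by a given curve \<open>Y\<close> and not by the solution itself.
  The control is then a known Borel function of time, and the equation falls under
  \<open>caratheodory_solution\<close>.\<close>

lemma controlled_solution:
  fixes Y x0 :: "real \<Rightarrow> 'a"
  assumes Y: "continuous_on UNIV Y" and x0: "continuous_on UNIV x0" "\<And>t. t \<ge> 0 \<Longrightarrow> x0 t = x0 0"
    and u0: "u0 \<in> {-1, 1}"
  shows "\<exists>Z. continuous_on UNIV Z \<and> (\<forall>t\<le>0. Z t = x0 t) \<and>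
      (\<forall>t\<ge>0. ((\<lambda>s. f (Z s) (state lam Y u0 s) lam) has_integral Z t - x0 0) {0..t})"
proof -
  have gY: "continuous_on UNIV (\<lambda>s. h (Y s) lam)" by (intro continuous_intros Y)
  define \<phi> where "\<phi> = (\<lambda>s y. f y (state lam Y u0 s) lam)"
  have st: "state lam Y u0 s \<in> {-1, 1}" for s by (rule relay_state(1)[OF pos gY u0])
  obtain L1 where L1: "L1-lipschitz_on UNIV (\<lambda>y. f y 1 lam)" using field_lipschitz[of 1] by auto
  obtain L2 where L2: "L2-lipschitz_on UNIV (\<lambda>y. f y (-1) lam)" using field_lipschitz[of "-1"] by auto
  have lip: "norm (\<phi> s p - \<phi> s q) \<le> max L1 L2 * norm (p - q)" for s p q
  proof -
    have "norm (f p 1 lam - f q 1 lam) \<le> L1 * norm (p - q)"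
      "norm (f p (-1) lam - f q (-1) lam) \<le> L2 * norm (p - q)"
      using lipschitz_onD[OF L1, of p q] lipschitz_onD[OF L2, of p q] by (auto simp: dist_norm)
    moreover have "L1 * norm (p - q) \<le> max L1 L2 * norm (p - q)"
      "L2 * norm (p - q) \<le> max L1 L2 * norm (p - q)" by (auto intro: mult_right_mono)
    ultimately show ?thesis using st[of s] unfolding \<phi>_def by auto
  qed
  have bd: "norm (\<phi> s 0) \<le> max (norm (f 0 1 lam)) (norm (f 0 (-1) lam))" for s
    using st[of s] by (auto simp: \<phi>_def)
  have int: "(\<lambda>s. \<phi> s (x s)) integrable_on {0..t}" if x: "continuous_on UNIV x" for x t
  proof -
    have "(\<lambda>s. if s \<in> {s. state lam Y u0 s = 1} then f (x s) 1 lam else f (x s) (-1) lam)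
        integrable_on {0..t}"
      by (intro integrable_on_if_borel relay_state_borel[OF pos gY u0] f_continuous_comp
          continuous_on_subset[OF x] continuous_intros) auto
    then show ?thesis
    proof (rule integrable_eq)
      show "(if s \<in> {s. state lam Y u0 s = 1} then f (x s) 1 lam else f (x s) (-1) lam) = \<phi> s (x s)"
        for s using st[of s] by (auto simp: \<phi>_def)
    qed
  qed
  obtain x where x: "continuous_on UNIV x" "\<And>t. t \<le> 0 \<Longrightarrow> x t = x0 0"
    "\<And>t. t \<ge> 0 \<Longrightarrow> ((\<lambda>s. \<phi> s (x s)) has_integral x t - x0 0) {0..t}"
    using caratheodory_solution[OF lip bd int, of "x0 0"] by blast
  define Z where "Z = (\<lambda>t. x t + x0 t - x0 0)"
  have Zx: "Z t = x t" if "t \<ge> 0" for t using x0(2)[OF that] by (simp add: Z_def)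
  show ?thesis
  proof (intro exI[of _ Z] conjI allI impI)
    show "continuous_on UNIV Z" unfolding Z_def by (intro continuous_intros x x0)
    show "Z t = x0 t" if "t \<le> 0" for t using x(2)[OF that] by (simp add: Z_def)
    fix t :: real assume t: "0 \<le> t"
    show "((\<lambda>s. f (Z s) (state lam Y u0 s) lam) has_integral Z t - x0 0) {0..t}"
      unfolding Zx[OF t] by (rule has_integral_eq[OF _ x(3)[OF t]]) (simp add: Zx \<phi>_def)
  qed
qed

lemma controlled_unique:
  fixes x y :: "real \<Rightarrow> 'a"
  assumes "continuous_on {a..b} x" "continuous_on {a..b} y"
    and st: "\<And>s. s \<in> {a..b} \<Longrightarrow> u s \<in> {-1, 1}"
    and "\<And>t. t \<in> {a..b} \<Longrightarrow> ((\<lambda>s. f (x s) (u s) lam) has_integral x t - z) {a..t}"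
    and "\<And>t. t \<in> {a..b} \<Longrightarrow> ((\<lambda>s. f (y s) (u s) lam) has_integral y t - z) {a..t}"
    and t: "t \<in> {a..b}"
  shows "x t = y t"
proof -
  obtain L1 where L1: "L1-lipschitz_on UNIV (\<lambda>y. f y 1 lam)" using field_lipschitz[of 1] by auto
  obtain L2 where L2: "L2-lipschitz_on UNIV (\<lambda>y. f y (-1) lam)" using field_lipschitz[of "-1"] by auto
  have lip: "norm (f p (u s) lam - f q (u s) lam) \<le> max L1 L2 * norm (p - q)"
    if "s \<in> {a..b}" for s p q
  proof -
    have "norm (f p 1 lam - f q 1 lam) \<le> L1 * norm (p - q)"
      "norm (f p (-1) lam - f q (-1) lam) \<le> L2 * norm (p - q)"
      using lipschitz_onD[OF L1, of p q] lipschitz_onD[OF L2, of p q] by (auto simp: dist_norm)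
    moreover have "L1 * norm (p - q) \<le> max L1 L2 * norm (p - q)"
      "L2 * norm (p - q) \<le> max L1 L2 * norm (p - q)" by (auto intro: mult_right_mono)
    ultimately show ?thesis using st[OF that] by auto
  qed
  have "0 \<le> max L1 L2" using lipschitz_on_nonneg[OF L1] by linarith
  from integral_equation_unique[where \<phi> = "\<lambda>s p. f p (u s) lam", OF assms(1,2) lip this assms(4,5) t]
  show ?thesis by simp
qed

text \<open>\<open>Z (Suc k)\<close> solves the equation with the relay driven by
  \<open>Z k\<close>. Because of the delay the iterates become stationary: from \<open>Z k\<close>
  on they agree up to time \<open>k * \<tau>\<close>, and the solution is read off from these final
  values.\<close>

lemma relay_solution_exists:
  assumes \<xi>: "continuous_on {-\<Theta>..0} \<xi>" and u0: "u0 \<in> {-1, 1}"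
  shows "\<exists>y u. relay_solution f h \<epsilon> \<tau> \<Theta> lam \<xi> u0 y u"
proof -
  have \<Theta>: "0 < \<Theta>" using pos \<tau>_le by linarith
  define x0 where "x0 = (\<lambda>s. \<xi> (max (-\<Theta>) (min 0 s)))"
  have cx0: "continuous_on UNIV x0"
    unfolding x0_def by (rule continuous_on_compose2[OF \<xi>]) (use \<Theta> in \<open>auto intro!: continuous_intros\<close>)
  have x0: "x0 t = x0 0" if "t \<ge> 0" for t using that by (simp add: x0_def)
  have x00: "x0 0 = \<xi> 0" using \<Theta> by (simp add: x0_def)
  define spec where "spec = (\<lambda>Y Z. continuous_on UNIV Z \<and> (\<forall>t\<le>0. Z t = x0 t) \<and>
      (\<forall>t\<ge>0. ((\<lambda>s. f (Z s) (state lam Y u0 s) lam) has_integral Z t - x0 0) {0..t}))"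
  define Z where "Z = rec_nat x0 (\<lambda>_ Y. SOME Z. spec Y Z)"
  have Z0: "Z 0 = x0" by (simp add: Z_def)
  have ZS: "Z (Suc k) = (SOME Y. spec (Z k) Y)" for k by (simp add: Z_def)
  have ex: "\<exists>Z. spec Y Z" if "continuous_on UNIV Y" for Y
    unfolding spec_def by (rule controlled_solution[OF that cx0 x0 u0])
  have sp: "continuous_on UNIV (Z k) \<and> spec (Z k) (Z (Suc k))" for k
  proof (induction k)
    case 0
    show ?case unfolding ZS Z0 using cx0 someI_ex[OF ex[OF cx0]] by simp
  next
    case (Suc k)
    then have c: "continuous_on UNIV (Z (Suc k))" by (simp add: spec_def)
    then show ?case using someI_ex[OF ex[OF c]] ZS[of "Suc k"] by simp
  qed
  have cZ: "continuous_on UNIV (Z k)" for k using sp by blast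
  have Zneg: "Z k t = x0 t" if "t \<le> 0" for k t
    using sp[of "k - 1"] that by (cases k) (auto simp: Z0 spec_def)
  have Zint: "((\<lambda>s. f (Z (Suc k) s) (state lam (Z k) u0 s) lam) has_integral Z (Suc k) t - x0 0) {0..t}"
    if "t \<ge> 0" for k t using sp[of k] that by (simp add: spec_def)
  have step: "Z (Suc k) t = Z k t" if "t \<le> real k * \<tau>" for k t
    using that
  proof (induction k arbitrary: t)
    case 0
    then show ?case using Zneg by simp
  next
    case (Suc k)
    show ?case
    proof (cases "t \<le> 0")
      case True
      then show ?thesis using Zneg by simp
    next
      case False
      \<comment> \<open>States at times up to \<open>t\<close> look back at times up to
        \<open>k * \<tau>\<close>, where the induction hypothesis makes the two driving curves
        equal.\<close>
      have eq: "state lam (Z (Suc k)) u0 s = state lam (Z k) u0 s" if "s \<le> t" for s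
        by (rule relay_state_cong[OF pos]) (use Suc that in \<open>auto simp: algebra_simps\<close>)
      show ?thesis
      proof (rule controlled_unique[where a = 0 and b = t and lam = lam and z = "x0 0" and u = "state lam (Z k) u0"])
        show "continuous_on {0..t} (Z (Suc (Suc k)))" "continuous_on {0..t} (Z (Suc k))"
          by (rule continuous_on_subset[OF cZ], simp)+
        show "state lam (Z k) u0 s \<in> {-1, 1}" for s
          by (rule relay_state(1)[OF pos _ u0]) (intro continuous_intros cZ)
        fix r assume r: "r \<in> {0..t}"
        show "((\<lambda>s. f (Z (Suc k) s) (state lam (Z k) u0 s) lam) has_integral Z (Suc k) r - x0 0) {0..r}"
          using Zint r by simp
        show "((\<lambda>s. f (Z (Suc (Suc k)) s) (state lam (Z k) u0 s) lam) has_integral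
            Z (Suc (Suc k)) r - x0 0) {0..r}"
          by (rule has_integral_eq[OF _ Zint]) (use r eq in auto)
      qed (use False in auto)
    qed
  qed
  have mono: "Z (k + m) t = Z k t" if "t \<le> real k * \<tau>" for k m t
  proof (induction m)
    case (Suc m)
    have "real k * \<tau> \<le> real (k + m) * \<tau>" using pos by (intro mult_right_mono) auto
    then show ?case using step[of t "k + m"] Suc that by simp
  qed simp
  \<comment> \<open>The ceiling picks an iterate that is already final at time
    \<open>t\<close>.\<close>
  define y where "y = (\<lambda>t. Z (nat \<lceil>t / \<tau>\<rceil>) t)"
  have y: "y t = Z k t" if "t \<le> real k * \<tau>" for k t
  proof -
    let ?n = "nat \<lceil>t / \<tau>\<rceil>"
    have n: "t \<le> real ?n * \<tau>"
      using real_nat_ceiling_ge[of "t / \<tau>"] pos by (simp only: pos_divide_le_eq)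
    show ?thesis
    proof (cases "k \<le> ?n")
      case True
      then show ?thesis using mono[OF that, of "?n - k"] by (simp add: y_def)
    next
      case False
      then have "?n + (k - ?n) = k" by linarith
      then show ?thesis using mono[OF n, of "k - ?n"] by (simp add: y_def)
    qed
  qed
  have "continuous_on (\<Union>k\<in>(UNIV::nat set). {..<real k * \<tau>}) y"
  proof (rule continuous_on_open_UN)
    fix k :: nat
    show "continuous_on {..<real k * \<tau>} y"
      by (rule continuous_on_eq[OF continuous_on_subset[OF cZ[of k]]]) (auto simp: y[of _ k])
  qed simp
  moreover have "(\<Union>k\<in>(UNIV::nat set). {..<real k * \<tau>}) = UNIV"
    using reals_Archimedean3[OF pos(2)] by auto
  ultimately have cy: "continuous_on UNIV y" by simp
  have gy: "continuous_on UNIV (\<lambda>s. h (y s) lam)" by (intro continuous_intros cy)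
  have "relay_solution f h \<epsilon> \<tau> \<Theta> lam \<xi> u0 y (state lam y u0)"
    unfolding relay_solution_def
  proof (intro conjI allI ballI impI)
    show "continuous_on {-\<Theta>..} y" by (rule continuous_on_subset[OF cy]) simp
    show "state lam y u0 t \<in> {-1, 1}" for t by (rule relay_state(1)[OF pos gy u0])
    show "y \<theta> = \<xi> \<theta>" if "\<theta> \<in> {-\<Theta>..0}" for \<theta>
      using y[of \<theta> 0] that by (simp add: Z0 x0_def)
    show "state lam y u0 0 = u0" by (simp add: relay_state_def[OF pos])
    show "relay_value \<epsilon> \<tau> (\<lambda>s. h (y s) lam) u0 t (state lam y u0 t)" if "t > 0" for t
      using relay_state(2)[OF pos gy u0 that] .
    fix t :: real assume t: "0 \<le> t"
    obtain k where k: "t < real k * \<tau>" using reals_Archimedean3[OF pos(2)] by auto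
    have le: "real k * \<tau> \<le> real (Suc k) * \<tau>" using pos by (intro mult_right_mono) auto
    have eq: "state lam y u0 s = state lam (Z k) u0 s" if "s \<le> t" for s
      by (rule relay_state_cong[OF pos]) (use y[of _ k] k that pos in auto)
    have "y t - \<xi> 0 = Z (Suc k) t - x0 0" using y[of t "Suc k"] k le x00 by simp
    then show "((\<lambda>s. f (y s) (state lam y u0 s) lam) has_integral y t - \<xi> 0) {0..t}"
      using has_integral_eq[OF _ Zint[OF t, of k], of "\<lambda>s. f (y s) (state lam y u0 s) lam"]
        y[of _ "Suc k"] eq k le by auto
  qed
  then show ?thesis by blast
qed

text \<open>Two implications alternate along steps of length \<tau>: equal curves up to
  \<open>t - \<tau>\<close> give equal states at \<open>t\<close>, and equal states give equal
  curves.\<close>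

lemma relay_solution_unique:
  assumes 1: "relay_solution f h \<epsilon> \<tau> \<Theta> lam \<xi> u0 y u"
    and 2: "relay_solution f h \<epsilon> \<tau> \<Theta> lam \<xi> u0 y' u'"
  shows "-\<Theta> \<le> t \<Longrightarrow> y t = y' t" "0 \<le> t \<Longrightarrow> u t = u' t"
proof -
  have ueq: "u t = u' t" if t: "0 \<le> t" and eq: "\<And>s. s \<in> {-\<tau>..t - \<tau>} \<Longrightarrow> y s = y' s" for t
  proof (cases "t = 0")
    case True
    then show ?thesis using 1 2 by (simp add: relay_solution_def)
  next
    case False
    then have "relay_value \<epsilon> \<tau> (\<lambda>s. h (y s) lam) u0 t (u t)"
      "relay_value \<epsilon> \<tau> (\<lambda>s. h (y' s) lam) u0 t (u' t)"
      using 1 2 t by (auto simp: relay_solution_def)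
    moreover have "relay_value \<epsilon> \<tau> (\<lambda>s. h (y s) lam) u0 t (u t) \<longleftrightarrow>
        relay_value \<epsilon> \<tau> (\<lambda>s. h (y' s) lam) u0 t (u t)"
      by (rule relay_value_cong[OF pos]) (use eq t in auto)
    ultimately show ?thesis using relay_value_unique[OF pos] by blast
  qed
  have yeq: "\<forall>t. -\<Theta> \<le> t \<and> t \<le> real k * \<tau> \<longrightarrow> y t = y' t" for k :: nat
  proof (induction k)
    case 0
    then show ?case using 1 2 by (auto simp: relay_solution_def)
  next
    case (Suc k)
    show ?case
    proof (intro allI impI)
      fix t assume t: "-\<Theta> \<le> t \<and> t \<le> real (Suc k) * \<tau>"
      show "y t = y' t"
      proof (cases "t \<le> 0")
        case True
        then show ?thesis using 1 2 t by (auto simp: relay_solution_def)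
      next
        case False
        have u: "u s = u' s" if "s \<in> {0..t}" for s
          by (rule ueq) (use that Suc.IH t \<tau>_le in \<open>auto simp: algebra_simps\<close>)
        show ?thesis
        proof (rule controlled_unique[where a = 0 and b = t and lam = lam and z = "\<xi> 0" and u = u])
          show "continuous_on {0..t} y" "continuous_on {0..t} y'"
            using 1 2 pos \<tau>_le by (auto simp: relay_solution_def intro!: continuous_on_subset[of "{-\<Theta>..}"])
          fix r assume r: "r \<in> {0..t}"
          show "((\<lambda>s. f (y s) (u s) lam) has_integral y r - \<xi> 0) {0..r}"
            using 1 r by (simp add: relay_solution_def)
          have "((\<lambda>s. f (y' s) (u' s) lam) has_integral y' r - \<xi> 0) {0..r}"
            using 2 r by (simp add: relay_solution_def)
          then show "((\<lambda>s. f (y' s) (u s) lam) has_integral y' r - \<xi> 0) {0..r}"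
            by (rule has_integral_eq[rotated]) (use u r in auto)
        qed (use 1 False in \<open>auto simp: relay_solution_def\<close>)
      qed
    qed
  qed
  show y: "y t = y' t" if "-\<Theta> \<le> t" for t
  proof -
    obtain k where "t < real k * \<tau>" using reals_Archimedean3[OF pos(2)] by auto
    then show ?thesis using yeq[of k] that by auto
  qed
  show "u t = u' t" if "0 \<le> t" for t
    by (rule ueq[OF that]) (use y \<tau>_le in auto)
qed

lemma evolution_eq:
  assumes sol: "relay_solution f h \<epsilon> \<tau> \<Theta> lam \<xi> u0 y u" and t: "0 \<le> t"
  shows "evolution f h \<epsilon> \<tau> \<Theta> lam t (\<xi>, u0) = (hist \<Theta> y t, u t)"
  unfolding evolution_def
proof (rule the_equality)
  show "\<exists>y' u'. relay_solution f h \<epsilon> \<tau> \<Theta> lam (fst (\<xi>, u0)) (snd (\<xi>, u0)) y' u' \<and>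
      (hist \<Theta> y t, u t) = (hist \<Theta> y' t, u' t)"
    using sol by auto
  fix r assume "\<exists>y u. relay_solution f h \<epsilon> \<tau> \<Theta> lam (fst (\<xi>, u0)) (snd (\<xi>, u0)) y u \<and>
      r = (hist \<Theta> y t, u t)"
  then obtain y' u' where r: "relay_solution f h \<epsilon> \<tau> \<Theta> lam \<xi> u0 y' u'" "r = (hist \<Theta> y' t, u' t)"
    by auto
  have "hist \<Theta> y' t = hist \<Theta> y t"
    unfolding hist_def
    by (rule restrict_ext, rule relay_solution_unique(1)[OF r(1) sol]) (use t in auto)
  moreover have "u' t = u t" by (rule relay_solution_unique(2)[OF r(1) sol t])
  ultimately show "r = (hist \<Theta> y t, u t)" using r(2) by simp
qed

end

section \<open>The colliding orbit\<close>

lemma triple_box_in_open: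
  fixes x0 :: "'a::metric_space" and y0 :: "'b::metric_space" and z0 :: "'c::metric_space"
  assumes "open S" "(x0, y0, z0) \<in> S"
  shows "\<exists>d>0. \<forall>x y z. dist x x0 < d \<longrightarrow> dist y y0 < d \<longrightarrow> dist z z0 < d \<longrightarrow> (x, y, z) \<in> S"
proof -
  obtain e where e: "e > 0" "ball (x0, y0, z0) e \<subseteq> S"
    using assms open_contains_ball by blast
  have "(x, y, z) \<in> S" if "dist x x0 < e / 3" "dist y y0 < e / 3" "dist z z0 < e / 3" for x y z
  proof -
    have "dist (y, z) (y0, z0) \<le> dist y y0 + dist z z0"
      unfolding dist_Pair_Pair by (rule sqrt_sum_squares_le_sum) auto
    moreover have "dist (x, y, z) (x0, y0, z0) \<le> dist x x0 + dist (y, z) (y0, z0)"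
      unfolding dist_Pair_Pair[of x] by (rule sqrt_sum_squares_le_sum) auto
    ultimately have "dist (x, y, z) (x0, y0, z0) < e" using that by linarith
    then show ?thesis using e(2) by (auto simp: dist_commute)
  qed
  then show ?thesis using e(1) by (intro exI[of _ "e / 3"]) auto
qed

text \<open>Used in \<open>admissible_exists\<close>, where strict inequalities along compact arcs
  of the orbit have to pass to all nearby histories with one common radius.\<close>

lemma compact_image_neighbourhood:
  fixes \<Phi> :: "'a::metric_space \<Rightarrow> real"
  assumes \<Phi>: "continuous_on UNIV \<Phi>" and \<gamma>: "continuous_on S \<gamma>" and S: "compact S"
    and lt: "\<And>s. s \<in> S \<Longrightarrow> c < \<Phi> (\<gamma> s)"
  shows "\<exists>d>0. \<forall>s\<in>S. \<forall>x. dist x (\<gamma> s) < d \<longrightarrow> c < \<Phi> x"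
proof -
  have "open {x. c < \<Phi> x}" by (intro open_Collect_less \<Phi> continuous_intros)
  moreover have "compact (\<gamma> ` S)" by (rule compact_continuous_image[OF \<gamma> S])
  moreover have "\<gamma> ` S \<subseteq> {x. c < \<Phi> x}" using lt by auto
  ultimately obtain d where "d > 0" "(\<Union>x\<in>\<gamma> ` S. ball x d) \<subseteq> {x. c < \<Phi> x}"
    using compact_subset_open_imp_ball_epsilon_subset by metis
  then show ?thesis by (intro exI[of _ d]) (force simp: dist_commute)
qed

section \<open>The flows of the two controls and \<open>h\<close> along them\<close>

context relay
begin

lemma lipschitz_field_f:
  assumes "c \<in> {-1, 1}" shows "\<exists>L. lipschitz_field (\<lambda>y. f y c lam) L"
  using field_lipschitz[OF assms, of lam] by (auto simp: lipschitz_field_def)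

lemma flow_0: "c \<in> {-1, 1} \<Longrightarrow> flow f c lam 0 y = y"
  using lipschitz_field_f[of c lam] by (auto simp: flow_eq_ode_flow lipschitz_field.ode_flow_0)

lemma flow_add:
  "c \<in> {-1, 1} \<Longrightarrow> flow f c lam (s + t) y = flow f c lam s (flow f c lam t y)"
  using lipschitz_field_f[of c lam] by (auto simp: flow_eq_ode_flow intro: lipschitz_field.ode_flow_add)

lemma flow_deriv:
  "c \<in> {-1, 1} \<Longrightarrow>
    ((\<lambda>t. flow f c lam t y) has_vector_derivative f (flow f c lam s y) c lam) (at s)"
  using lipschitz_field_f[of c lam]
  by (auto simp: flow_eq_ode_flow intro: lipschitz_field.ode_flow_deriv)

lemma flow_continuous: "c \<in> {-1, 1} \<Longrightarrow> continuous_on UNIV (\<lambda>(lam, t, y). flow f c lam t y)"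
  unfolding flow_eq_ode_flow
  by (rule continuous_family_flow[OF field_continuous field_lipschitz])

lemma flow_continuous_comp:
  assumes c: "c \<in> {-1, 1}"
    and l: "continuous_on S l" and t: "continuous_on S t" and y: "continuous_on S y"
  shows "continuous_on S (\<lambda>s. flow f c (l s) (t s) (y s))"
  using continuous_on_compose2[OF flow_continuous[OF c]
      continuous_on_Pair[OF l continuous_on_Pair[OF t y]]] by simp

text \<open>The control is prescribed on a half-open interval because it jumps at switching times;
  the missing end point does not affect the integral, so the conclusion includes
  \<open>b\<close>.\<close>

lemma relay_solution_follows_flow:
  assumes sol: "relay_solution f h \<epsilon> \<tau> \<Theta> lam \<xi> u0 y u" and a: "0 \<le> a"
    and c: "c \<in> {-1, 1}" and u: "\<And>s. s \<in> {a..<b} \<Longrightarrow> u s = c" and t: "t \<in> {a..b}"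
  shows "y t = flow f c lam (t - a) (y a)"
proof -
  obtain L where "lipschitz_field (\<lambda>y. f y c lam) L" using lipschitz_field_f[OF c] by blast
  then interpret F: lipschitz_field "\<lambda>y. f y c lam" L .
  have "0 \<le> \<Theta>" using pos \<tau>_le by linarith
  then have y: "continuous_on {a..b} y"
    using sol a by (auto simp: relay_solution_def intro: continuous_on_subset[of "{-\<Theta>..}"])
  have int: "((\<lambda>s. f (y s) (u s) lam) has_integral (y r - \<xi> 0)) {0..r}" if "0 \<le> r" for r
    using sol that by (simp add: relay_solution_def)
  have "((\<lambda>s. f (y s) c lam) has_integral (y r - y a)) {a..r}" if r: "r \<in> {a..b}" for r
  proof -
    have r': "0 \<le> r" "a \<le> r" using r a by auto
    have "(\<lambda>s. f (y s) (u s) lam) integrable_on {a..r}"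
      by (rule integrable_subinterval_real[OF has_integral_integrable[OF int[OF r'(1)]]]) (use a in auto)
    then obtain i where i: "((\<lambda>s. f (y s) (u s) lam) has_integral i) {a..r}" by blast
    have "((\<lambda>s. f (y s) (u s) lam) has_integral (y a - \<xi> 0) + i) {0..r}"
      by (rule has_integral_combine[OF a r'(2) int[OF a] i])
    from has_integral_unique[OF this int[OF r'(1)]] have "i = y r - y a"
      by (simp add: algebra_simps)
    with i show ?thesis
      using has_integral_spike_finite[of "{r}" "{a..r}" "\<lambda>s. f (y s) c lam" "\<lambda>s. f (y s) (u s) lam"]
        u r by auto
  qed
  from F.integral_solution_eq_ode_flow[OF y this t] show ?thesis by (simp add: flow_eq_ode_flow)
qed

definition dh :: "'a \<Rightarrow> real \<Rightarrow> 'a \<Rightarrow> real" where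
  "dh y lam = frechet_derivative (\<lambda>z. h z lam) (at y)"

lemma dh: "((\<lambda>z. h z lam) has_derivative dh y lam) (at y)"
  and dh_continuous: "continuous_on UNIV (\<lambda>(y, lam, v). dh y lam v)"
proof -
  obtain D :: "'a \<times> real \<Rightarrow> ('a \<times> real) \<Rightarrow>\<^sub>L real" where
    D: "\<And>x. ((\<lambda>(y, lam). h y lam) has_derivative blinfun_apply (D x)) (at x)" "continuous_on UNIV D"
    using system by (auto simp: relay_system_def C1_def)
  have d: "((\<lambda>z. h z lam) has_derivative (\<lambda>v. blinfun_apply (D (y, lam)) (v, 0))) (at y)" for y lam
  proof -
    have "((\<lambda>z. (z, lam)) has_derivative (\<lambda>v. (v, 0))) (at y)"
      by (auto intro!: derivative_eq_intros)
    from has_derivative_compose[OF this D(1)] show ?thesis by simp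
  qed
  have e: "dh y lam = (\<lambda>v. blinfun_apply (D (y, lam)) (v, 0))" for y lam
    unfolding dh_def using frechet_derivative_at[OF d] by simp
  show "((\<lambda>z. h z lam) has_derivative dh y lam) (at y)" using d by (simp add: e)
  show "continuous_on UNIV (\<lambda>(y, lam, v). dh y lam v)"
    unfolding e split_beta
    by (intro continuous_intros continuous_on_compose2[OF D(2)]) auto
qed

lemma h_flow_deriv:
  assumes c: "c \<in> {-1, 1}"
  shows "((\<lambda>t. h (flow f c lam t y) lam) has_real_derivative
    dh (flow f c lam s y) lam (f (flow f c lam s y) c lam)) (at s)"
proof -
  have "((\<lambda>t. h (flow f c lam t y) lam) has_derivative
      (\<lambda>r. dh (flow f c lam s y) lam (r *\<^sub>R f (flow f c lam s y) c lam))) (at s)"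
    using has_derivative_compose[OF flow_deriv[OF c, unfolded has_vector_derivative_def] dh] .
  moreover have "dh (flow f c lam s y) lam (r *\<^sub>R v) = dh (flow f c lam s y) lam v * r" for r v
    using linear_cmul[OF has_derivative_linear[OF dh]] by simp
  ultimately show ?thesis by (simp add: has_field_derivative_def mult_commute_abs)
qed

end

section \<open>Symmetry and transversality of the colliding orbit\<close>

locale colliding_orbit = relay f h \<epsilon> \<tau> \<Theta>
  for f :: "'a::euclidean_space \<Rightarrow> real \<Rightarrow> real \<Rightarrow> 'a" and h :: "'a \<Rightarrow> real \<Rightarrow> real"
    and \<epsilon> \<tau> \<Theta> :: real +
  fixes lam0 :: real and ys :: "real \<Rightarrow> 'a" and us :: "real \<Rightarrow> real"
  assumes symmetry: "reflection_symmetric f h"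
    and orbit: "symmetric_periodic_orbit f h \<epsilon> \<tau> \<Theta> lam0 \<tau> ys us"
    and transversality: "frechet_derivative (\<lambda>y. h y lam0) (at (ys 0)) (f (ys 0) (-1) lam0) *
       frechet_derivative (\<lambda>y. h y lam0) (at (ys 0)) (f (ys 0) 1 lam0) > 0"
begin

lemma h_odd: "h (- y) lam = - h y lam"
proof -
  have "h y lam = - h (- y) lam" using symmetry unfolding reflection_symmetric_def by blast
  then show ?thesis by linarith
qed

text \<open>The reflected curve solves the equation for the opposite control, and uniqueness
  identifies it with the flow.\<close>

lemma flow_odd:
  assumes c: "c \<in> {-1, 1}"
  shows "flow f (- c) lam t (- y) = - flow f c lam t y"
proof -
  have c': "- c \<in> {-1, 1}" using c by auto
  obtain L where L: "lipschitz_field (\<lambda>y. f y (- c) lam) L" using lipschitz_field_f[OF c'] by blast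
  have eq: "- f y c lam = f (- y) (- c) lam" for y
  proof -
    have "f y c lam = - f (- y) (- c) lam"
      using symmetry c unfolding reflection_symmetric_def by blast
    then show ?thesis by (metis minus_minus)
  qed
  have "((\<lambda>t. - flow f c lam t y) has_vector_derivative f (- flow f c lam s y) (- c) lam) (at s)" for s
    using has_vector_derivative_minus[OF flow_deriv[OF c, where lam = lam and s = s and y = y]]
    unfolding eq .
  from lipschitz_field.ode_flow_unique[OF L this, of t] show ?thesis
    by (simp add: flow_eq_ode_flow[symmetric] flow_0[OF c])
qed

lemma ys_shift: "ys (t - \<tau>) = - ys t"
  using orbit by (simp add: symmetric_periodic_orbit_def)

lemma ys_continuous: "continuous_on S ys"
  using orbit by (auto simp: symmetric_periodic_orbit_def periodic_solution_def intro: continuous_on_subset)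

lemma ys_on_section: "h (ys 0) lam0 = \<epsilon>"
  using orbit by (simp add: symmetric_periodic_orbit_def)

text \<open>Periodicity is assumed for values of \<open>evolution\<close> only. This recovers a
  solution to which the relay rule and the integral equation can be applied.\<close>

lemma orbit_solution:
  obtains y u where "relay_solution f h \<epsilon> \<tau> \<Theta> lam0 (hist \<Theta> ys 0) 1 y u"
    "\<And>t. -\<Theta> \<le> t \<Longrightarrow> y t = ys t" "\<And>t. 0 \<le> t \<Longrightarrow> u t = us t"
proof -
  have \<Theta>: "0 \<le> \<Theta>" using pos \<tau>_le by linarith
  have us0: "us 0 = 1" using orbit pos by (auto simp: symmetric_periodic_orbit_def)
  have "continuous_on {-\<Theta>..0} (hist \<Theta> ys 0)"
    by (rule continuous_on_eq[OF ys_continuous]) (simp add: hist_def)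
  then obtain y u where sol: "relay_solution f h \<epsilon> \<tau> \<Theta> lam0 (hist \<Theta> ys 0) 1 y u"
    using relay_solution_exists[of "hist \<Theta> ys 0" 1 lam0] by auto
  have eq: "hist \<Theta> y t = hist \<Theta> ys t \<and> u t = us t" if t: "0 \<le> t" for t
  proof -
    have "evolution f h \<epsilon> \<tau> \<Theta> lam0 t (hist \<Theta> ys 0, us 0) = (hist \<Theta> ys (0 + t), us (0 + t))"
      using orbit t unfolding symmetric_periodic_orbit_def periodic_solution_def by blast
    then show ?thesis using evolution_eq[OF sol t] us0 by simp
  qed
  show thesis
  proof
    show "relay_solution f h \<epsilon> \<tau> \<Theta> lam0 (hist \<Theta> ys 0) 1 y u" by (rule sol)
    show "u t = us t" if "0 \<le> t" for t using eq[OF that] by simp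
    show "y t = ys t" if "-\<Theta> \<le> t" for t
    proof (cases "0 \<le> t")
      case True
      have "hist \<Theta> y t 0 = hist \<Theta> ys t 0" using eq[OF True] by simp
      then show ?thesis using \<Theta> by (simp add: hist_def)
    next
      case False
      then show ?thesis using sol that by (auto simp: relay_solution_def hist_def)
    qed
  qed
qed

text \<open>For \<open>h_ys_less\<close>: a value of at least \<open>\<epsilon>\<close> at a time in
  \<open>(-\<tau>, 0)\<close> would force the control \<open>-1\<close> one delay later, at a time
  in \<open>(0, \<tau>)\<close>, where it is \<open>1\<close>.\<close>

lemma ys_flow_plus: "t \<in> {0..\<tau>} \<Longrightarrow> ys t = flow f 1 lam0 t (ys 0)"
  and h_ys_less: "t \<in> {-\<tau><..<0} \<Longrightarrow> h (ys t) lam0 < \<epsilon>"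
proof -
  obtain y u where sol: "relay_solution f h \<epsilon> \<tau> \<Theta> lam0 (hist \<Theta> ys 0) 1 y u"
    and y: "\<And>t. -\<Theta> \<le> t \<Longrightarrow> y t = ys t" and u: "\<And>t. 0 \<le> t \<Longrightarrow> u t = us t"
    by (rule orbit_solution) blast
  have us1: "us t = 1" if "t \<in> {0..<\<tau>}" for t
    using orbit that by (auto simp: symmetric_periodic_orbit_def)
  show "ys t = flow f 1 lam0 t (ys 0)" if t: "t \<in> {0..\<tau>}"
    using relay_solution_follows_flow[OF sol, of 0 1 \<tau> t] t u us1 y pos \<tau>_le by simp
  show "h (ys t) lam0 < \<epsilon>" if t: "t \<in> {-\<tau><..<0}"
  proof (rule ccontr)
    assume "\<not> h (ys t) lam0 < \<epsilon>"
    moreover have "relay_value \<epsilon> \<tau> (\<lambda>s. h (y s) lam0) 1 (t + \<tau>) (u (t + \<tau>))"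
      using sol t by (simp add: relay_solution_def)
    ultimately have "u (t + \<tau>) = - 1" using y[of t] t \<tau>_le by (simp add: relay_value_def)
    then show False using u[of "t + \<tau>"] us1[of "t + \<tau>"] t by simp
  qed
qed

lemma ys_\<tau>: "ys \<tau> = - ys 0"
  using ys_shift[of \<tau>] by simp

lemma ys_flow_minus:
  assumes t: "t \<in> {-\<tau>..0}" shows "ys t = flow f (-1) lam0 t (ys 0)"
proof -
  have "ys t = - flow f 1 lam0 (t + \<tau>) (ys 0)"
    using ys_shift[of "t + \<tau>"] ys_flow_plus[of "t + \<tau>"] t by simp
  also have "\<dots> = flow f (-1) lam0 t (- flow f 1 lam0 \<tau> (ys 0))"
    using flow_odd[of 1 lam0 _ "ys 0"] flow_add[of "-1" lam0 t \<tau> "- ys 0"] by simp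
  also have "- flow f 1 lam0 \<tau> (ys 0) = ys 0"
    using ys_flow_plus[of \<tau>] ys_\<tau> pos by (metis atLeastAtMost_iff less_imp_le minus_minus order_refl)
  finally show ?thesis .
qed

lemma h_ys_greater: "t \<in> {0<..<\<tau>} \<Longrightarrow> - \<epsilon> < h (ys t) lam0"
  using h_ys_less[of "t - \<tau>"] ys_shift[of t] by (simp add: h_odd)

text \<open>Transversality only says that the two derivatives have the same nonzero sign. If
  \<open>h\<close> decreased along the flow of \<open>-1\<close> at \<open>ys 0\<close>, it would
  exceed \<open>\<epsilon>\<close> just before time 0, against \<open>h_ys_less\<close>.\<close>

lemma dh_orbit_pos:
  assumes c: "c \<in> {-1, 1}" shows "0 < dh (ys 0) lam0 (f (ys 0) c lam0)"
proof -
  have "\<not> dh (ys 0) lam0 (f (ys 0) (-1) lam0) < 0"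
  proof
    assume neg: "dh (ys 0) lam0 (f (ys 0) (-1) lam0) < 0"
    have "((\<lambda>t. h (flow f (-1) lam0 t (ys 0)) lam0) has_real_derivative
        dh (ys 0) lam0 (f (ys 0) (-1) lam0)) (at 0)"
      using h_flow_deriv[of "-1" lam0 "ys 0" 0] by (simp add: flow_0)
    from DERIV_neg_dec_left[OF this neg] obtain d where d: "0 < d"
      "\<And>s. 0 < s \<Longrightarrow> s < d \<Longrightarrow> \<epsilon> < h (flow f (-1) lam0 (- s) (ys 0)) lam0"
      by (auto simp: flow_0 ys_on_section)
    define s where "s = min d \<tau> / 2"
    have s: "0 < s" "s < d" "s < \<tau>" using d pos by (auto simp: s_def)
    from d(2)[OF s(1,2)] h_ys_less[of "- s"] ys_flow_minus[of "- s"] s show False by simp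
  qed
  moreover have "dh (ys 0) lam0 (f (ys 0) (-1) lam0) * dh (ys 0) lam0 (f (ys 0) 1 lam0) > 0"
    using transversality by (simp add: dh_def)
  ultimately show ?thesis using c by (auto simp: zero_less_mult_iff)
qed

text \<open>The common domain of all local arguments. The three inequalities make \<open>h\<close>
  strictly increasing along both flows, keep \<open>h\<close> away from \<open>-\<epsilon>\<close>
  near the corner, and make the flow of \<open>1\<close> cross the section plane in one
  direction.\<close>

definition box_radius :: "real \<Rightarrow> bool" where
  "box_radius d \<longleftrightarrow> 0 < d \<and> d < \<tau> / 4 \<and>
     (\<forall>c\<in>{-1, 1}. \<forall>lam t y. dist lam lam0 < d \<longrightarrow> dist t 0 < d \<longrightarrow> dist y (ys 0) < d \<longrightarrow>
        0 < dh (flow f c lam t y) lam (f (flow f c lam t y) c lam) \<and>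
        0 < h (flow f c lam t y) lam \<and>
        0 < f (ys 0) 1 lam0 \<bullet> f (flow f c lam t y) 1 lam)"

lemma box_radius_exists: "\<exists>d. box_radius d"
proof -
  have *: "\<exists>d>0. \<forall>lam t y. dist lam lam0 < d \<longrightarrow> dist t 0 < d \<longrightarrow> dist y (ys 0) < d \<longrightarrow>
        0 < dh (flow f c lam t y) lam (f (flow f c lam t y) c lam) \<and>
        0 < h (flow f c lam t y) lam \<and>
        0 < f (ys 0) 1 lam0 \<bullet> f (flow f c lam t y) 1 lam" if c: "c \<in> {-1, 1}" for c
  proof -
    let ?S = "{(lam, t, y). 0 < dh (flow f c lam t y) lam (f (flow f c lam t y) c lam) \<and>
        0 < h (flow f c lam t y) lam \<and> 0 < f (ys 0) 1 lam0 \<bullet> f (flow f c lam t y) 1 lam}"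
    have fl: "continuous_on UNIV (\<lambda>p. flow f c (fst p) (fst (snd p)) (snd (snd p)))"
      by (intro flow_continuous_comp[OF c] continuous_intros)
    have d: "continuous_on UNIV (\<lambda>p. dh (flow f c (fst p) (fst (snd p)) (snd (snd p))) (fst p)
        (f (flow f c (fst p) (fst (snd p)) (snd (snd p))) c (fst p)))"
      using continuous_on_compose2[OF dh_continuous, of UNIV
          "\<lambda>p. (flow f c (fst p) (fst (snd p)) (snd (snd p)), fst p,
              f (flow f c (fst p) (fst (snd p)) (snd (snd p))) c (fst p))"]
      by (simp add: continuous_on_Pair fl f_continuous_comp[OF c] continuous_on_fst)
    have "open ?S"
      unfolding split_beta
      by (intro open_Collect_conj open_Collect_less continuous_intros d fl f_continuous_comp) auto
    \<comment> \<open>The linear map \<open>dh\<close> is nonzero on this vector, so the normal of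
      the section plane does not vanish.\<close>
    moreover have "f (ys 0) 1 lam0 \<noteq> 0"
      using dh_orbit_pos[of 1] linear_0[OF has_derivative_linear[OF dh]] by force
    then have "(lam0, 0, ys 0) \<in> ?S"
      using dh_orbit_pos[OF c] pos by (simp add: flow_0[OF c] ys_on_section)
    ultimately show ?thesis using triple_box_in_open[of ?S lam0 0 "ys 0"] by simp
  qed
  obtain d1 where d1: "d1 > 0" "\<forall>lam t y. dist lam lam0 < d1 \<longrightarrow> dist t 0 < d1 \<longrightarrow> dist y (ys 0) < d1 \<longrightarrow>
        0 < dh (flow f 1 lam t y) lam (f (flow f 1 lam t y) 1 lam) \<and>
        0 < h (flow f 1 lam t y) lam \<and>
        0 < f (ys 0) 1 lam0 \<bullet> f (flow f 1 lam t y) 1 lam" using *[of 1] by auto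
  obtain d2 where d2: "d2 > 0" "\<forall>lam t y. dist lam lam0 < d2 \<longrightarrow> dist t 0 < d2 \<longrightarrow> dist y (ys 0) < d2 \<longrightarrow>
        0 < dh (flow f (-1) lam t y) lam (f (flow f (-1) lam t y) (-1) lam) \<and>
        0 < h (flow f (-1) lam t y) lam \<and>
        0 < f (ys 0) 1 lam0 \<bullet> f (flow f (-1) lam t y) 1 lam" using *[of "-1"] by auto
  have "box_radius (min (min d1 d2) (\<tau> / 5))"
    unfolding box_radius_def using d1 d2 pos by auto
  then show ?thesis by blast
qed

end

section \<open>Motion between two returns\<close>

locale local_orbit = colliding_orbit f h \<epsilon> \<tau> \<Theta> lam0 ys us
  for f :: "'a::euclidean_space \<Rightarrow> real \<Rightarrow> real \<Rightarrow> 'a" and h :: "'a \<Rightarrow> real \<Rightarrow> real"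
    and \<epsilon> \<tau> \<Theta> :: real and lam0 :: real and ys :: "real \<Rightarrow> 'a" and us :: "real \<Rightarrow> real" +
  fixes d :: real
  assumes box: "box_radius d"
begin

lemma d_pos: "0 < d" and d_less: "d < \<tau> / 4"
  using box by (auto simp: box_radius_def)

lemma
  assumes "c \<in> {-1, 1}" "dist lam lam0 < d" "\<bar>t\<bar> < d" "dist y (ys 0) < d"
  shows dh_box: "0 < dh (flow f c lam t y) lam (f (flow f c lam t y) c lam)"
    and h_box: "0 < h (flow f c lam t y) lam"
    and section_box: "0 < f (ys 0) 1 lam0 \<bullet> f (flow f c lam t y) 1 lam"
  using box assms unfolding box_radius_def by (auto simp: dist_real_def)

lemma h_flow_strict_mono:
  assumes c: "c \<in> {-1, 1}" and "dist lam lam0 < d" "dist y (ys 0) < d" "- d < s" "s < t" "t < d"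
  shows "h (flow f c lam s y) lam < h (flow f c lam t y) lam"
proof (rule DERIV_pos_imp_increasing[OF \<open>s < t\<close>])
  fix r assume r: "s \<le> r" "r \<le> t"
  then have "\<bar>r\<bar> < d" using assms by auto
  then show "\<exists>D. ((\<lambda>t. h (flow f c lam t y) lam) has_real_derivative D) (at r) \<and> 0 < D"
    using h_flow_deriv[OF c] dh_box[OF c] assms by blast
qed

lemma section_strict_mono:
  assumes "dist lam lam0 < d" "dist y (ys 0) < d" "- d < s" "s < t" "t < d"
  shows "f (ys 0) 1 lam0 \<bullet> flow f 1 lam s y < f (ys 0) 1 lam0 \<bullet> flow f 1 lam t y"
proof (rule DERIV_pos_imp_increasing[OF \<open>s < t\<close>])
  fix r assume r: "s \<le> r" "r \<le> t"
  then have r': "\<bar>r\<bar> < d" using assms by auto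
  have "((\<lambda>t. f (ys 0) 1 lam0 \<bullet> flow f 1 lam t y) has_derivative
      (\<lambda>q. f (ys 0) 1 lam0 \<bullet> (q *\<^sub>R f (flow f 1 lam r y) 1 lam))) (at r)"
    by (intro has_derivative_inner_right)
      (use flow_deriv[of 1 lam y r] in \<open>simp add: has_vector_derivative_def\<close>)
  then have "((\<lambda>t. f (ys 0) 1 lam0 \<bullet> flow f 1 lam t y) has_real_derivative
      f (ys 0) 1 lam0 \<bullet> f (flow f 1 lam r y) 1 lam) (at r)"
    by (simp add: has_field_derivative_def mult_commute_abs)
  then show "\<exists>D. ((\<lambda>t. f (ys 0) 1 lam0 \<bullet> flow f 1 lam t y) has_real_derivative D) (at r) \<and> 0 < D"
    using section_box[of 1, OF _ assms(1) r' assms(2)] by blast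
qed

text \<open>
  Along this curve \<open>h\<close> increases through the corner, so both cases in the definition of the hitting
  time \<open>t(y)\<close> become the single equation \<open>h (bent t y) = \<epsilon>\<close>.
\<close>

definition bent :: "real \<Rightarrow> real \<Rightarrow> 'a \<Rightarrow> 'a" where
  "bent lam s y = flow f 1 lam (max 0 s) (flow f (-1) lam (min s 0) y)"

lemma bent_neg: "s \<le> 0 \<Longrightarrow> bent lam s y = flow f (-1) lam s y"
  and bent_pos: "0 \<le> s \<Longrightarrow> bent lam s y = flow f 1 lam s y"
  by (auto simp: bent_def flow_0 max_def min_def)

lemma bent_0: "bent lam 0 y = y"
  by (simp add: bent_pos flow_0)

lemma bent_continuous_comp:
  assumes "continuous_on S l" "continuous_on S t" "continuous_on S y"
  shows "continuous_on S (\<lambda>s. bent (l s) (t s) (y s))"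
  unfolding bent_def by (intro flow_continuous_comp continuous_intros assms) auto

lemma h_bent_pos:
  assumes "dist lam lam0 < d" "dist y (ys 0) < d" "\<bar>t\<bar> < d"
  shows "0 < h (bent lam t y) lam"
  using h_box[of "-1" lam t y] h_box[of 1 lam t y] assms
  by (cases "t \<le> 0") (auto simp: bent_neg bent_pos)

lemma h_bent_strict_mono:
  assumes "dist lam lam0 < d" "dist y (ys 0) < d" "- d < s" "s < t" "t < d"
  shows "h (bent lam s y) lam < h (bent lam t y) lam"
proof -
  have neg: "h (bent lam s y) lam < h (bent lam t y) lam" if "- d < s" "s < t" "t \<le> 0" for s t
    using h_flow_strict_mono[of "-1" lam y s t] assms(1,2) that d_pos by (simp add: bent_neg)
  have pos: "h (bent lam s y) lam < h (bent lam t y) lam" if "0 \<le> s" "s < t" "t < d" for s t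
    using h_flow_strict_mono[of 1 lam y s t] assms(1,2) that d_pos by (simp add: bent_pos)
  consider "t \<le> 0" | "0 \<le> s" | "s < 0" "0 < t" by linarith
  then show ?thesis
  proof cases
    case 3
    then show ?thesis using neg[of s 0] pos[of 0 t] assms by simp
  qed (use neg pos assms in auto)
qed

text \<open>If \<open>h y lam\<close> is at least \<open>\<epsilon>\<close>, monotonicity forces
  \<open>t \<le> 0\<close> both for the flow of \<open>-1\<close> and for the bent curve, and there
  the two agree. The other case is the mirror image, with \<open>0 \<le> t\<close> and the flow of
  \<open>1\<close>.\<close>

lemma is_hitting_time_iff:
  assumes "dist lam lam0 < d" "dist y (ys 0) < d" "\<Delta> \<le> d"
  shows "is_hitting_time (flow f 1 lam) (flow f (-1) lam) (\<lambda>y. h y lam) \<epsilon> \<Delta> y t \<longleftrightarrow>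
    \<bar>t\<bar> < \<Delta> \<and> h (bent lam t y) lam = \<epsilon>"
proof (cases "\<bar>t\<bar> < \<Delta>")
  case False
  then show ?thesis by (auto simp: is_hitting_time_def)
next
  case t: True
  then have t': "\<bar>t\<bar> < d" using assms by linarith
  show ?thesis
  proof (cases "\<epsilon> \<le> h y lam")
    case True
    have "t \<le> 0" if "h (flow f (-1) lam t y) lam = \<epsilon>"
    proof (rule ccontr)
      assume "\<not> t \<le> 0"
      then have "h y lam < \<epsilon>"
        using h_flow_strict_mono[of "-1" lam y 0 t] that assms t' d_pos by (auto simp: flow_0)
      with True show False by simp
    qed
    moreover have "t \<le> 0" if "h (bent lam t y) lam = \<epsilon>"
    proof (rule ccontr)
      assume "\<not> t \<le> 0"
      then have "h y lam < \<epsilon>"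
        using h_bent_strict_mono[of lam y 0 t] that assms t' d_pos by (auto simp: bent_0)
      with True show False by simp
    qed
    moreover have "is_hitting_time (flow f 1 lam) (flow f (-1) lam) (\<lambda>y. h y lam) \<epsilon> \<Delta> y t
        \<longleftrightarrow> h (flow f (-1) lam t y) lam = \<epsilon>"
      using t True by (auto simp: is_hitting_time_def)
    ultimately show ?thesis using t by (metis bent_neg)
  next
    case False
    have "0 \<le> t" if "h (flow f 1 lam t y) lam = \<epsilon>"
    proof (rule ccontr)
      assume "\<not> 0 \<le> t"
      then have "\<epsilon> < h y lam"
        using h_flow_strict_mono[of 1 lam y t 0] that assms t' d_pos by (auto simp: flow_0)
      with False show False by simp
    qed
    moreover have "0 \<le> t" if "h (bent lam t y) lam = \<epsilon>"
    proof (rule ccontr)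
      assume "\<not> 0 \<le> t"
      then have "\<epsilon> < h y lam"
        using h_bent_strict_mono[of lam y t 0] that assms t' d_pos by (auto simp: bent_0)
      with False show False by simp
    qed
    moreover have "is_hitting_time (flow f 1 lam) (flow f (-1) lam) (\<lambda>y. h y lam) \<epsilon> \<Delta> y t
        \<longleftrightarrow> h (flow f 1 lam t y) lam = \<epsilon>"
      using t False by (auto simp: is_hitting_time_def)
    ultimately show ?thesis using t by (metis bent_pos)
  qed
qed

text \<open>The end-point inequalities for the intermediate value theorem in \<open>hit\<close>,
  stated as an open condition so that they survive small changes of \<open>lam\<close> and
  \<open>y\<close>.\<close>

definition nearby :: "real \<Rightarrow> real \<Rightarrow> 'a \<Rightarrow> bool" where
  "nearby \<eta> lam y \<longleftrightarrow> dist lam lam0 < d \<and> dist y (ys 0) < d \<and>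
     h (bent lam (- \<eta>) y) lam < \<epsilon> \<and> \<epsilon> < h (bent lam \<eta> y) lam"

text \<open>The window is \<open>d\<close> and not \<Delta>, which makes the value independent of
  the choice of \<Delta>; \<open>half_return_map_eq\<close> reconciles it with the map in the
  theorem.\<close>

definition hit :: "real \<Rightarrow> 'a \<Rightarrow> real" where
  "hit lam y = (THE t. \<bar>t\<bar> < d \<and> h (bent lam t y) lam = \<epsilon>)"

definition half_return :: "real \<Rightarrow> 'a \<Rightarrow> 'a" where
  "half_return lam y = - flow f 1 lam (\<tau> + hit lam y) y"

lemma hit_unique:
  assumes "dist lam lam0 < d" "dist y (ys 0) < d" "\<bar>s\<bar> < d" "\<bar>t\<bar> < d"
    "h (bent lam s y) lam = \<epsilon>" "h (bent lam t y) lam = \<epsilon>"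
  shows "s = t"
  using h_bent_strict_mono[of lam y s t] h_bent_strict_mono[of lam y t s] assms
  by (cases s t rule: linorder_cases) (auto simp: abs_less_iff)

lemma hit:
  assumes n: "nearby \<eta> lam y" and \<eta>: "0 < \<eta>" "\<eta> < d"
  shows "\<bar>hit lam y\<bar> < \<eta>" "h (bent lam (hit lam y) y) lam = \<epsilon>"
proof -
  have b: "dist lam lam0 < d" "dist y (ys 0) < d" using n by (auto simp: nearby_def)
  have "continuous_on {-\<eta>..\<eta>} (\<lambda>t. h (bent lam t y) lam)"
    by (intro continuous_intros bent_continuous_comp)
  then obtain t where t: "-\<eta> \<le> t" "t \<le> \<eta>" "h (bent lam t y) lam = \<epsilon>"
    using IVT'[of "\<lambda>t. h (bent lam t y) lam" "-\<eta>" \<epsilon> \<eta>] n \<eta> by (auto simp: nearby_def)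
  have "t \<noteq> -\<eta>" "t \<noteq> \<eta>" using t n by (auto simp: nearby_def)
  then have t': "\<bar>t\<bar> < \<eta>" using t by auto
  have "hit lam y = t"
    unfolding hit_def by (rule the_equality) (use t t' \<eta> hit_unique[OF b] in auto)
  then show "\<bar>hit lam y\<bar> < \<eta>" "h (bent lam (hit lam y) y) lam = \<epsilon>" using t t' by auto
qed

lemma
  assumes n: "nearby \<eta> lam y" and \<eta>: "0 < \<eta>" "\<eta> < d" "\<eta> \<le> \<Delta>" "\<Delta> \<le> d"
  shows hitting_time_unique:
      "\<exists>!t. is_hitting_time (flow f 1 lam) (flow f (-1) lam) (\<lambda>y. h y lam) \<epsilon> \<Delta> y t"
    and half_return_map_eq:
      "half_return_map (flow f 1 lam) (flow f (-1) lam) (\<lambda>y. h y lam) \<epsilon> \<tau> \<Delta> y = half_return lam y"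
proof -
  have b: "dist lam lam0 < d" "dist y (ys 0) < d" using n by (auto simp: nearby_def)
  have iff: "is_hitting_time (flow f 1 lam) (flow f (-1) lam) (\<lambda>y. h y lam) \<epsilon> \<Delta> y t
      \<longleftrightarrow> t = hit lam y" for t
    unfolding is_hitting_time_iff[OF b \<eta>(4)]
    using hit[OF n \<eta>(1,2)] hit_unique[OF b, of t "hit lam y"] \<eta> by auto
  show "\<exists>!t. is_hitting_time (flow f 1 lam) (flow f (-1) lam) (\<lambda>y. h y lam) \<epsilon> \<Delta> y t"
    unfolding iff by simp
  show "half_return_map (flow f 1 lam) (flow f (-1) lam) (\<lambda>y. h y lam) \<epsilon> \<tau> \<Delta> y = half_return lam y"
    unfolding half_return_map_def half_return_def iff by simp
qed

lemma nearby_eventually: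
  assumes \<eta>: "0 < \<eta>" "\<eta> < d"
  shows "\<exists>r>0. \<forall>lam y. dist lam lam0 < r \<longrightarrow> dist y (ys 0) < r \<longrightarrow> nearby \<eta> lam y"
proof -
  have cb: "continuous_on UNIV (\<lambda>p. h (bent (fst p) (fst (snd p)) (snd (snd p))) (fst p))"
    by (intro continuous_intros bent_continuous_comp)
  have b0: "h (bent lam0 0 (ys 0)) lam0 = \<epsilon>" by (simp add: bent_0 ys_on_section)
  let ?S1 = "{(lam, t, y). h (bent lam t y) lam < \<epsilon>}" and ?S2 = "{(lam, t, y). \<epsilon> < h (bent lam t y) lam}"
  have "open ?S1" unfolding split_beta by (intro open_Collect_less cb continuous_intros)
  moreover have "(lam0, -\<eta>, ys 0) \<in> ?S1"
    using h_bent_strict_mono[of lam0 "ys 0" "-\<eta>" 0] d_pos \<eta> b0 by simp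
  ultimately obtain r1 where r1: "r1 > 0" "\<And>lam t y. dist lam lam0 < r1 \<Longrightarrow> dist t (-\<eta>) < r1 \<Longrightarrow>
      dist y (ys 0) < r1 \<Longrightarrow> (lam, t, y) \<in> ?S1" using triple_box_in_open[of ?S1 lam0 "-\<eta>" "ys 0"] by blast
  have "open ?S2" unfolding split_beta by (intro open_Collect_less cb continuous_intros)
  moreover have "(lam0, \<eta>, ys 0) \<in> ?S2"
    using h_bent_strict_mono[of lam0 "ys 0" 0 \<eta>] d_pos \<eta> b0 by simp
  ultimately obtain r2 where r2: "r2 > 0" "\<And>lam t y. dist lam lam0 < r2 \<Longrightarrow> dist t \<eta> < r2 \<Longrightarrow>
      dist y (ys 0) < r2 \<Longrightarrow> (lam, t, y) \<in> ?S2" using triple_box_in_open[of ?S2 lam0 \<eta> "ys 0"] by blast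
  show ?thesis
  proof (intro exI[of _ "min d (min r1 r2)"] conjI allI impI)
    show "0 < min d (min r1 r2)" using d_pos r1 r2 by simp
    fix lam y assume a: "dist lam lam0 < min d (min r1 r2)" "dist y (ys 0) < min d (min r1 r2)"
    show "nearby \<eta> lam y"
      using r1(2)[of lam "-\<eta>" y] r2(2)[of lam \<eta> y] r1(1) r2(1) a by (simp add: nearby_def)
  qed
qed

text \<open>At \<open>lam0\<close> the point \<open>ys 0\<close> is fixed, because
  \<open>- flow f 1 lam0 \<tau> (ys 0) = - ys \<tau> = ys 0\<close>. For nearby data the hitting
  time enters through its bound by \<eta>, and continuity of the flow gives the rest.\<close>

lemma half_return_near:
  assumes e: "0 < e"
  shows "\<exists>r>0. \<forall>lam y. dist lam lam0 < r \<longrightarrow> dist y (ys 0) < r \<longrightarrow> dist (half_return lam y) (ys 0) < e"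
proof -
  let ?S = "{(lam, t, y). dist (- flow f 1 lam t y) (ys 0) < e}"
  have "open ?S"
    unfolding split_beta by (intro open_Collect_less continuous_intros flow_continuous_comp) auto
  moreover have "(lam0, \<tau>, ys 0) \<in> ?S"
    using ys_flow_plus[of \<tau>] ys_\<tau> pos e by (simp flip: ys_flow_plus)
  ultimately obtain r1 where r1: "r1 > 0" "\<And>lam t y. dist lam lam0 < r1 \<Longrightarrow> dist t \<tau> < r1 \<Longrightarrow>
      dist y (ys 0) < r1 \<Longrightarrow> (lam, t, y) \<in> ?S" using triple_box_in_open[of ?S lam0 \<tau> "ys 0"] by blast
  define \<eta> where "\<eta> = min r1 d / 2"
  have \<eta>: "0 < \<eta>" "\<eta> < d" "\<eta> < r1" using r1 d_pos by (auto simp: \<eta>_def)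
  obtain r2 where r2: "r2 > 0" "\<And>lam y. dist lam lam0 < r2 \<Longrightarrow> dist y (ys 0) < r2 \<Longrightarrow> nearby \<eta> lam y"
    using nearby_eventually[OF \<eta>(1,2)] by blast
  show ?thesis
  proof (intro exI[of _ "min r1 r2"] conjI allI impI)
    fix lam y assume a: "dist lam lam0 < min r1 r2" "dist y (ys 0) < min r1 r2"
    have "\<bar>hit lam y\<bar> < \<eta>" using hit(1)[OF r2(2) \<eta>(1,2)] a by simp
    then have "(lam, \<tau> + hit lam y, y) \<in> ?S"
      using a \<eta> by (intro r1(2)) (auto simp: dist_real_def)
    then show "dist (half_return lam y) (ys 0) < e" by (simp add: half_return_def)
  qed (use r1 r2 in auto)
qed

text \<open>
  The time \<open>s1\<close> is the first time the history \<open>\<xi>\<close> reaches the level \<open>\<epsilon>\<close>.  Later re-crossings of \<open>\<epsilon>\<close>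
  do not matter, because of the hysteresis.  The point \<open>first_switch\<close> is the reflection of the
  point at which the control turns from \<open>+1\<close> to \<open>-1\<close>.
\<close>

definition admissible :: "real \<Rightarrow> real \<Rightarrow> real \<Rightarrow> (real \<Rightarrow> 'a) \<Rightarrow> real \<Rightarrow> bool" where
  "admissible \<Delta> \<eta> lam \<xi> s1 \<longleftrightarrow> continuous_on {-\<Theta>..0} \<xi> \<and>
     \<bar>s1 + \<Delta>\<bar> \<le> \<eta> \<and> (\<forall>s\<in>{-\<tau>..<s1}. h (\<xi> s) lam < \<epsilon>) \<and> \<epsilon> \<le> h (\<xi> s1) lam \<and>
     h (\<xi> (-\<tau>)) lam \<le> - \<epsilon> \<and> (\<forall>s\<in>{s1..0}. - \<epsilon> < h (\<xi> s) lam) \<and>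
     (\<forall>t\<in>{0..\<tau> - \<Delta> - \<eta>}. - \<epsilon> < h (flow f 1 lam t (\<xi> 0)) lam)"

definition first_switch :: "real \<Rightarrow> (real \<Rightarrow> 'a) \<Rightarrow> real \<Rightarrow> 'a" where
  "first_switch lam \<xi> s1 = - flow f 1 lam (\<tau> + s1) (\<xi> 0)"

text \<open>Here \<eta> bounds the timing errors of \<open>s1\<close> and of the hitting time, and
  \<rho> the deviation of the return time from \<open>2 * \<tau>\<close>. The two timing errors,
  together at most \<open>\<rho> / 4\<close>, and the error \<open>\<rho> / 2\<close> in reaching
  the section plane add up to less than \<rho>.\<close>

definition sizes :: "real \<Rightarrow> real \<Rightarrow> real \<Rightarrow> bool" where
  "sizes \<Delta> \<rho> \<eta> \<longleftrightarrow> 0 < \<eta> \<and> 8 * \<eta> \<le> \<rho> \<and> 4 * \<rho> \<le> \<Delta> \<and> 4 * \<Delta> \<le> d"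

text \<open>The order of the switch at \<open>t1\<close> and the crossing at \<open>t1 + H\<close>
  is left open. Control and trajectory are extended alternately, each piece of control being decided
  by the signal one delay earlier.\<close>

lemma relay_motion:
  fixes \<xi> s1 lam
  defines "w \<equiv> first_switch lam \<xi> s1"
  defines "t1 \<equiv> \<tau> + s1"
  defines "t3 \<equiv> \<tau> + s1 + hit lam w + \<tau>"
  assumes sol: "relay_solution f h \<epsilon> \<tau> \<Theta> lam \<xi> 1 y u"
    and sz: "sizes \<Delta> \<rho> \<eta>" and adm: "admissible \<Delta> \<eta> lam \<xi> s1" and near: "nearby \<eta> lam w"
  shows "\<And>t. t \<in> {t1..<t3} \<Longrightarrow> u t = -1"
    and "\<And>t. t \<in> {t3..<t1 + \<tau> + d} \<Longrightarrow> u t = 1"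
    and "\<And>t. t \<in> {t1..t3} \<Longrightarrow> y t = flow f (-1) lam (t - t3) (half_return lam w)"
    and "\<And>t. t \<in> {t3..t1 + \<tau> + d} \<Longrightarrow> y t = flow f 1 lam (t - t3) (half_return lam w)"
proof -
  define g where "g = (\<lambda>s. h (y s) lam)"
  define H where "H = hit lam w"
  have s: "0 < \<eta>" "8 * \<eta> \<le> \<rho>" "4 * \<rho> \<le> \<Delta>" "4 * \<Delta> \<le> d" "d < \<tau> / 4"
    using sz d_less by (auto simp: sizes_def)
  have \<eta>d: "\<eta> < d" using s by linarith
  have b: "dist lam lam0 < d" "dist w (ys 0) < d" using near by (auto simp: nearby_def)
  have H: "\<bar>H\<bar> < \<eta>" "h (bent lam H w) lam = \<epsilon>" using hit[OF near s(1) \<eta>d] by (auto simp: H_def)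
  have s1: "\<bar>s1 + \<Delta>\<bar> \<le> \<eta>" using adm by (simp add: admissible_def)
  have t1: "\<tau> - \<Delta> - \<eta> \<le> t1" "t1 \<le> \<tau> - \<Delta> + \<eta>" "0 < t1" "t1 < \<tau>" "s1 < 0" "- \<tau> < s1"
    using s1 s unfolding t1_def by linarith+
  have y\<xi>: "y r = \<xi> r" if "r \<in> {-\<tau>..0}" for r
    using sol that \<tau>_le by (auto simp: relay_solution_def)
  have rv: "relay_value \<epsilon> \<tau> g 1 t (u t)" if "0 < t" for t
    using sol that by (simp add: relay_solution_def g_def)
  \<comment> \<open>The anchor is time \<open>-\<tau>\<close>, where the history is at or below
    \<open>-\<epsilon>\<close>; the level \<open>\<epsilon>\<close> is not reached before
    \<open>s1\<close>.\<close>
  have u1: "u t = 1" if t: "t \<in> {0..<t1}" for t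
  proof (cases "t = 0")
    case True
    then show ?thesis using sol by (simp add: relay_solution_def)
  next
    case False
    show ?thesis
    proof (rule relay_value_one[OF pos rv, of t "-\<tau>"])
      show "g (- \<tau>) \<le> - \<epsilon>" using adm y\<xi>[of "-\<tau>"] pos by (simp add: admissible_def g_def)
      show "g r < \<epsilon>" if "r \<in> {-\<tau>..t - \<tau>}" for r
        using adm y\<xi>[of r] that t t1 by (simp add: admissible_def g_def t1_def)
    qed (use t False in auto)
  qed
  have y1: "y t = flow f 1 lam t (\<xi> 0)" if "t \<in> {0..t1}" for t
    using relay_solution_follows_flow[OF sol, of 0 1 t1 t] u1 that y\<xi>[of 0] pos by simp
  have yt1: "y t1 = - w"
    using y1[of t1] t1 by (simp add: w_def first_switch_def t1_def)
  \<comment> \<open>By reflection, the approach to \<open>-w\<close> under control \<open>1\<close>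
    is the negative of the incoming branch of the bent curve through \<open>w\<close>.\<close>
  have y1b: "y (t1 + r) = - bent lam r w" if r: "r \<in> {-t1..0}" for r
  proof -
    have "y (t1 + r) = flow f 1 lam r (flow f 1 lam t1 (\<xi> 0))"
      using y1[of "t1 + r"] flow_add[of 1 lam r t1 "\<xi> 0"] r by (simp add: add.commute)
    also have "\<dots> = - flow f (-1) lam r w"
      using y1[of t1] yt1 t1 flow_odd[of "-1" lam r w] by simp
    finally show ?thesis using r by (simp add: bent_neg)
  qed
  \<comment> \<open>Three stretches: the history and the flow away from the corner, both covered by
    \<open>admissible\<close>, and the last piece inside the box, where \<open>h\<close> along the
    bent curve is still below its value at \<open>H\<close>.\<close>
  have g1: "- \<epsilon> < g r" if r: "r \<in> {s1..t1}" "r < t1 + H" for r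
  proof -
    consider "r \<le> 0" | "0 \<le> r" "r \<le> \<tau> - \<Delta> - \<eta>" | "\<tau> - \<Delta> - \<eta> < r" by linarith
    then show ?thesis
    proof cases
      case 1
      then show ?thesis using adm y\<xi>[of r] r t1 by (simp add: admissible_def g_def)
    next
      case 2
      then show ?thesis using adm y1[of r] r t1 by (simp add: admissible_def g_def)
    next
      case 3
      define q where "q = r - t1"
      have q: "- d < q" "q < H" "H < d" "q \<in> {-t1..0}"
        using 3 r t1 s H(1) unfolding q_def by auto
      have "g r = - h (bent lam q w) lam"
        using y1b[OF q(4)] by (simp add: g_def q_def h_odd)
      then show ?thesis using h_bent_strict_mono[OF b q(1-3)] H(2) by simp
    qed
  qed
  have u2: "u t = -1" if t: "t1 \<le> t" and gt: "\<And>r. r \<in> {s1..t - \<tau>} \<Longrightarrow> - \<epsilon> < g r" for t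
  proof (rule relay_value_minus_one[OF pos rv, of t s1])
    show "\<epsilon> \<le> g s1" using adm y\<xi>[of s1] t1 by (simp add: admissible_def g_def)
  qed (use t t1 gt in \<open>auto simp: t1_def\<close>)
  have y2: "y t = - flow f 1 lam (t - t1) w"
    if t: "t \<in> {t1..c}" and c: "\<And>t. t \<in> {t1..<c} \<Longrightarrow> u t = -1" for t c
    using relay_solution_follows_flow[OF sol, of t1 "-1" c t] t c t1 yt1 flow_odd[of 1 lam _ w] by simp
  \<comment> \<open>First round: \<open>g1\<close> covers signal times up to
    \<open>t1 - \<eta>\<close>, which decides the control for almost a full delay after
    \<open>t1\<close>. This reaches beyond a crossing that falls after \<open>t1\<close>.\<close>
  have u2a: "u t = -1" if "t \<in> {t1..<t1 + (\<tau> - \<eta>)}" for t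
    by (rule u2) (use that g1 H(1) t1 s in auto)
  \<comment> \<open>Second round: the stretch between \<open>t1\<close> and \<open>t1 + H\<close>,
    present only if \<open>H > 0\<close>, can now be followed on the outgoing branch of the bent
    curve.\<close>
  have g2: "- \<epsilon> < g r" if r: "r \<in> {s1..<t1 + H}" for r
  proof (cases "r \<le> t1")
    case True
    then show ?thesis using g1 r by simp
  next
    case False
    define q where "q = r - t1"
    have q: "- d < q" "q < H" "H < d" "0 \<le> q"
      using False r t1 s H(1) unfolding q_def by auto
    have "y r = - bent lam q w"
      using y2[where t = r and c = "t1 + (\<tau> - \<eta>)", OF _ u2a] False r H(1) s q(4)
      by (simp add: bent_pos q_def)
    then have "g r = - h (bent lam q w) lam" by (simp add: g_def h_odd)
    then show ?thesis using h_bent_strict_mono[OF b q(1-3)] H(2) by simp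
  qed
  show u2b: "u t = -1" if "t \<in> {t1..<t3}" for t
    by (rule u2) (use that g2 in \<open>auto simp: t3_def H_def t1_def\<close>)
  have t3: "t3 = t1 + H + \<tau>" by (simp add: t3_def t1_def H_def)
  have y2b: "y t = - flow f 1 lam (t - t1) w" if "t \<in> {t1..t3}" for t
    by (rule y2[OF that u2b])
  have yb: "y (t1 + r) = - bent lam r w" if "r \<in> {-t1..H + \<tau>}" for r
  proof (cases "r \<le> 0")
    case True
    then show ?thesis using y1b that by simp
  next
    case False
    then show ?thesis using y2b[of "t1 + r"] that by (simp add: bent_pos t3)
  qed
  have gb: "g (t1 + r) = - h (bent lam r w) lam" if "r \<in> {-t1..H + \<tau>}" for r
    using yb[OF that] by (simp add: g_def h_odd)
  have yt3: "y t3 = half_return lam w"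
    using y2b[of t3] t1 H(1) s by (simp add: t3 half_return_def H_def add.commute)
  \<comment> \<open>The signal reaches \<open>-\<epsilon>\<close> at \<open>t1 + H\<close> and stays
    negative while \<open>h\<close> is positive along the bent curve, that is until
    \<open>t1 + d\<close>; one delay later this is the end of the window.\<close>
  show u3: "u t = 1" if t: "t \<in> {t3..<t1 + \<tau> + d}" for t
  proof (rule relay_value_one[OF pos rv, of t "t1 + H"])
    show "g (t1 + H) \<le> - \<epsilon>" using gb[of H] H s t1 by simp
    show "g r < \<epsilon>" if r: "r \<in> {t1 + H..t - \<tau>}" for r
    proof -
      define q where "q = r - t1"
      have q: "\<bar>q\<bar> < d" "q \<in> {-t1..H + \<tau>}"
        using r t H(1) \<eta>d s t1 unfolding q_def by auto
      then show ?thesis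
        using gb[OF q(2)] h_bent_pos[OF b q(1)] pos by (simp add: q_def)
    qed
  qed (use t t1 H(1) s in \<open>auto simp: t3\<close>)
  show "y t = flow f (-1) lam (t - t3) (half_return lam w)" if t: "t \<in> {t1..t3}" for t
  proof -
    have "y t = flow f (-1) lam (t - t1) (y t1)"
      using relay_solution_follows_flow[OF sol, of t1 "-1" t3 t] t u2b t1 by simp
    moreover have "y t3 = flow f (-1) lam (t3 - t1) (y t1)"
      using relay_solution_follows_flow[OF sol, of t1 "-1" t3 t3] u2b t1 t by simp
    moreover have "flow f (-1) lam (t - t1) (y t1)
        = flow f (-1) lam (t - t3) (flow f (-1) lam (t3 - t1) (y t1))"
      using flow_add[of "-1" lam "t - t3" "t3 - t1" "y t1"] by simp
    ultimately show ?thesis using yt3 by simp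
  qed
  show "y t = flow f 1 lam (t - t3) (half_return lam w)" if t: "t \<in> {t3..t1 + \<tau> + d}" for t
    using relay_solution_follows_flow[OF sol, of t3 1 "t1 + \<tau> + d" t] t u3 t1 H(1) s yt3
    by (simp add: t3)
qed

end

section \<open>The return map\<close>

context local_orbit
begin

abbreviation E where "E lam \<equiv> evolution f h \<epsilon> \<tau> \<Theta> lam"
abbreviation \<Gamma> where "\<Gamma> \<Delta> \<equiv> section_plane f lam0 ys \<Delta>"
abbreviation P where "P \<Delta> \<rho> lam \<equiv> poincare_map (E lam) (\<Gamma> \<Delta>) \<tau> \<rho>"

text \<open>The counterpart of \<open>nearby\<close> for the section plane: an open condition that
  supplies the end points for an intermediate value argument.\<close>

definition crosses :: "real \<Rightarrow> real \<Rightarrow> real \<Rightarrow> 'a \<Rightarrow> bool" where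
  "crosses \<Delta> \<rho> lam b \<longleftrightarrow> dist lam lam0 < d \<and> dist b (ys 0) < d \<and>
     f (ys 0) 1 lam0 \<bullet> (flow f 1 lam (\<Delta> - \<rho> / 2) b - ys \<Delta>) < 0 \<and>
     0 < f (ys 0) 1 lam0 \<bullet> (flow f 1 lam (\<Delta> + \<rho> / 2) b - ys \<Delta>)"

lemma crosses_eventually:
  assumes \<rho>: "0 < \<rho>" "4 * \<rho> \<le> \<Delta>" "4 * \<Delta> \<le> d"
  shows "\<exists>r>0. \<forall>lam b. dist lam lam0 < r \<longrightarrow> dist b (ys 0) < r \<longrightarrow> crosses \<Delta> \<rho> lam b"
proof -
  have y\<Delta>: "ys \<Delta> = flow f 1 lam0 \<Delta> (ys 0)" using ys_flow_plus[of \<Delta>] \<rho> d_less d_pos by simp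
  let ?k = "\<lambda>p. f (ys 0) 1 lam0 \<bullet> (flow f 1 (fst p) (fst (snd p)) (snd (snd p)) - ys \<Delta>)"
  have ck: "continuous_on UNIV ?k" by (intro continuous_intros flow_continuous_comp) auto
  let ?S1 = "{(lam, t, b). f (ys 0) 1 lam0 \<bullet> (flow f 1 lam t b - ys \<Delta>) < 0}"
  let ?S2 = "{(lam, t, b). 0 < f (ys 0) 1 lam0 \<bullet> (flow f 1 lam t b - ys \<Delta>)}"
  have "open ?S1" unfolding split_beta by (intro open_Collect_less ck continuous_intros)
  moreover have "(lam0, \<Delta> - \<rho> / 2, ys 0) \<in> ?S1"
    using section_strict_mono[of lam0 "ys 0" "\<Delta> - \<rho> / 2" \<Delta>] \<rho> d_pos by (simp add: y\<Delta> inner_diff_right)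
  ultimately obtain r1 where r1: "r1 > 0" "\<And>lam t b. dist lam lam0 < r1 \<Longrightarrow>
      dist t (\<Delta> - \<rho> / 2) < r1 \<Longrightarrow> dist b (ys 0) < r1 \<Longrightarrow> (lam, t, b) \<in> ?S1"
    using triple_box_in_open[of ?S1 lam0 "\<Delta> - \<rho> / 2" "ys 0"] by blast
  have "open ?S2" unfolding split_beta by (intro open_Collect_less ck continuous_intros)
  moreover have "(lam0, \<Delta> + \<rho> / 2, ys 0) \<in> ?S2"
    using section_strict_mono[of lam0 "ys 0" \<Delta> "\<Delta> + \<rho> / 2"] \<rho> d_pos by (simp add: y\<Delta> inner_diff_right)
  ultimately obtain r2 where r2: "r2 > 0" "\<And>lam t b. dist lam lam0 < r2 \<Longrightarrow>
      dist t (\<Delta> + \<rho> / 2) < r2 \<Longrightarrow> dist b (ys 0) < r2 \<Longrightarrow> (lam, t, b) \<in> ?S2"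
    using triple_box_in_open[of ?S2 lam0 "\<Delta> + \<rho> / 2" "ys 0"] by blast
  show ?thesis
  proof (intro exI[of _ "min d (min r1 r2)"] conjI allI impI)
    show "0 < min d (min r1 r2)" using d_pos r1 r2 by simp
    fix lam b assume a: "dist lam lam0 < min d (min r1 r2)" "dist b (ys 0) < min d (min r1 r2)"
    show "crosses \<Delta> \<rho> lam b"
      using r1(2)[of lam "\<Delta> - \<rho> / 2" b] r2(2)[of lam "\<Delta> + \<rho> / 2" b] r1(1) r2(1) a
      by (simp add: crosses_def)
  qed
qed

lemma crossing_point:
  assumes c: "crosses \<Delta> \<rho> lam b" and \<rho>: "0 < \<rho>" "4 * \<rho> \<le> \<Delta>" "4 * \<Delta> \<le> d"
  obtains \<theta> where "\<bar>\<theta> - \<Delta>\<bar> < \<rho> / 2"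
    "\<And>s. \<bar>s\<bar> < d \<Longrightarrow> flow f 1 lam s b \<in> \<Gamma> \<Delta> \<longleftrightarrow> s = \<theta>"
proof -
  let ?k = "\<lambda>s. f (ys 0) 1 lam0 \<bullet> (flow f 1 lam s b - ys \<Delta>)"
  have "continuous_on {\<Delta> - \<rho> / 2..\<Delta> + \<rho> / 2} ?k"
    by (intro continuous_intros flow_continuous_comp) auto
  then obtain \<theta> where \<theta>: "\<Delta> - \<rho> / 2 \<le> \<theta>" "\<theta> \<le> \<Delta> + \<rho> / 2" "?k \<theta> = 0"
    using IVT'[of ?k "\<Delta> - \<rho> / 2" 0 "\<Delta> + \<rho> / 2"] c \<rho> by (auto simp: crosses_def)
  have "\<theta> \<noteq> \<Delta> - \<rho> / 2" "\<theta> \<noteq> \<Delta> + \<rho> / 2" using \<theta>(3) c by (auto simp: crosses_def)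
  then have \<theta>': "\<bar>\<theta> - \<Delta>\<bar> < \<rho> / 2" using \<theta> by (auto simp: abs_if)
  then have \<theta>d: "\<bar>\<theta>\<bar> < d" using \<rho> by linarith
  have b: "dist lam lam0 < d" "dist b (ys 0) < d" using c by (auto simp: crosses_def)
  show thesis
  proof (rule that[OF \<theta>'])
    fix s :: real assume s: "\<bar>s\<bar> < d"
    have "?k s \<noteq> 0" if "s \<noteq> \<theta>"
      using section_strict_mono[OF b, of s \<theta>] section_strict_mono[OF b, of \<theta> s] that s \<theta>d \<theta>(3)
      by (cases s \<theta> rule: linorder_cases) (auto simp: inner_diff_right abs_less_iff)
    then show "flow f 1 lam s b \<in> \<Gamma> \<Delta> \<longleftrightarrow> s = \<theta>"
      using \<theta>(3) by (auto simp: section_plane_def)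
  qed
qed

text \<open>The point \<open>b\<close> is reached at \<open>t3\<close>, within
  \<open>\<rho> / 4\<close> of \<open>2 * \<tau> - \<Delta>\<close>. All times within \<rho> of
  \<open>2 * \<tau>\<close> lie on the arc after \<open>t3\<close> and inside the box, so uniqueness
  of the return time reduces to uniqueness of the crossing with the plane.\<close>

lemma return_structure:
  fixes \<xi> s1 lam
  defines "b \<equiv> half_return lam (first_switch lam \<xi> s1)"
  assumes sz: "sizes \<Delta> \<rho> \<eta>" and adm: "admissible \<Delta> \<eta> lam \<xi> s1"
    and near: "nearby \<eta> lam (first_switch lam \<xi> s1)" and cr: "crosses \<Delta> \<rho> lam b"
  obtains tr \<theta> where "\<And>t. is_return_time (E lam) (\<Gamma> \<Delta>) \<tau> \<rho> \<xi> t \<longleftrightarrow> t = tr"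
    "\<bar>\<theta> - \<Delta>\<bar> < \<rho> / 2" "flow f 1 lam \<theta> b \<in> \<Gamma> \<Delta>"
    "\<And>s. s \<in> {-\<theta>..0} \<Longrightarrow> P \<Delta> \<rho> lam \<xi> s = flow f 1 lam (s + \<theta>) b"
    "\<And>s. s \<in> {-\<tau>..-\<theta>} \<Longrightarrow> P \<Delta> \<rho> lam \<xi> s = flow f (-1) lam (s + \<theta>) b"
    "\<And>s. s \<in> {-\<theta>..0} \<Longrightarrow> snd (E lam (tr + s) (\<xi>, 1)) = 1"
    "\<And>s. s \<in> {-\<tau>..<-\<theta>} \<Longrightarrow> snd (E lam (tr + s) (\<xi>, 1)) = -1"
proof -
  have s: "0 < \<eta>" "8 * \<eta> \<le> \<rho>" "4 * \<rho> \<le> \<Delta>" "4 * \<Delta> \<le> d" "d < \<tau> / 4"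
    using sz d_less by (auto simp: sizes_def)
  have \<eta>d: "\<eta> < d" "0 < \<rho>" using s by linarith+
  have \<xi>: "continuous_on {-\<Theta>..0} \<xi>" and s1: "\<bar>s1 + \<Delta>\<bar> \<le> \<eta>" using adm by (auto simp: admissible_def)
  obtain y u where sol: "relay_solution f h \<epsilon> \<tau> \<Theta> lam \<xi> 1 y u"
    using relay_solution_exists[OF \<xi>, of 1 lam] by auto
  define H where "H = hit lam (first_switch lam \<xi> s1)"
  have H: "\<bar>H\<bar> < \<eta>" using hit[OF near s(1) \<eta>d(1)] by (simp add: H_def)
  define t3 where "t3 = \<tau> + s1 + H + \<tau>"
  note motion = relay_motion[OF sol sz adm near, folded H_def, folded t3_def b_def]
  obtain \<theta> where \<theta>: "\<bar>\<theta> - \<Delta>\<bar> < \<rho> / 2" "\<And>s. \<bar>s\<bar> < d \<Longrightarrow> flow f 1 lam s b \<in> \<Gamma> \<Delta> \<longleftrightarrow> s = \<theta>"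
    using crossing_point[OF cr \<eta>d(2) s(3,4)] by blast
  define tr where "tr = t3 + \<theta>"
  have ev: "E lam t (\<xi>, 1) = (hist \<Theta> y t, u t)" if "0 \<le> t" for t by (rule evolution_eq[OF sol that])
  have \<Theta>: "0 \<le> \<Theta>" using pos \<tau>_le by linarith
  have ret: "is_return_time (E lam) (\<Gamma> \<Delta>) \<tau> \<rho> \<xi> t \<longleftrightarrow> t = tr" for t
  proof (cases "\<bar>t - 2 * \<tau>\<bar> < \<rho>")
    case True
    have t0: "0 \<le> t" "t \<in> {t3..\<tau> + s1 + \<tau> + d}" "\<bar>t - t3\<bar> < d"
      using True s s1 H unfolding t3_def by auto
    have "fst (E lam t (\<xi>, 1)) 0 = y t" using ev[OF t0(1)] \<Theta> by (simp add: hist_def)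
    then show ?thesis
      using True motion(4)[OF t0(2)] \<theta>(2)[OF t0(3)] by (auto simp: is_return_time_def tr_def)
  next
    case False
    then have "t \<noteq> tr" using s s1 H \<theta>(1) unfolding tr_def t3_def by (auto simp: abs_if split: if_splits)
    then show ?thesis using False by (simp add: is_return_time_def)
  qed
  then have rt: "return_time (E lam) (\<Gamma> \<Delta>) \<tau> \<rho> \<xi> = tr" by (simp add: return_time_def)
  have tr0: "2 * \<tau> - \<rho> < tr" "tr < 2 * \<tau> + \<rho>"
    using s s1 H \<theta>(1) unfolding tr_def t3_def by (auto simp: abs_if split: if_splits)
  have P: "P \<Delta> \<rho> lam \<xi> r = y (tr + r)" if "r \<in> {-\<tau>..0}" for r
    using ev[of tr] tr0 s that \<tau>_le by (simp add: poincare_map_def rt hist_def)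
  have \<theta>0: "0 < \<theta>" "\<theta> < \<tau>" using \<theta>(1) s by linarith+
  \<comment> \<open>The delay window of the image does not begin before the first switch
    \<open>\<tau> + s1\<close>; inside it the control is \<open>-1\<close> up to \<open>t3\<close>
    and \<open>1\<close> from \<open>t3\<close> on.\<close>
  have trd: "tr \<le> \<tau> + s1 + \<tau> + d / 2" "\<tau> + s1 \<le> tr - \<tau>"
    using s s1 H \<theta>(1) unfolding tr_def t3_def by (auto simp: abs_if split: if_splits)
  show thesis
  proof (rule that[OF ret \<theta>(1)])
    show "flow f 1 lam \<theta> b \<in> \<Gamma> \<Delta>" using \<theta>(2)[of \<theta>] \<theta>(1) s by linarith
    show "P \<Delta> \<rho> lam \<xi> r = flow f 1 lam (r + \<theta>) b" if r: "r \<in> {-\<theta>..0}" for r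
      using P[of r] motion(4)[of "tr + r"] r \<theta>0 trd s by (simp add: tr_def add_ac)
    show "P \<Delta> \<rho> lam \<xi> r = flow f (-1) lam (r + \<theta>) b" if r: "r \<in> {-\<tau>..-\<theta>}" for r
      using P[of r] motion(3)[of "tr + r"] r \<theta>0 trd s by (simp add: tr_def add_ac)
    show "snd (E lam (tr + r) (\<xi>, 1)) = 1" if r: "r \<in> {-\<theta>..0}" for r
      using ev[of "tr + r"] motion(2)[of "tr + r"] r \<theta>0 trd tr0 s by (simp add: tr_def)
    show "snd (E lam (tr + r) (\<xi>, 1)) = -1" if r: "r \<in> {-\<tau>..<-\<theta>}" for r
      using ev[of "tr + r"] motion(1)[of "tr + r"] r \<theta>0 trd tr0 s by (simp add: tr_def)
  qed
qed

text \<open>The recorded control decides: two different offsets would give it both values at a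
  common time. With equal offsets the point is the value of the segment at
  \<open>-\<theta>\<close>.\<close>

lemma is_switching_point_iff:
  assumes sz: "sizes \<Delta> \<rho> \<eta>"
    and ret: "\<And>t. is_return_time (E lam) (\<Gamma> \<Delta>) \<tau> \<rho> \<xi> t \<longleftrightarrow> t = tr"
    and \<theta>: "\<bar>\<theta> - \<Delta>\<bar> < \<rho> / 2" "flow f 1 lam \<theta> b \<in> \<Gamma> \<Delta>"
    and P: "\<And>s. s \<in> {-\<theta>..0} \<Longrightarrow> P \<Delta> \<rho> lam \<xi> s = flow f 1 lam (s + \<theta>) b"
      "\<And>s. s \<in> {-\<tau>..-\<theta>} \<Longrightarrow> P \<Delta> \<rho> lam \<xi> s = flow f (-1) lam (s + \<theta>) b"
    and u: "\<And>s. s \<in> {-\<theta>..0} \<Longrightarrow> snd (E lam (tr + s) (\<xi>, 1)) = 1"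
      "\<And>s. s \<in> {-\<tau>..<-\<theta>} \<Longrightarrow> snd (E lam (tr + s) (\<xi>, 1)) = -1"
    and U: "b \<in> U"
  shows "is_switching_point (E lam) (flow f 1 lam) (flow f (-1) lam) (\<Gamma> \<Delta>) \<tau> \<rho> \<tau> \<Delta> U \<xi> y \<longleftrightarrow> y = b"
proof -
  have s: "0 < \<eta>" "8 * \<eta> \<le> \<rho>" "4 * \<rho> \<le> \<Delta>" "4 * \<Delta> \<le> d" "d < \<tau> / 4"
    using sz d_less by (auto simp: sizes_def)
  have \<theta>0: "0 < \<theta>" "\<theta> < \<tau>" "\<theta> \<le> 2 * \<Delta>" "2 * \<Delta> < \<tau>" using \<theta>(1) s by linarith+
  have rt: "return_time (E lam) (\<Gamma> \<Delta>) \<tau> \<rho> \<xi> = tr" by (simp add: return_time_def ret)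
  show ?thesis
  proof
    assume "y = b"
    then show "is_switching_point (E lam) (flow f 1 lam) (flow f (-1) lam) (\<Gamma> \<Delta>) \<tau> \<rho> \<tau> \<Delta> U \<xi> y"
      unfolding is_switching_point_def rt using U \<theta> \<theta>0 P u by (intro conjI bexI[of _ \<theta>]) auto
  next
    assume "is_switching_point (E lam) (flow f 1 lam) (flow f (-1) lam) (\<Gamma> \<Delta>) \<tau> \<rho> \<tau> \<Delta> U \<xi> y"
    then obtain \<theta>' where \<theta>': "\<theta>' \<in> {0..2 * \<Delta>}"
      "\<And>s. s \<in> {-\<theta>'..0} \<Longrightarrow> P \<Delta> \<rho> lam \<xi> s = flow f 1 lam (s + \<theta>') y"
      "\<And>s. s \<in> {-\<theta>'..0} \<Longrightarrow> snd (E lam (tr + s) (\<xi>, 1)) = 1"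
      "\<And>s. s \<in> {-\<tau>..<-\<theta>'} \<Longrightarrow> snd (E lam (tr + s) (\<xi>, 1)) = -1"
      unfolding is_switching_point_def rt by blast
    have "\<not> \<theta>' < \<theta>"
    proof
      assume "\<theta>' < \<theta>"
      then show False using \<theta>'(4)[of "-\<theta>"] u(1)[of "-\<theta>"] \<theta>0 by simp
    qed
    moreover have "\<not> \<theta> < \<theta>'"
    proof
      assume "\<theta> < \<theta>'"
      then show False using \<theta>'(3)[of "-\<theta>'"] u(2)[of "-\<theta>'"] \<theta>0 \<theta>'(1) by simp
    qed
    ultimately have "\<theta>' = \<theta>" by simp
    then show "y = b" using \<theta>'(2)[of "-\<theta>"] P(1)[of "-\<theta>"] \<theta>0 by (simp add: flow_0)
  qed
qed

text \<open>Up to the time shift \<theta> the history is the bent curve through \<open>b\<close>, so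
  \<open>s1 = hit lam b - \<theta>\<close>. Flowing for the time \<open>\<tau> + s1\<close> from
  \<open>\<xi> 0 = flow f 1 lam \<theta> b\<close> cancels \<theta>.\<close>

lemma first_switch_of_return:
  assumes sz: "sizes \<Delta> \<rho> \<eta>" and adm: "admissible \<Delta> \<eta> lam \<xi> s1" and near: "nearby \<eta> lam b"
    and \<theta>: "\<bar>\<theta> - \<Delta>\<bar> < \<rho> / 2"
    and \<xi>: "\<And>s. s \<in> {-\<theta>..0} \<Longrightarrow> \<xi> s = flow f 1 lam (s + \<theta>) b"
      "\<And>s. s \<in> {-\<tau>..-\<theta>} \<Longrightarrow> \<xi> s = flow f (-1) lam (s + \<theta>) b"
  shows "first_switch lam \<xi> s1 = half_return lam b"
proof -
  have s: "0 < \<eta>" "8 * \<eta> \<le> \<rho>" "4 * \<rho> \<le> \<Delta>" "4 * \<Delta> \<le> d" "d < \<tau> / 4"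
    using sz d_less by (auto simp: sizes_def)
  have \<eta>d: "\<eta> < d" using s by linarith
  have b: "dist lam lam0 < d" "dist b (ys 0) < d" using near by (auto simp: nearby_def)
  define H where "H = hit lam b"
  have H: "\<bar>H\<bar> < \<eta>" "h (bent lam H b) lam = \<epsilon>" using hit[OF near s(1) \<eta>d] by (auto simp: H_def)
  have \<theta>0: "0 < \<theta>" "\<theta> < \<tau>" using \<theta> s by linarith+
  have \<xi>b: "\<xi> r = bent lam (r + \<theta>) b" if "r \<in> {-\<tau>..0}" for r
    using \<xi>[of r] that by (cases "r \<le> -\<theta>") (auto simp: bent_neg bent_pos)
  have s1: "\<bar>s1 + \<Delta>\<bar> \<le> \<eta>" "\<forall>s\<in>{-\<tau>..<s1}. h (\<xi> s) lam < \<epsilon>" "\<epsilon> \<le> h (\<xi> s1) lam"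
    using adm by (auto simp: admissible_def)
  have "- \<tau> \<le> s1" "s1 \<le> 0" "\<bar>s1 + \<theta>\<bar> < d" using s1(1) \<theta> s by linarith+
  then have s1': "s1 \<in> {-\<tau>..0}" "\<bar>s1 + \<theta>\<bar> < d" by auto
  have "\<not> s1 + \<theta> < H"
  proof
    assume "s1 + \<theta> < H"
    then have "h (bent lam (s1 + \<theta>) b) lam < h (bent lam H b) lam"
      using h_bent_strict_mono[OF b, of "s1 + \<theta>" H] s1' H(1) \<eta>d by (simp add: abs_less_iff)
    then show False using H(2) s1(3) \<xi>b[OF s1'(1)] by simp
  qed
  \<comment> \<open>Otherwise \<open>H - \<theta>\<close> would be a time before \<open>s1\<close>
    at which \<open>h\<close> equals \<open>\<epsilon>\<close>.\<close>
  moreover have "\<not> H < s1 + \<theta>"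
  proof
    assume "H < s1 + \<theta>"
    moreover have "- \<tau> \<le> H - \<theta>" using H(1) \<theta> s by linarith
    ultimately have "H - \<theta> \<in> {-\<tau>..<s1}" "H - \<theta> \<in> {-\<tau>..0}" using s1'(1) by auto
    then show False using s1(2) \<xi>b[of "H - \<theta>"] H(2) by fastforce
  qed
  ultimately have "s1 + \<theta> = H" by simp
  then have "flow f 1 lam (\<tau> + s1) (\<xi> 0) = flow f 1 lam (\<tau> + H) b"
    using \<xi>(1)[of 0] \<theta>0 flow_add[of 1 lam "\<tau> + s1" \<theta> b] by (simp add: add.assoc)
  then show ?thesis by (simp add: first_switch_def half_return_def H_def)
qed

text \<open>Strict inequalities along compact arcs of the orbit persist for nearby histories and
  parameters. History time \<open>t\<close> corresponds to orbit time \<open>\<Delta> + t\<close>,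
  so the delay window starts at \<open>\<Delta> - \<tau>\<close>, strictly after the corner at
  \<open>-\<tau>\<close>.\<close>

lemma admissible_exists:
  assumes sz: "sizes \<Delta> \<rho> \<eta>" and r: "0 < r"
  shows "\<exists>\<delta>>0. \<forall>\<xi> lam. continuous_on {-\<Theta>..0} \<xi> \<longrightarrow>
      (\<forall>\<theta>\<in>{-\<Theta>..0}. dist (\<xi> \<theta>) (ys (\<Delta> + \<theta>)) < \<delta>) \<longrightarrow> dist lam lam0 < \<delta> \<longrightarrow>
      (\<exists>s1. admissible \<Delta> \<eta> lam \<xi> s1 \<and> dist (first_switch lam \<xi> s1) (ys 0) < r)"
proof -
  have s: "0 < \<eta>" "8 * \<eta> \<le> \<rho>" "4 * \<rho> \<le> \<Delta>" "4 * \<Delta> \<le> d" "d < \<tau> / 4"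
    using sz d_less by (auto simp: sizes_def)
  have \<Delta>: "0 < \<Delta>" "\<Delta> < d" "\<Delta> < \<tau>" using s by linarith+
  have flow_ys: "flow f 1 lam0 t (ys \<Delta>) = ys (t + \<Delta>)" if "t \<in> {0..\<tau> - \<Delta>}" for t
    using ys_flow_plus[of "t + \<Delta>"] ys_flow_plus[of \<Delta>] flow_add[of 1 lam0 t \<Delta> "ys 0"] that \<Delta> by simp
  let ?S = "{(lam, t, y). dist (- flow f 1 lam t y) (ys 0) < r}"
  have "open ?S"
    unfolding split_beta by (intro open_Collect_less continuous_intros flow_continuous_comp) auto
  moreover have "(lam0, \<tau> - \<Delta>, ys \<Delta>) \<in> ?S"
    using flow_ys[of "\<tau> - \<Delta>"] ys_\<tau> \<Delta> r by simp
  ultimately obtain e where e: "e > 0" "\<And>lam t y. dist lam lam0 < e \<Longrightarrow> dist t (\<tau> - \<Delta>) < e \<Longrightarrow>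
      dist y (ys \<Delta>) < e \<Longrightarrow> (lam, t, y) \<in> ?S"
    using triple_box_in_open[of ?S lam0 "\<tau> - \<Delta>" "ys \<Delta>"] by blast
  \<comment> \<open>The precision in locating \<open>s1\<close>: at most \<eta> for
    \<open>admissible\<close>, and below \<open>e\<close> so that \<open>first_switch\<close> falls
    within \<open>r\<close> of \<open>ys 0\<close>.\<close>
  define \<zeta> where "\<zeta> = min \<eta> (e / 2)"
  have \<zeta>: "0 < \<zeta>" "\<zeta> \<le> \<eta>" "\<zeta> < e" using s e by (auto simp: \<zeta>_def)
  let ?h = "\<lambda>p. h (fst p) (snd p)"
  have hc: "continuous_on UNIV ?h" "continuous_on UNIV (\<lambda>p. - ?h p)"
    by (intro continuous_intros)+
  have gc: "continuous_on S (\<lambda>t. (ys t, lam0))" for S by (intro continuous_intros ys_continuous)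
  have h_inc: "h (ys s) lam0 < h (ys t) lam0" if "- d < s" "s < t" "t < d" for s t
  proof -
    have bent: "ys q = bent lam0 q (ys 0)" if "\<bar>q\<bar> < d" for q
      using ys_flow_minus[of q] ys_flow_plus[of q] that s by (cases "q \<le> 0") (auto simp: bent_neg bent_pos)
    show ?thesis using h_bent_strict_mono[of lam0 "ys 0" s t] bent[of s] bent[of t] that d_pos by auto
  qed
  have A: "\<exists>\<delta>>0. \<forall>s\<in>{\<Delta> - \<tau>..-\<zeta>}. \<forall>x. dist x (ys s, lam0) < \<delta> \<longrightarrow> - \<epsilon> < - ?h x"
    by (rule compact_image_neighbourhood[OF hc(2) gc]) (use h_ys_less \<Delta> \<zeta> in auto)
  have up: "\<exists>\<delta>>0. \<forall>s\<in>{\<zeta>}. \<forall>x. dist x (ys s, lam0) < \<delta> \<longrightarrow> \<epsilon> < ?h x"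
    by (rule compact_image_neighbourhood[OF hc(1) gc])
      (use h_inc[of 0 \<zeta>] \<zeta> s d_pos ys_on_section in auto)
  \<comment> \<open>Here \<open>ys (\<Delta> - \<tau>) = - ys \<Delta>\<close>, and between times 0
    and \<Delta> the function \<open>h\<close> has grown beyond \<open>\<epsilon>\<close>.\<close>
  have B: "\<exists>\<delta>>0. \<forall>s\<in>{\<Delta> - \<tau>}. \<forall>x. dist x (ys s, lam0) < \<delta> \<longrightarrow> \<epsilon> < - ?h x"
    by (rule compact_image_neighbourhood[OF hc(2) gc])
      (use h_inc[of 0 \<Delta>] \<Delta> d_pos ys_on_section ys_shift[of \<Delta>] in \<open>auto simp: h_odd\<close>)
  have C: "\<exists>\<delta>>0. \<forall>s\<in>{-\<zeta>..\<Delta>}. \<forall>x. dist x (ys s, lam0) < \<delta> \<longrightarrow> - \<epsilon> < ?h x"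
  proof (rule compact_image_neighbourhood[OF hc(1) gc])
    fix q assume q: "q \<in> {-\<zeta>..\<Delta>}"
    have bent: "ys q = bent lam0 q (ys 0)"
      using ys_flow_minus[of q] ys_flow_plus[of q] q s \<zeta> by (cases "q \<le> 0") (auto simp: bent_neg bent_pos)
    have "0 < h (ys q) lam0"
      unfolding bent by (rule h_bent_pos) (use q s \<zeta> d_pos in auto)
    then show "- \<epsilon> < ?h (ys q, lam0)" using pos by simp
  qed auto
  have D: "\<exists>\<delta>>0. \<forall>t\<in>{0..\<tau> - \<Delta> - \<eta>}. \<forall>x. dist x (lam0, t, ys \<Delta>) < \<delta> \<longrightarrow>
      - \<epsilon> < h (flow f 1 (fst x) (fst (snd x)) (snd (snd x))) (fst x)"
  proof (rule compact_image_neighbourhood)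
    show "continuous_on UNIV (\<lambda>x. h (flow f 1 (fst x) (fst (snd x)) (snd (snd x))) (fst x))"
      by (intro continuous_intros flow_continuous_comp) auto
    show "continuous_on {0..\<tau> - \<Delta> - \<eta>} (\<lambda>t. (lam0, t, ys \<Delta>))" by (intro continuous_intros)
    fix t assume t: "t \<in> {0..\<tau> - \<Delta> - \<eta>}"
    show "- \<epsilon> < h (flow f 1 (fst (lam0, t, ys \<Delta>)) (fst (snd (lam0, t, ys \<Delta>)))
        (snd (snd (lam0, t, ys \<Delta>)))) (fst (lam0, t, ys \<Delta>))"
      using flow_ys[of t] h_ys_greater[of "t + \<Delta>"] t \<Delta> s by simp
  qed simp
  obtain \<delta>A where \<delta>A: "\<delta>A > 0" "\<And>s y lam. s \<in> {\<Delta> - \<tau>..-\<zeta>} \<Longrightarrow> dist (y, lam) (ys s, lam0) < \<delta>A \<Longrightarrow>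
      h y lam < \<epsilon>" using A by fastforce
  obtain \<delta>U where \<delta>U: "\<delta>U > 0" "\<And>y lam. dist (y, lam) (ys \<zeta>, lam0) < \<delta>U \<Longrightarrow> \<epsilon> < h y lam"
    using up by fastforce
  obtain \<delta>B where \<delta>B: "\<delta>B > 0" "\<And>y lam. dist (y, lam) (ys (\<Delta> - \<tau>), lam0) < \<delta>B \<Longrightarrow> h y lam < - \<epsilon>"
    using B by fastforce
  obtain \<delta>C where \<delta>C: "\<delta>C > 0" "\<And>s y lam. s \<in> {-\<zeta>..\<Delta>} \<Longrightarrow> dist (y, lam) (ys s, lam0) < \<delta>C \<Longrightarrow>
      - \<epsilon> < h y lam" using C by fastforce
  obtain \<delta>D where \<delta>D: "\<delta>D > 0" "\<And>t y lam. t \<in> {0..\<tau> - \<Delta> - \<eta>} \<Longrightarrow>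
      dist (lam, t, y) (lam0, t, ys \<Delta>) < \<delta>D \<Longrightarrow> - \<epsilon> < h (flow f 1 lam t y) lam" using D by fastforce
  define m where "m = min (min \<delta>A \<delta>U) (min (min \<delta>B \<delta>C) \<delta>D)"
  define \<delta> where "\<delta> = min (m / 2) e"
  show ?thesis
  proof (rule exI[of _ \<delta>], intro conjI allI impI)
    show "0 < \<delta>" using \<delta>A \<delta>U \<delta>B \<delta>C \<delta>D e by (simp add: \<delta>_def m_def)
    fix \<xi> lam assume c\<xi>: "continuous_on {-\<Theta>..0} \<xi>"
      and close: "\<forall>\<theta>\<in>{-\<Theta>..0}. dist (\<xi> \<theta>) (ys (\<Delta> + \<theta>)) < \<delta>" and lam: "dist lam lam0 < \<delta>"
    have near: "dist (\<xi> t, lam) (ys (\<Delta> + t), lam0) < m" if "t \<in> {-\<tau>..0}" for t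
    proof -
      have "dist (\<xi> t, lam) (ys (\<Delta> + t), lam0) \<le> dist (\<xi> t) (ys (\<Delta> + t)) + dist lam lam0"
        unfolding dist_Pair_Pair by (rule sqrt_sum_squares_le_sum) auto
      also have "\<dots> < \<delta> + \<delta>" using close that \<tau>_le lam by (intro add_strict_mono) auto
      finally show ?thesis by (simp add: \<delta>_def)
    qed
    have near0: "dist (lam, t, \<xi> 0) (lam0, t, ys \<Delta>) < m" for t
    proof -
      have "dist (lam, t, \<xi> 0) (lam0, t, ys \<Delta>) = dist (\<xi> 0, lam) (ys \<Delta>, lam0)"
        by (simp add: dist_Pair_Pair add.commute)
      then show ?thesis using near[of 0] pos by simp
    qed
    have hA: "h (\<xi> t) lam < \<epsilon>" if "t \<in> {-\<tau>..-\<Delta> - \<zeta>}" for t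
      using \<delta>A(2)[of "\<Delta> + t" "\<xi> t" lam] near[of t] that \<zeta> \<Delta> by (simp add: m_def)
    have hU: "\<epsilon> < h (\<xi> (\<zeta> - \<Delta>)) lam"
      using \<delta>U(2)[of "\<xi> (\<zeta> - \<Delta>)" lam] near[of "\<zeta> - \<Delta>"] \<zeta> \<Delta> s by (simp add: m_def)
    \<comment> \<open>A history that is merely close in the sup norm may oscillate through the level
      \<open>\<epsilon>\<close>; compactness of this set still provides a first time at or above
      it.\<close>
    define Z where "Z = {t \<in> {-\<tau>..\<zeta> - \<Delta>}. \<epsilon> \<le> h (\<xi> t) lam}"
    have "closed ({-\<tau>..\<zeta> - \<Delta>} \<inter> (\<lambda>t. h (\<xi> t) lam) -` {\<epsilon>..})"
      by (intro continuous_closed_preimage continuous_intros continuous_on_subset[OF c\<xi>])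
        (use \<tau>_le \<zeta> \<Delta> s in auto)
    also have "{-\<tau>..\<zeta> - \<Delta>} \<inter> (\<lambda>t. h (\<xi> t) lam) -` {\<epsilon>..} = Z" by (auto simp: Z_def)
    finally have "closed Z" .
    moreover have "bounded Z" by (rule bounded_subset[of "{-\<tau>..\<zeta> - \<Delta>}"]) (auto simp: Z_def)
    ultimately have "compact Z" by (simp add: compact_eq_bounded_closed)
    moreover have "\<zeta> - \<Delta> \<in> Z" using hU \<zeta> \<Delta> by (auto simp: Z_def)
    ultimately obtain s1 where s1: "s1 \<in> Z" "\<And>t. t \<in> Z \<Longrightarrow> s1 \<le> t"
      using compact_attains_inf[of Z] by auto
    have s1': "- \<Delta> - \<zeta> < s1" "s1 \<le> \<zeta> - \<Delta>" "- \<tau> \<le> s1"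
      using s1(1) hA[of s1] by (auto simp: Z_def not_less[symmetric])
    have before: "h (\<xi> t) lam < \<epsilon>" if "t \<in> {-\<tau>..<s1}" for t
      using s1(2)[of t] that s1' by (force simp: Z_def not_less[symmetric])
    have "admissible \<Delta> \<eta> lam \<xi> s1"
      unfolding admissible_def
    proof (intro conjI ballI c\<xi>)
      show "\<bar>s1 + \<Delta>\<bar> \<le> \<eta>" using s1' \<zeta> by auto
      show "\<epsilon> \<le> h (\<xi> s1) lam" using s1(1) by (simp add: Z_def)
      show "h (\<xi> (-\<tau>)) lam \<le> - \<epsilon>"
        using \<delta>B(2)[of "\<xi> (-\<tau>)" lam] near[of "-\<tau>"] pos by (simp add: m_def)
      show "- \<epsilon> < h (\<xi> t) lam" if "t \<in> {s1..0}" for t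
        using \<delta>C(2)[of "\<Delta> + t" "\<xi> t" lam] near[of t] that s1' by (simp add: m_def)
      show "- \<epsilon> < h (flow f 1 lam t (\<xi> 0)) lam" if "t \<in> {0..\<tau> - \<Delta> - \<eta>}" for t
        using \<delta>D(2)[OF that, of lam "\<xi> 0"] near0[of t] by (simp add: m_def)
    qed (rule before)
    moreover have "dist (first_switch lam \<xi> s1) (ys 0) < r"
    proof -
      have "dist (\<xi> 0) (ys \<Delta>) < \<delta>" using close \<tau>_le pos by (auto dest: bspec[of _ _ 0])
      then have "(lam, \<tau> + s1, \<xi> 0) \<in> ?S"
        using lam s1' \<zeta> by (intro e(2)) (auto simp: \<delta>_def dist_real_def)
      then show ?thesis by (simp add: first_switch_def)
    qed
    ultimately show "\<exists>s1. admissible \<Delta> \<eta> lam \<xi> s1 \<and> dist (first_switch lam \<xi> s1) (ys 0) < r" by blast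
  qed
qed

text \<open>All smallness enters as a hypothesis, so that only radii remain to be chosen afterwards.
  Two balls occur because \<open>F\<close> is applied on \<open>U0\<close> and then on its image in
  \<open>U1\<close>.\<close>

lemma return_map_of_small_sections:
  assumes sz: "sizes \<Delta> \<rho> (\<rho> / 8)" and r0: "\<And>lam y. dist lam lam0 < r0 \<Longrightarrow> dist y (ys 0) < r0 \<Longrightarrow>
      nearby (\<rho> / 8) lam y \<and> dist (half_return lam y) (ys 0) < r1"
    and r1: "\<And>lam y. dist lam lam0 < r1 \<Longrightarrow> dist y (ys 0) < r1 \<Longrightarrow> nearby (\<rho> / 8) lam y"
    and \<delta>: "\<And>\<xi>. \<xi> \<in> S1 \<Longrightarrow> \<exists>s1. admissible \<Delta> (\<rho> / 8) lam \<xi> s1 \<and>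
      nearby (\<rho> / 8) lam (first_switch lam \<xi> s1) \<and>
      dist (half_return lam (first_switch lam \<xi> s1)) (ys 0) < r0 \<and>
      crosses \<Delta> \<rho> lam (half_return lam (first_switch lam \<xi> s1))"
    and lam: "dist lam lam0 < r0" "dist lam lam0 < r1"
  shows "let U0 = ball (ys 0) r0;
            U1 = ball (ys 0) r1;
            Yp = flow f 1 lam;
            Ym = flow f (-1) lam;
            P = poincare_map (E lam) (\<Gamma> \<Delta>) \<tau> \<rho>;
            sp = switching_point (E lam) Yp Ym (\<Gamma> \<Delta>) \<tau> \<rho> \<tau> \<Delta> U0;
            m = return_map P S1 sp;
            F = half_return_map Yp Ym (\<lambda>y. h y lam) \<epsilon> \<tau> \<Delta>
        in (\<forall>\<xi>\<in>S1. (\<exists>!t. is_return_time (E lam) (\<Gamma> \<Delta>) \<tau> \<rho> \<xi> t) \<and>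
                     snd (E lam (return_time (E lam) (\<Gamma> \<Delta>) \<tau> \<rho> \<xi>) (\<xi>, 1)) = 1 \<and>
                     (\<exists>!y. is_switching_point (E lam) Yp Ym (\<Gamma> \<Delta>) \<tau> \<rho> \<tau> \<Delta> U0 \<xi> y)) \<and>
           (\<forall>y\<in>U0 \<union> U1. \<exists>!t. is_hitting_time Yp Ym (\<lambda>y. h y lam) \<epsilon> \<Delta> y t) \<and>
           F ` U0 \<subseteq> U1 \<and>
           (\<forall>\<eta>\<in>S1. P \<eta> \<in> S1 \<longrightarrow>
              m (sp \<eta>) = sp (P \<eta>) \<and> m (sp \<eta>) = (F \<circ> F) (sp \<eta>))"
proof -
  define \<eta> where "\<eta> = \<rho> / 8"
  have s: "0 < \<eta>" "8 * \<eta> \<le> \<rho>" "4 * \<rho> \<le> \<Delta>" "4 * \<Delta> \<le> d" "d < \<tau> / 4"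
    using sz d_less by (auto simp: sizes_def \<eta>_def)
  have \<eta>: "0 < \<eta>" "\<eta> < d" "\<eta> \<le> \<Delta>" "\<Delta> \<le> d" using s by linarith+
  define U0 where "U0 = ball (ys 0) r0"
  define U1 where "U1 = ball (ys 0) r1"
  define sp where "sp = switching_point (E lam) (flow f 1 lam) (flow f (-1) lam) (\<Gamma> \<Delta>) \<tau> \<rho> \<tau> \<Delta> U0"
  define F where "F = half_return_map (flow f 1 lam) (flow f (-1) lam) (\<lambda>y. h y lam) \<epsilon> \<tau> \<Delta>"
  have near: "nearby \<eta> lam y" if "y \<in> U0 \<union> U1" for y
    using that r0[of lam y] r1[of lam y] lam by (auto simp: U0_def U1_def dist_commute \<eta>_def)
  have F: "F y = half_return lam y" if "y \<in> U0 \<union> U1" for y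
    unfolding F_def by (rule half_return_map_eq[OF near[OF that] \<eta>])
  have F_image: "F y \<in> U1" if "y \<in> U0" for y
    using that r0[of lam y] F[of y] lam by (simp add: U0_def U1_def dist_commute)
  have struct: "\<exists>s1 tr \<theta>. admissible \<Delta> \<eta> lam \<xi> s1 \<and>
      (\<forall>t. is_return_time (E lam) (\<Gamma> \<Delta>) \<tau> \<rho> \<xi> t \<longleftrightarrow> t = tr) \<and> snd (E lam tr (\<xi>, 1)) = 1 \<and>
      sp \<xi> = half_return lam (first_switch lam \<xi> s1) \<and> sp \<xi> \<in> U0 \<and>
      (\<forall>y. is_switching_point (E lam) (flow f 1 lam) (flow f (-1) lam) (\<Gamma> \<Delta>) \<tau> \<rho> \<tau> \<Delta> U0 \<xi> y
        \<longleftrightarrow> y = sp \<xi>) \<and> \<bar>\<theta> - \<Delta>\<bar> < \<rho> / 2 \<and>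
      (\<forall>s\<in>{-\<theta>..0}. P \<Delta> \<rho> lam \<xi> s = flow f 1 lam (s + \<theta>) (sp \<xi>)) \<and>
      (\<forall>s\<in>{-\<tau>..-\<theta>}. P \<Delta> \<rho> lam \<xi> s = flow f (-1) lam (s + \<theta>) (sp \<xi>))" if \<xi>: "\<xi> \<in> S1" for \<xi>
  proof -
    obtain s1 where s1: "admissible \<Delta> \<eta> lam \<xi> s1" "nearby \<eta> lam (first_switch lam \<xi> s1)"
      "dist (half_return lam (first_switch lam \<xi> s1)) (ys 0) < r0"
      "crosses \<Delta> \<rho> lam (half_return lam (first_switch lam \<xi> s1))"
      using \<delta>[OF \<xi>] unfolding \<eta>_def by blast
    define b where "b = half_return lam (first_switch lam \<xi> s1)"
    have bU: "b \<in> U0" using s1(3) by (simp add: b_def U0_def dist_commute)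
    from return_structure[OF sz[folded \<eta>_def] s1(1,2,4)] obtain tr \<theta> where
      ret: "\<And>t. is_return_time (E lam) (\<Gamma> \<Delta>) \<tau> \<rho> \<xi> t \<longleftrightarrow> t = tr" and
      \<theta>: "\<bar>\<theta> - \<Delta>\<bar> < \<rho> / 2" "flow f 1 lam \<theta> b \<in> \<Gamma> \<Delta>" and
      P: "\<And>s. s \<in> {-\<theta>..0} \<Longrightarrow> P \<Delta> \<rho> lam \<xi> s = flow f 1 lam (s + \<theta>) b"
        "\<And>s. s \<in> {-\<tau>..-\<theta>} \<Longrightarrow> P \<Delta> \<rho> lam \<xi> s = flow f (-1) lam (s + \<theta>) b" and
      u: "\<And>s. s \<in> {-\<theta>..0} \<Longrightarrow> snd (E lam (tr + s) (\<xi>, 1)) = 1"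
        "\<And>s. s \<in> {-\<tau>..<-\<theta>} \<Longrightarrow> snd (E lam (tr + s) (\<xi>, 1)) = -1"
      unfolding b_def[symmetric] by blast
    have iff: "is_switching_point (E lam) (flow f 1 lam) (flow f (-1) lam) (\<Gamma> \<Delta>) \<tau> \<rho> \<tau> \<Delta> U0 \<xi> y
        \<longleftrightarrow> y = b" for y
      by (rule is_switching_point_iff[OF sz[folded \<eta>_def] ret \<theta> P u bU])
    have sp: "sp \<xi> = b" by (simp add: sp_def switching_point_def iff)
    have "0 \<le> \<theta>" using \<theta>(1) s by linarith
    then have u0: "snd (E lam tr (\<xi>, 1)) = 1" using u(1)[of 0] by simp
    show ?thesis
      by (rule exI[of _ s1], rule exI[of _ tr], rule exI[of _ \<theta>], fold b_def)
        (use s1(1) ret sp bU iff \<theta>(1) P u0 in auto)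
  qed
  \<comment> \<open>The core identity. The image \<open>P \<Delta> \<rho> lam \<xi>\<close> bends at
    \<open>sp \<xi>\<close>, so its first switch is at \<open>F (sp \<xi>)\<close> up to reflection,
    and the switching point after the next return is \<open>F\<close> of that.\<close>
  have sp_P: "sp (P \<Delta> \<rho> lam \<xi>) = F (F (sp \<xi>))" if \<xi>: "\<xi> \<in> S1" "P \<Delta> \<rho> lam \<xi> \<in> S1" for \<xi>
  proof -
    obtain \<theta> where \<theta>: "sp \<xi> \<in> U0" "\<bar>\<theta> - \<Delta>\<bar> < \<rho> / 2"
      "\<And>s. s \<in> {-\<theta>..0} \<Longrightarrow> P \<Delta> \<rho> lam \<xi> s = flow f 1 lam (s + \<theta>) (sp \<xi>)"
      "\<And>s. s \<in> {-\<tau>..-\<theta>} \<Longrightarrow> P \<Delta> \<rho> lam \<xi> s = flow f (-1) lam (s + \<theta>) (sp \<xi>)"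
      using struct[OF \<xi>(1)] by blast
    obtain s1 where s1: "admissible \<Delta> \<eta> lam (P \<Delta> \<rho> lam \<xi>) s1"
      "sp (P \<Delta> \<rho> lam \<xi>) = half_return lam (first_switch lam (P \<Delta> \<rho> lam \<xi>) s1)"
      using struct[OF \<xi>(2)] by blast
    have n: "nearby \<eta> lam (sp \<xi>)" using near \<theta>(1) by simp
    have "first_switch lam (P \<Delta> \<rho> lam \<xi>) s1 = F (sp \<xi>)"
      using first_switch_of_return[OF sz[folded \<eta>_def] s1(1) n \<theta>(2-4)] F \<theta>(1) by simp
    then show ?thesis using s1(2) F[of "F (sp \<xi>)"] F_image[OF \<theta>(1)] by simp
  qed
  \<comment> \<open>By \<open>sp_P\<close> the next switching point depends on
    \<open>sp \<xi>\<close> alone and not on the preimage chosen, so the definite description is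
    legitimate.\<close>
  have m: "return_map (P \<Delta> \<rho> lam) S1 sp (sp \<xi>) = F (F (sp \<xi>))" if "\<xi> \<in> S1" "P \<Delta> \<rho> lam \<xi> \<in> S1" for \<xi>
    unfolding return_map_def
  proof (rule the_equality)
    show "\<exists>\<eta>\<in>S1. P \<Delta> \<rho> lam \<eta> \<in> S1 \<and> sp \<eta> = sp \<xi> \<and> sp (P \<Delta> \<rho> lam \<eta>) = F (F (sp \<xi>))"
      using that sp_P by blast
    show "y' = F (F (sp \<xi>))"
      if "\<exists>\<eta>\<in>S1. P \<Delta> \<rho> lam \<eta> \<in> S1 \<and> sp \<eta> = sp \<xi> \<and> sp (P \<Delta> \<rho> lam \<eta>) = y'" for y'
      using that sp_P by metis
  qed
  have first: "(\<exists>!t. is_return_time (E lam) (\<Gamma> \<Delta>) \<tau> \<rho> \<xi> t) \<and>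
      snd (E lam (return_time (E lam) (\<Gamma> \<Delta>) \<tau> \<rho> \<xi>) (\<xi>, 1)) = 1 \<and>
      (\<exists>!y. is_switching_point (E lam) (flow f 1 lam) (flow f (-1) lam) (\<Gamma> \<Delta>) \<tau> \<rho> \<tau> \<Delta> U0 \<xi> y)"
    if \<xi>: "\<xi> \<in> S1" for \<xi>
  proof -
    obtain tr where tr: "\<And>t. is_return_time (E lam) (\<Gamma> \<Delta>) \<tau> \<rho> \<xi> t \<longleftrightarrow> t = tr"
      "snd (E lam tr (\<xi>, 1)) = 1"
      "\<And>y. is_switching_point (E lam) (flow f 1 lam) (flow f (-1) lam) (\<Gamma> \<Delta>) \<tau> \<rho> \<tau> \<Delta> U0 \<xi> y
        \<longleftrightarrow> y = sp \<xi>"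
      using struct[OF \<xi>] by blast
    then show ?thesis by (simp add: return_time_def)
  qed
  show ?thesis
    unfolding Let_def U0_def[symmetric] U1_def[symmetric] sp_def[symmetric] F_def[symmetric]
    using first hitting_time_unique[OF near \<eta>] F_image m sp_P by auto
qed

text \<open>The order of the quantifiers follows the dependence of the thresholds: \<open>rn\<close>
  on \<rho>, \<open>rF\<close> on \<open>r1\<close>, \<open>rc\<close> on \<Delta> and \<rho>,
  \<open>rG\<close> on \<open>r0\<close> and \<open>rc\<close>, and \<open>\<delta>0\<close> on the
  scales, \<open>rn\<close> and \<open>rG\<close>. The closeness of \<open>lam\<close> comes
  last.\<close>

lemma return_map_eventually:
  "\<forall>\<^sub>F \<Delta> in at_right 0. \<forall>\<^sub>F \<rho> in at_right 0. \<forall>\<^sub>F r1 in at_right 0. \<forall>\<^sub>F r0 in at_right 0.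
     \<forall>\<^sub>F \<delta> in at_right 0. \<forall>\<^sub>F lam in nhds lam0.
       (let U0 = ball (ys 0) r0;
            U1 = ball (ys 0) r1;
            E = evolution f h \<epsilon> \<tau> \<Theta> lam;
            Yp = flow f 1 lam;
            Ym = flow f (-1) lam;
            \<Gamma> = section_plane f lam0 ys \<Delta>;
            S1 = local_section \<Theta> ys \<Gamma> \<Delta> \<delta>;
            P = poincare_map E \<Gamma> \<tau> \<rho>;
            sp = switching_point E Yp Ym \<Gamma> \<tau> \<rho> \<tau> \<Delta> U0;
            m = return_map P S1 sp;
            F = half_return_map Yp Ym (\<lambda>y. h y lam) \<epsilon> \<tau> \<Delta>
        in (\<forall>\<xi>\<in>S1. (\<exists>!t. is_return_time E \<Gamma> \<tau> \<rho> \<xi> t) \<and>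
                     snd (E (return_time E \<Gamma> \<tau> \<rho> \<xi>) (\<xi>, 1)) = 1 \<and>
                     (\<exists>!y. is_switching_point E Yp Ym \<Gamma> \<tau> \<rho> \<tau> \<Delta> U0 \<xi> y)) \<and>
           (\<forall>y\<in>U0 \<union> U1. \<exists>!t. is_hitting_time Yp Ym (\<lambda>y. h y lam) \<epsilon> \<Delta> y t) \<and>
           F ` U0 \<subseteq> U1 \<and>
           (\<forall>\<eta>\<in>S1. P \<eta> \<in> S1 \<longrightarrow>
              m (sp \<eta>) = sp (P \<eta>) \<and> m (sp \<eta>) = (F \<circ> F) (sp \<eta>)))"
  (is "\<forall>\<^sub>F \<Delta> in _. \<forall>\<^sub>F \<rho> in _. \<forall>\<^sub>F r1 in _. \<forall>\<^sub>F r0 in _. \<forall>\<^sub>F \<delta> in _. \<forall>\<^sub>F lam in _.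
     ?\<Phi> \<Delta> \<rho> r1 r0 \<delta> lam")
proof (rule eventually_at_rightI[of 0 "d / 4"])
  fix \<Delta> assume \<Delta>: "\<Delta> \<in> {0<..<d / 4}"
  show "\<forall>\<^sub>F \<rho> in at_right 0. \<forall>\<^sub>F r1 in at_right 0. \<forall>\<^sub>F r0 in at_right 0.
     \<forall>\<^sub>F \<delta> in at_right 0. \<forall>\<^sub>F lam in nhds lam0. ?\<Phi> \<Delta> \<rho> r1 r0 \<delta> lam"
  proof (rule eventually_at_rightI[of 0 "\<Delta> / 4"])
    fix \<rho> assume \<rho>: "\<rho> \<in> {0<..<\<Delta> / 4}"
    have sz: "sizes \<Delta> \<rho> (\<rho> / 8)" using \<Delta> \<rho> by (simp add: sizes_def)
    have "0 < \<rho> / 8" "\<rho> / 8 < d" using \<Delta> \<rho> by auto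
    then obtain rn where rn: "0 < rn"
      "\<And>lam y. dist lam lam0 < rn \<Longrightarrow> dist y (ys 0) < rn \<Longrightarrow> nearby (\<rho> / 8) lam y"
      using nearby_eventually by blast
    show "\<forall>\<^sub>F r1 in at_right 0. \<forall>\<^sub>F r0 in at_right 0.
     \<forall>\<^sub>F \<delta> in at_right 0. \<forall>\<^sub>F lam in nhds lam0. ?\<Phi> \<Delta> \<rho> r1 r0 \<delta> lam"
    proof (rule eventually_at_rightI[of 0 rn])
      fix r1 assume r1: "r1 \<in> {0<..<rn}"
      then obtain rF where rF: "0 < rF"
        "\<And>lam y. dist lam lam0 < rF \<Longrightarrow> dist y (ys 0) < rF \<Longrightarrow> dist (half_return lam y) (ys 0) < r1"
        using half_return_near[of r1] by auto
      show "\<forall>\<^sub>F r0 in at_right 0. \<forall>\<^sub>F \<delta> in at_right 0. \<forall>\<^sub>F lam in nhds lam0. ?\<Phi> \<Delta> \<rho> r1 r0 \<delta> lam"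
      proof (rule eventually_at_rightI[of 0 "min rn rF"])
        fix r0 assume r0: "r0 \<in> {0<..<min rn rF}"
        obtain rc where rc: "0 < rc"
          "\<And>lam b. dist lam lam0 < rc \<Longrightarrow> dist b (ys 0) < rc \<Longrightarrow> crosses \<Delta> \<rho> lam b"
          using crosses_eventually[of \<rho> \<Delta>] \<Delta> \<rho> by auto
        \<comment> \<open>The switching point has to land in \<open>U0\<close>, hence
          \<open>r0\<close>, and where the section plane is crossed, hence
          \<open>rc\<close>.\<close>
        obtain rG where rG: "0 < rG" "\<And>lam y. dist lam lam0 < rG \<Longrightarrow> dist y (ys 0) < rG \<Longrightarrow>
            dist (half_return lam y) (ys 0) < min r0 rc"
          using half_return_near[of "min r0 rc"] r0 rc(1) by auto
        have "0 < min rn rG" using rn rG by simp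
        from admissible_exists[OF sz this] obtain \<delta>0 where \<delta>0: "0 < \<delta>0"
          "\<And>\<xi> lam. continuous_on {-\<Theta>..0} \<xi> \<Longrightarrow>
            (\<And>\<theta>. \<theta> \<in> {-\<Theta>..0} \<Longrightarrow> dist (\<xi> \<theta>) (ys (\<Delta> + \<theta>)) < \<delta>0) \<Longrightarrow> dist lam lam0 < \<delta>0 \<Longrightarrow>
            \<exists>s1. admissible \<Delta> (\<rho> / 8) lam \<xi> s1 \<and> dist (first_switch lam \<xi> s1) (ys 0) < min rn rG"
          by blast
        show "\<forall>\<^sub>F \<delta> in at_right 0. \<forall>\<^sub>F lam in nhds lam0. ?\<Phi> \<Delta> \<rho> r1 r0 \<delta> lam"
        proof (rule eventually_at_rightI[of 0 \<delta>0])
          fix \<delta> assume \<delta>: "\<delta> \<in> {0<..<\<delta>0}"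
          define q where "q = min (min (min r0 r1) (min rn rF)) (min (min rc rG) \<delta>0)"
          have q: "0 < q" using r0 r1 rn rF rc rG \<delta>0 by (simp add: q_def)
          have "?\<Phi> \<Delta> \<rho> r1 r0 \<delta> lam" if "dist lam lam0 < q" for lam
          proof -
            have l: "dist lam lam0 < r0" "dist lam lam0 < r1" "dist lam lam0 < rn"
              "dist lam lam0 < rF" "dist lam lam0 < rc" "dist lam lam0 < rG" "dist lam lam0 < \<delta>0"
              using that by (auto simp: q_def)
            have S1: "\<exists>s1. admissible \<Delta> (\<rho> / 8) lam \<xi> s1 \<and>
                nearby (\<rho> / 8) lam (first_switch lam \<xi> s1) \<and>
                dist (half_return lam (first_switch lam \<xi> s1)) (ys 0) < r0 \<and>
                crosses \<Delta> \<rho> lam (half_return lam (first_switch lam \<xi> s1))"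
              if "\<xi> \<in> local_section \<Theta> ys (section_plane f lam0 ys \<Delta>) \<Delta> \<delta>" for \<xi>
            proof -
              have "continuous_on {-\<Theta>..0} \<xi>"
                "\<And>\<theta>. \<theta> \<in> {-\<Theta>..0} \<Longrightarrow> dist (\<xi> \<theta>) (ys (\<Delta> + \<theta>)) < \<delta>0"
                using that \<delta> by (force simp: local_section_def histories_def)+
              from \<delta>0(2)[OF this l(7)] obtain s1 where s1: "admissible \<Delta> (\<rho> / 8) lam \<xi> s1"
                "dist (first_switch lam \<xi> s1) (ys 0) < min rn rG" by blast
              then show ?thesis
                using rn(2)[OF l(3)] rG(2)[OF l(6)] rc(2)[OF l(5)] by (intro exI[of _ s1]) auto
            qed
            show ?thesis
              unfolding Let_def
              by (rule return_map_of_small_sections[OF sz _ _ S1 l(1,2), unfolded Let_def])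
                (use r0 r1 rn(2) rF(2) in auto)
          qed
          then show "\<forall>\<^sub>F lam in nhds lam0. ?\<Phi> \<Delta> \<rho> r1 r0 \<delta> lam"
            using q unfolding eventually_nhds_metric by blast
        qed (use \<delta>0 in auto)
      qed (use rn rF in auto)
    qed (use rn in auto)
  qed (use \<Delta> in auto)
qed (use d_pos in auto)

end

theorem theorem9:
  fixes f :: "real ^ 'n \<Rightarrow> real \<Rightarrow> real \<Rightarrow> real ^ 'n"
    and h :: "real ^ 'n \<Rightarrow> real \<Rightarrow> real"
    and \<epsilon> \<tau> \<Theta> lam0 T :: real
    and ys :: "real \<Rightarrow> real ^ 'n" and us :: "real \<Rightarrow> real"
  assumes system: "relay_system f h \<epsilon> \<tau> \<Theta>"
    and symmetry: "reflection_symmetric f h"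
    and orbit: "symmetric_periodic_orbit f h \<epsilon> \<tau> \<Theta> lam0 T ys us"
    and collision: "T = \<tau>"
    and transversality:
      "frechet_derivative (\<lambda>y. h y lam0) (at (ys 0)) (f (ys 0) (-1) lam0) *
       frechet_derivative (\<lambda>y. h y lam0) (at (ys 0)) (f (ys 0) 1 lam0) > 0"
  shows
    "\<forall>\<^sub>F \<Delta> in at_right 0. \<forall>\<^sub>F \<rho> in at_right 0. \<forall>\<^sub>F r1 in at_right 0. \<forall>\<^sub>F r0 in at_right 0.
     \<forall>\<^sub>F \<delta> in at_right 0. \<forall>\<^sub>F lam in nhds lam0.
       (let U0 = ball (ys 0) r0;
            U1 = ball (ys 0) r1;
            E = evolution f h \<epsilon> \<tau> \<Theta> lam;
            Yp = flow f 1 lam;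
            Ym = flow f (-1) lam;
            \<Gamma> = section_plane f lam0 ys \<Delta>;
            S1 = local_section \<Theta> ys \<Gamma> \<Delta> \<delta>;
            P = poincare_map E \<Gamma> T \<rho>;
            sp = switching_point E Yp Ym \<Gamma> T \<rho> \<tau> \<Delta> U0;
            m = return_map P S1 sp;
            F = half_return_map Yp Ym (\<lambda>y. h y lam) \<epsilon> \<tau> \<Delta>
        in (\<forall>\<xi>\<in>S1. (\<exists>!t. is_return_time E \<Gamma> T \<rho> \<xi> t) \<and>
                     snd (E (return_time E \<Gamma> T \<rho> \<xi>) (\<xi>, 1)) = 1 \<and>
                     (\<exists>!y. is_switching_point E Yp Ym \<Gamma> T \<rho> \<tau> \<Delta> U0 \<xi> y)) \<and>
           (\<forall>y\<in>U0 \<union> U1. \<exists>!t. is_hitting_time Yp Ym (\<lambda>y. h y lam) \<epsilon> \<Delta> y t) \<and>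
           F ` U0 \<subseteq> U1 \<and>
           (\<forall>\<eta>\<in>S1. P \<eta> \<in> S1 \<longrightarrow>
              m (sp \<eta>) = sp (P \<eta>) \<and> m (sp \<eta>) = (F \<circ> F) (sp \<eta>)))"
proof -
  interpret colliding_orbit f h \<epsilon> \<tau> \<Theta> lam0 ys us
    by unfold_locales (use system symmetry orbit collision transversality in auto)
  obtain d where "box_radius d" using box_radius_exists by blast
  then interpret local_orbit f h \<epsilon> \<tau> \<Theta> lam0 ys us d by unfold_locales
  show ?thesis using return_map_eventually unfolding collision .
qed

end
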